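(* Let $n\geq 3$, $1\leq q<n-1$ and $\frac{(n-1)q}{n-1-q}<p<\infty$. Then there exists a bounded domain $\Omega\subset\mathbb R^n$ which is a $(W^{1,p},W^{1,q})$-extension domain but not an $(L^{1,p},L^{1,q})$-extension domain.
   Context: For a domain $\Omega\subset\mathbb R^n$ and $1\leq p<\infty$: $L^{1,p}(\Omega)$ is the space of $u\in L^1_{\rm loc}(\Omega)$ that are weakly differentiable with $\nabla u\in L^p(\Omega;\mathbb R^n)$, with seminorm $\|\nabla u\|_{L^p(\Omega)}$; $W^{1,p}(\Omega)=L^{1,p}(\Omega)\cap L^p(\Omega)$ with norm $(\int_\Omega |u|^p+|\nabla u|^p)^{1/p}$. $\Omega$ is an $(\mathcal X,\mathcal Y)$-extension domain if there is an operator $E:\mathcal X(\Omega)\to\mathcal Y(\mathbb R^n)$ and $C>0$ with $E(u)|_\Omega=u$ and $\|E(u)\|_{\mathcal Y}\leq C\|u\|_{\mathcal X}$ for all $u\in\mathcal X(\Omega)$. *)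

theory Defs
  imports "HOL-Analysis.Analysis"
begin

fun Ck_on :: "nat \<Rightarrow> 'a::euclidean_space set \<Rightarrow> ('a \<Rightarrow> real) \<Rightarrow> bool" where
  "Ck_on 0 S f \<longleftrightarrow> continuous_on S f"
| "Ck_on (Suc k) S f \<longleftrightarrow> continuous_on S f \<and> (\<forall>x\<in>S. f differentiable (at x)) \<and>
     (\<forall>i\<in>Basis. Ck_on k S (\<lambda>x. frechet_derivative f (at x) i))"

definition smooth_fun :: "('a::euclidean_space \<Rightarrow> real) \<Rightarrow> bool" where
  "smooth_fun f \<longleftrightarrow> (\<forall>k. Ck_on k UNIV f)"

definition test_fun :: "'a::euclidean_space set \<Rightarrow> ('a \<Rightarrow> real) \<Rightarrow> bool" where
  "test_fun \<Omega> \<phi> \<longleftrightarrow> smooth_fun \<phi> \<and>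
     (\<exists>K. compact K \<and> K \<subseteq> \<Omega> \<and> (\<forall>x. x \<notin> K \<longrightarrow> \<phi> x = 0))"

definition pderiv_i :: "('a::euclidean_space \<Rightarrow> real) \<Rightarrow> 'a \<Rightarrow> 'a \<Rightarrow> real" where
  "pderiv_i \<phi> i x = frechet_derivative \<phi> (at x) i"

definition L1loc :: "'a::euclidean_space set \<Rightarrow> ('a \<Rightarrow> 'b::{banach,second_countable_topology}) \<Rightarrow> bool" where
  "L1loc \<Omega> f \<longleftrightarrow> (\<forall>K. compact K \<and> K \<subseteq> \<Omega> \<longrightarrow> set_integrable lebesgue K f)"

definition weak_grad :: "'a::euclidean_space set \<Rightarrow> ('a \<Rightarrow> real) \<Rightarrow> ('a \<Rightarrow> 'a) \<Rightarrow> bool" where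
  "weak_grad \<Omega> u g \<longleftrightarrow> L1loc \<Omega> u \<and> L1loc \<Omega> g \<and>
     (\<forall>\<phi>. test_fun \<Omega> \<phi> \<longrightarrow> (\<forall>i\<in>Basis.
        (LINT x:\<Omega>|lebesgue. u x * pderiv_i \<phi> i x) = - (LINT x:\<Omega>|lebesgue. (g x \<bullet> i) * \<phi> x)))"

definition weakly_diff :: "'a::euclidean_space set \<Rightarrow> ('a \<Rightarrow> real) \<Rightarrow> bool" where
  "weakly_diff \<Omega> u \<longleftrightarrow> (\<exists>g. weak_grad \<Omega> u g)"

text \<open>The weak gradient (unique up to null sets).\<close>
definition wgrad :: "'a::euclidean_space set \<Rightarrow> ('a \<Rightarrow> real) \<Rightarrow> 'a \<Rightarrow> 'a" where
  "wgrad \<Omega> u = (SOME g. weak_grad \<Omega> u g)"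

definition Lp_on :: "'a::euclidean_space set \<Rightarrow> real \<Rightarrow> ('a \<Rightarrow> real) \<Rightarrow> bool" where
  "Lp_on \<Omega> p f \<longleftrightarrow> f \<in> borel_measurable (lebesgue_on \<Omega>) \<and>
     (\<integral>\<^sup>+x\<in>\<Omega>. ennreal (\<bar>f x\<bar> powr p) \<partial>lebesgue) < \<infinity>"

definition Lp_pow :: "'a::euclidean_space set \<Rightarrow> real \<Rightarrow> ('a \<Rightarrow> real) \<Rightarrow> real" where
  "Lp_pow \<Omega> p f = enn2real (\<integral>\<^sup>+x\<in>\<Omega>. ennreal (\<bar>f x\<bar> powr p) \<partial>lebesgue)"

definition L1p :: "'a::euclidean_space set \<Rightarrow> real \<Rightarrow> ('a \<Rightarrow> real) \<Rightarrow> bool" where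
  "L1p \<Omega> p u \<longleftrightarrow> L1loc \<Omega> u \<and> weakly_diff \<Omega> u \<and> Lp_on \<Omega> p (\<lambda>x. norm (wgrad \<Omega> u x))"

definition L1p_seminorm :: "'a::euclidean_space set \<Rightarrow> real \<Rightarrow> ('a \<Rightarrow> real) \<Rightarrow> real" where
  "L1p_seminorm \<Omega> p u = Lp_pow \<Omega> p (\<lambda>x. norm (wgrad \<Omega> u x)) powr (1 / p)"

definition W1p :: "'a::euclidean_space set \<Rightarrow> real \<Rightarrow> ('a \<Rightarrow> real) \<Rightarrow> bool" where
  "W1p \<Omega> p u \<longleftrightarrow> L1p \<Omega> p u \<and> Lp_on \<Omega> p u"

definition W1p_norm :: "'a::euclidean_space set \<Rightarrow> real \<Rightarrow> ('a \<Rightarrow> real) \<Rightarrow> real" where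
  "W1p_norm \<Omega> p u = (Lp_pow \<Omega> p u + Lp_pow \<Omega> p (\<lambda>x. norm (wgrad \<Omega> u x))) powr (1 / p)"

definition is_domain :: "'a::euclidean_space set \<Rightarrow> bool" where
  "is_domain \<Omega> \<longleftrightarrow> open \<Omega> \<and> connected \<Omega> \<and> \<Omega> \<noteq> {}"

definition W_ext_domain :: "'a::euclidean_space set \<Rightarrow> real \<Rightarrow> real \<Rightarrow> bool" where
  "W_ext_domain \<Omega> p q \<longleftrightarrow> (\<exists>E C. C > 0 \<and> (\<forall>u. W1p \<Omega> p u \<longrightarrow>
      W1p UNIV q (E u) \<and> (AE x in lebesgue. x \<in> \<Omega> \<longrightarrow> E u x = u x) \<and>
      W1p_norm UNIV q (E u) \<le> C * W1p_norm \<Omega> p u))"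

definition L_ext_domain :: "'a::euclidean_space set \<Rightarrow> real \<Rightarrow> real \<Rightarrow> bool" where
  "L_ext_domain \<Omega> p q \<longleftrightarrow> (\<exists>E C. C > 0 \<and> (\<forall>u. L1p \<Omega> p u \<longrightarrow>
      L1p UNIV q (E u) \<and> (AE x in lebesgue. x \<in> \<Omega> \<longrightarrow> E u x = u x) \<and>
      L1p_seminorm UNIV q (E u) \<le> C * L1p_seminorm \<Omega> p u))"

end

theory Submission
  imports Defs
begin

text \<open>
  Write \<open>n\<close> for the dimension. A hall is joined to long thin rooms of radius \<open>r\<close> and height 1 by
  corridors of radius \<open>d\<close>, with \<open>d\<close> far smaller than \<open>r\<close>. A function on a room extends by reflection and
  a cutoff at scale \<open>r\<close>, at the cost of a factor \<open>1/r\<close> on the function itself. The extension lives on a set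
  of volume about \<open>r^(n-1)\<close>, so Hoelder's inequality from \<open>p\<close> down to \<open>q\<close> bounds the \<open>q\<close>-th power of its norm
  by \<open>r^\<gamma>\<close> times that of the \<open>W^{1,p}\<close> norm, where \<open>\<gamma> = (n-1)(1-q/p) - q\<close> is positive precisely
  under the assumption on \<open>p\<close>. These costs are summable. First the hall and the rooms are extended to \<open>U\<close>;
  the remainder \<open>u - U\<close> lives in the corridors, vanishes at both of their ends, and is extended in the
  same way, which is affordable when \<open>d\<close> is small compared with a power of \<open>r\<close>.

  For the homogeneous spaces, consider functions equal to 1 in one room and to 0 in the hall and in the
  other rooms. Their \<open>L^{1,p}\<close> seminorm tends to 0 with \<open>d\<close>. The weak formulation with a test
  function whose \<open>e\<close>-derivative is supported in the hall and in the room bounds the seminorm of any extension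
  from below independently of \<open>d\<close>.
\<close>

section \<open>Smooth functions\<close>

text \<open>The rooms keep height 1 while their width shrinks, so volumes scale with the power n-1
  instead of n; this is the origin of n-1 in the threshold on \<open>p\<close>. The functions that
  defeat the homogeneous bound are harmless for the inhomogeneous one: their \<open>L^p\<close>
  norm, of order r^((n-1)/p), does not decrease with \<open>d\<close>. Room number j only refutes
  constants up to about j, so infinitely many rooms are needed.

  The obstacle is the mouth of a corridor, where two scales meet. No traces are used. Each corridor
  runs through the full height of its room and of the hall, so that \<open>u - U\<close> vanishes on
  whole slabs of height 1 at both ends, and reflecting a box keeps such slabs clear. Hence adding
  the second extension does not spoil the first one on the hall and the rooms.

  On a corridor the remainder has \<open>p\<close>-energy of order r^(-p), since \<open>U\<close>
  has already paid for the width of the room. Its own extension costs d^(-p) more, and Hoelder on a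
  volume of order d^(n-1) turns this into d^\<gamma> r^(-q). The lower bound in the homogeneous case
  depends on r alone. So r is fixed first, and \<open>d\<close> is then chosen to meet both
  demands.\<close>

lemma pderiv_i_eq:
  assumes "(f has_derivative f') (at x)"
  shows "pderiv_i f i x = f' i"
  using frechet_derivative_at[OF assms] by (simp add: pderiv_i_def)

lemma Ck_on_Suc_UNIV:
  "Ck_on (Suc k) UNIV f \<longleftrightarrow>
     (\<forall>x. f differentiable (at x)) \<and> (\<forall>i\<in>Basis. Ck_on k UNIV (pderiv_i f i))"
  unfolding pderiv_i_def[abs_def]
  by (auto intro!: continuous_at_imp_continuous_on differentiable_imp_continuous_within)

declare Ck_on.simps(2) [simp del]

lemma Ck_on_SucI:
  assumes "\<And>x. (f has_derivative f' x) (at x)"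
    and "\<And>i. i \<in> Basis \<Longrightarrow> Ck_on k UNIV (\<lambda>x. f' x i)"
  shows "Ck_on (Suc k) UNIV f"
proof -
  have "pderiv_i f i = (\<lambda>x. f' x i)" for i
    using pderiv_i_eq[OF assms(1)] by auto
  then show ?thesis
    using assms by (auto simp: Ck_on_Suc_UNIV differentiable_def)
qed

lemma Ck_on_has_derivative:
  assumes "Ck_on (Suc k) UNIV f"
  shows "(f has_derivative (\<lambda>h. pderiv_i f h x)) (at x)"
  using assms unfolding Ck_on_Suc_UNIV pderiv_i_def
  by (metis (mono_tags, lifting) frechet_derivative_works eta_contract_eq)

lemma Ck_on_Suc_imp: "Ck_on (Suc k) UNIV f \<Longrightarrow> Ck_on k UNIV f"
proof (induction k arbitrary: f)
  case 0
  then show ?case by (simp add: Ck_on.simps(2))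
next
  case (Suc k)
  then show ?case by (metis Ck_on_Suc_UNIV)
qed

lemma Ck_on_const: "Ck_on k UNIV (\<lambda>x::'a::euclidean_space. c)"
proof (induction k arbitrary: c)
  case (Suc k)
  show ?case by (rule Ck_on_SucI[where f' = "\<lambda>x h. 0"]) (auto intro: Suc)
qed simp

lemma Ck_on_add:
  "Ck_on k UNIV f \<Longrightarrow> Ck_on k UNIV g \<Longrightarrow> Ck_on k UNIV (\<lambda>x::'a::euclidean_space. f x + g x)"
proof (induction k arbitrary: f g)
  case (Suc k)
  show ?case
    by (rule Ck_on_SucI[OF has_derivative_add[OF Ck_on_has_derivative Ck_on_has_derivative]])
      (use Suc in \<open>auto simp: Ck_on_Suc_UNIV\<close>)
qed (auto intro: continuous_intros)

lemma Ck_on_mult: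
  "Ck_on k UNIV f \<Longrightarrow> Ck_on k UNIV g \<Longrightarrow> Ck_on k UNIV (\<lambda>x::'a::euclidean_space. f x * g x)"
proof (induction k arbitrary: f g)
  case (Suc k)
  note D = Suc.prems[THEN Ck_on_has_derivative] and C = Suc.prems[THEN Ck_on_Suc_imp]
  show ?case
    by (rule Ck_on_SucI[OF has_derivative_mult[OF D]])
      (use Suc C in \<open>auto simp: Ck_on_Suc_UNIV intro!: Ck_on_add\<close>)
qed (auto intro: continuous_intros)

lemma Ck_on_sum:
  "(\<And>i. i \<in> I \<Longrightarrow> Ck_on k UNIV (f i)) \<Longrightarrow> Ck_on k UNIV (\<lambda>x::'a::euclidean_space. \<Sum>i\<in>I. f i x)"
  by (induction I rule: infinite_finite_induct) (auto intro: Ck_on_const Ck_on_add)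

lemma Ck_on_inverse:
  assumes "\<And>x. f x \<noteq> 0"
  shows "Ck_on k UNIV f \<Longrightarrow> Ck_on k UNIV (\<lambda>x::'a::euclidean_space. inverse (f x))"
proof (induction k)
  case 0
  then show ?case using assms by (auto intro: continuous_intros)
next
  case (Suc k)
  note C = Suc.IH[OF Ck_on_Suc_imp[OF Suc.prems]]
  have "Ck_on k UNIV (\<lambda>x. (-1) * (inverse (f x) * pderiv_i f i x * inverse (f x)))"
    if "i \<in> Basis" for i
    by (intro Ck_on_mult Ck_on_const C) (use Suc that in \<open>auto simp: Ck_on_Suc_UNIV\<close>)
  then show ?case
    by (intro Ck_on_SucI[OF Deriv.has_derivative_inverse[OF assms Ck_on_has_derivative[OF Suc.prems]]])
      (simp add: mult.assoc)
qed

lemma Ck_on_affine: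
  fixes L :: "'b::euclidean_space \<Rightarrow> 'a::euclidean_space"
  assumes L: "bounded_linear L"
  shows "Ck_on k UNIV f \<Longrightarrow> Ck_on k UNIV (\<lambda>x. f (c + L x))"
proof (induction k arbitrary: f)
  case 0
  then show ?case
    by (auto intro!: continuous_on_compose2[of UNIV f UNIV "\<lambda>x. c + L x"]
        continuous_on_add linear_continuous_on[OF L])
next
  case (Suc k)
  have D: "((\<lambda>x. f (c + L x)) has_derivative (\<lambda>h. pderiv_i f (L h) (c + L x))) (at x)" for x
  proof -
    have "((\<lambda>x. c + L x) has_derivative L) (at x)"
      using L by (auto intro!: derivative_eq_intros bounded_linear_imp_has_derivative)
    from has_derivative_compose[OF this Ck_on_has_derivative[OF Suc.prems]] show ?thesis by simp
  qed
  \<comment> \<open>\<open>Ck_on\<close> speaks of basis directions only, and \<open>L h\<close>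
    need not be one. Linearity of the derivative reduces to them, so that the induction hypothesis
    applies to each partial derivative of \<open>f\<close>.\<close>
  have *: "pderiv_i f (L h) y = (\<Sum>b\<in>Basis. (L h \<bullet> b) * pderiv_i f b y)" for h y
  proof -
    interpret bounded_linear "\<lambda>h. pderiv_i f h y"
      using Ck_on_has_derivative[OF Suc.prems] by (rule has_derivative_bounded_linear)
    have "pderiv_i f (L h) y = pderiv_i f (\<Sum>b\<in>Basis. (L h \<bullet> b) *\<^sub>R b) y"
      by (simp add: euclidean_representation)
    then show ?thesis by (simp add: sum scale)
  qed
  show ?case
    by (rule Ck_on_SucI[OF D])
      (use Suc in \<open>auto simp: * Ck_on_Suc_UNIV intro!: Ck_on_sum Ck_on_mult Ck_on_const\<close>)
qed

lemma smooth_fun_const: "smooth_fun (\<lambda>x::'a::euclidean_space. c)"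
  and smooth_fun_add:
    "smooth_fun f \<Longrightarrow> smooth_fun g \<Longrightarrow> smooth_fun (\<lambda>x::'a. f x + g x)"
  and smooth_fun_mult:
    "smooth_fun f \<Longrightarrow> smooth_fun g \<Longrightarrow> smooth_fun (\<lambda>x::'a. f x * g x)"
  by (auto simp: smooth_fun_def Ck_on_const Ck_on_add Ck_on_mult)

lemma smooth_fun_prod:
  "(\<And>i. i \<in> I \<Longrightarrow> smooth_fun (f i)) \<Longrightarrow> smooth_fun (\<lambda>x::'a::euclidean_space. \<Prod>i\<in>I. f i x)"
  by (induction I rule: infinite_finite_induct) (auto intro: smooth_fun_const smooth_fun_mult)

lemma smooth_fun_inverse:
  "smooth_fun f \<Longrightarrow> (\<And>x. f x \<noteq> 0) \<Longrightarrow> smooth_fun (\<lambda>x::'a::euclidean_space. inverse (f x))"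
  by (auto simp: smooth_fun_def Ck_on_inverse)

lemma smooth_fun_affine:
  fixes L :: "'b::euclidean_space \<Rightarrow> 'a::euclidean_space"
  shows "bounded_linear L \<Longrightarrow> smooth_fun f \<Longrightarrow> smooth_fun (\<lambda>x. f (c + L x))"
  by (auto simp: smooth_fun_def Ck_on_affine)

lemma smooth_fun_coord:
  assumes "smooth_fun h"
  shows "smooth_fun (\<lambda>x::'a::euclidean_space. h (c + m * (x \<bullet> i)))"
  by (rule smooth_fun_affine[OF _ assms])
    (intro bounded_linear_const_mult bounded_linear_inner_left)

lemma smooth_fun_real_affine: "smooth_fun h \<Longrightarrow> smooth_fun (\<lambda>x::real. h (c + m * x))"
  using smooth_fun_coord[of h c m "1::real"] by simp

lemma smooth_fun_has_derivative:
  "smooth_fun f \<Longrightarrow> (f has_derivative (\<lambda>h. pderiv_i f h x)) (at x)"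
  by (auto simp: smooth_fun_def intro: Ck_on_has_derivative)

lemma smooth_fun_has_field_derivative:
  fixes f :: "real \<Rightarrow> real"
  assumes "smooth_fun f"
  shows "(f has_real_derivative pderiv_i f 1 x) (at x)"
proof -
  interpret bounded_linear "\<lambda>h. pderiv_i f h x"
    using smooth_fun_has_derivative[OF assms] by (rule has_derivative_bounded_linear)
  have "(\<lambda>h. pderiv_i f h x) = (*) (pderiv_i f 1 x)"
    by (rule ext) (metis mult.right_neutral real_scaleR_def scaleR mult.commute)
  then show ?thesis
    using smooth_fun_has_derivative[OF assms, of x] by (simp add: has_field_derivative_def)
qed

lemma smooth_fun_continuous_on: "smooth_fun f \<Longrightarrow> continuous_on S f"
  unfolding smooth_fun_def by (metis Ck_on.simps(1) continuous_on_subset top_greatest)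

lemma smooth_fun_pderiv: "smooth_fun f \<Longrightarrow> i \<in> Basis \<Longrightarrow> smooth_fun (pderiv_i f i)"
  unfolding smooth_fun_def by (metis Ck_on_Suc_UNIV)

lemma smooth_fun_linear_pderiv:
  assumes "smooth_fun f" shows "linear (\<lambda>h. pderiv_i f h x)"
  using smooth_fun_has_derivative[OF assms] has_derivative_linear by blast

lemma smooth_fun_line_derivative:
  assumes "smooth_fun f"
  shows "((\<lambda>t. f (x + t *\<^sub>R i)) has_real_derivative pderiv_i f i (x + s *\<^sub>R i)) (at s)"
proof -
  have "((\<lambda>t. x + t *\<^sub>R i) has_derivative (\<lambda>h. h *\<^sub>R i)) (at s)"
    by (auto intro!: derivative_eq_intros)
  from has_derivative_compose[OF this smooth_fun_has_derivative[OF assms]]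
  have "((\<lambda>t. f (x + t *\<^sub>R i)) has_derivative (\<lambda>h. h * pderiv_i f i (x + s *\<^sub>R i))) (at s)"
    using linear_scale[OF smooth_fun_linear_pderiv[OF assms]] by simp
  then show ?thesis by (simp add: has_field_derivative_def mult_commute_abs)
qed

section \<open>Smooth steps\<close>

text \<open>The polynomial factor makes the family closed under differentiation, so that smoothness
  of all members is one induction over the order with \<open>P\<close> arbitrary. The classical
  function exp(-1/x) is the case \<open>P = 1\<close>.\<close>

definition flat :: "real poly \<Rightarrow> real \<Rightarrow> real" where
  "flat P x = (if x > 0 then poly P (1/x) * exp (- (1/x)) else 0)"

lemma poly_times_exp_tendsto_0: "((\<lambda>y::real. poly P y * exp (- y)) \<longlongrightarrow> 0) at_top"
proof -
  have "((\<lambda>y::real. \<Sum>i\<le>degree P. coeff P i * (y ^ i / exp y)) \<longlongrightarrow> (\<Sum>i\<le>degree P. coeff P i * 0)) at_top"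
    by (intro tendsto_intros tendsto_power_div_exp_0)
  then show ?thesis
    by (simp add: poly_altdef sum_distrib_right exp_minus divide_inverse mult.assoc)
qed

lemma flat_tendsto_0: "(flat P \<longlongrightarrow> 0) (at 0)"
proof -
  have "((\<lambda>x. poly P (inverse x) * exp (- inverse x)) \<longlongrightarrow> 0) (at_right (0::real))"
    by (rule filterlim_compose[OF poly_times_exp_tendsto_0 filterlim_inverse_at_top_right])
  then have "(flat P \<longlongrightarrow> 0) (at_right 0)"
    by (rule tendsto_cong[THEN iffD1, rotated])
      (auto simp: flat_def eventually_at_filter inverse_eq_divide)
  moreover have "(flat P \<longlongrightarrow> 0) (at_left 0)"
    by (rule tendsto_eventually) (auto simp: flat_def eventually_at_filter)
  ultimately show ?thesis by (simp add: filterlim_at_split)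
qed

text \<open>With t = 1/x one has d/dx = -t^2 d/dt, which sends P(t) exp(-t) to t^2 (P - P')(t)
  exp(-t); \<open>[:0,0,1:]\<close> is t^2. At the origin the difference quotient is again a
  \<open>flat\<close>, for the polynomial t P(t), and therefore tends to 0.\<close>

lemma flat_has_derivative:
  "(flat P has_real_derivative flat ([:0,0,1:] * (P - pderiv P)) x) (at x)"
proof -
  consider "x < 0" | "x = 0" | "x > 0" by linarith
  then show ?thesis
  proof cases
    case 1
    have "((\<lambda>x::real. 0) has_real_derivative 0) (at x)" by simp
    then have "(flat P has_real_derivative 0) (at x)"
      by (rule DERIV_cong_ev[THEN iffD1, OF refl _ refl, rotated])
        (use 1 in \<open>auto simp: flat_def eventually_nhds intro!: exI[of _ "{..<0}"]\<close>)
    then show ?thesis using 1 by (simp add: flat_def)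
  next
    case 2
    have "(\<lambda>h. (flat P h - flat P 0) / (h - 0)) = flat (pCons 0 P)"
      by (auto simp: flat_def)
    then have "(flat P has_real_derivative 0) (at 0)"
      using flat_tendsto_0[of "pCons 0 P"] by (simp add: has_field_derivative_iff)
    then show ?thesis
      using 2 by (simp add: flat_def)
  next
    case 3
    have "((\<lambda>x. poly P (1/x) * exp (- (1/x))) has_real_derivative
        poly (pderiv P) (1/x) * (- 1 / x^2) * exp (- (1/x)) + exp (- (1/x)) * (1/x^2) * poly P (1/x)) (at x)"
      using 3 by (auto intro!: derivative_eq_intros DERIV_chain'[OF _ poly_DERIV]
          simp: power2_eq_square)
    then have "(flat P has_real_derivative
        poly (pderiv P) (1/x) * (- 1 / x^2) * exp (- (1/x)) + exp (- (1/x)) * (1/x^2) * poly P (1/x)) (at x)"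
      by (rule DERIV_cong_ev[THEN iffD1, OF refl _ refl, rotated])
        (use 3 in \<open>auto simp: flat_def eventually_nhds intro!: exI[of _ "{0<..}"]\<close>)
    then show ?thesis
      using 3 by (simp add: flat_def field_simps power2_eq_square)
  qed
qed

lemma smooth_fun_flat: "smooth_fun (flat P)"
  unfolding smooth_fun_def
proof
  fix k show "Ck_on k UNIV (flat P)"
  proof (induction k arbitrary: P)
    case 0
    then show ?case
      by (auto intro!: continuous_at_imp_continuous_on DERIV_isCont flat_has_derivative)
  next
    case (Suc k)
    show ?case
      by (rule Ck_on_SucI[OF flat_has_derivative[THEN has_field_derivative_imp_has_derivative]])
        (use Suc in auto)
  qed
qed

definition bump :: "real \<Rightarrow> real" where "bump = flat 1"

lemma bump_pos_iff: "bump x > 0 \<longleftrightarrow> x > 0" and bump_nonneg: "bump x \<ge> 0"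
  and bump_le_1: "bump x \<le> 1" and bump_eq_0: "x \<le> 0 \<Longrightarrow> bump x = 0"
  by (auto simp: bump_def flat_def)

lemma bump_mono: "x \<le> y \<Longrightarrow> bump x \<le> bump y"
  by (auto simp: bump_def flat_def field_simps)

lemma smooth_fun_bump: "smooth_fun bump"
  by (simp add: bump_def smooth_fun_flat)

definition step :: "real \<Rightarrow> real" where
  "step x = bump x * inverse (bump x + bump (1 - x))"

lemma step_denom_pos: "bump x + bump (1 - x) > 0"
  using bump_pos_iff[of x] bump_pos_iff[of "1 - x"] bump_nonneg[of x] bump_nonneg[of "1-x"] by linarith

lemma smooth_fun_step: "smooth_fun step"
  unfolding step_def[abs_def]
  using smooth_fun_real_affine[OF smooth_fun_bump, of 1 "-1"] step_denom_pos
  by (intro smooth_fun_mult smooth_fun_bump smooth_fun_inverse smooth_fun_add)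
    (auto simp: less_imp_neq[symmetric])

lemma step_eq_0: "x \<le> 0 \<Longrightarrow> step x = 0" and step_eq_1: "x \<ge> 1 \<Longrightarrow> step x = 1"
  using step_denom_pos[of x] by (auto simp: step_def bump_eq_0)

lemma step_nonneg: "step x \<ge> 0" and step_le_1: "step x \<le> 1"
  using step_denom_pos[of x] bump_nonneg[of x] bump_nonneg[of "1-x"]
  by (auto simp: step_def field_simps)

lemma step_mono: assumes "x \<le> y" shows "step x \<le> step y"
proof -
  have "bump x * bump (1 - y) \<le> bump y * bump (1 - x)"
    using assms by (intro mult_mono bump_mono bump_nonneg) auto
  then show ?thesis
    using step_denom_pos[of x] step_denom_pos[of y] by (simp add: step_def field_simps)
qed

abbreviation step' :: "real \<Rightarrow> real" where "step' \<equiv> pderiv_i step 1"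

lemmas step_deriv = smooth_fun_has_field_derivative[OF smooth_fun_step]

lemma step'_nonneg: "step' x \<ge> 0"
proof (rule ccontr)
  assume "\<not> 0 \<le> step' x"
  then obtain d where "d > 0" "\<And>h. 0 < h \<Longrightarrow> h < d \<Longrightarrow> step (x + h) < step x"
    using DERIV_neg_dec_right[OF step_deriv, of x] by auto
  from this(2)[of "d/2"] this(1) step_mono[of x "x + d/2"] show False by auto
qed

text \<open>On these closed half lines \<open>step\<close> attains its global minimum 0 or maximum
  1, so the derivative vanishes by Fermat's criterion, endpoints included.\<close>

lemma step'_eq_0: assumes "x \<le> 0 \<or> 1 \<le> x" shows "step' x = 0"
  using assms
proof
  assume "x \<le> 0"
  then show ?thesis
    by (intro DERIV_local_min[OF step_deriv, of 1]) (auto simp: step_eq_0 step_nonneg)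
next
  assume "1 \<le> x"
  then show ?thesis
    by (intro DERIV_local_max[OF step_deriv, of 1]) (auto simp: step_eq_1 step_le_1)
qed

lemma continuous_step': "continuous_on S step'"
  using smooth_fun_pderiv[OF smooth_fun_step] by (intro smooth_fun_continuous_on) auto

lemma step'_bounded: obtains D where "D \<ge> 1" "\<And>x. \<bar>step' x\<bar> \<le> D"
proof -
  have "compact (step' ` {0..1})"
    by (intro compact_continuous_image continuous_step') auto
  then obtain B where B: "\<And>x. x \<in> {0..1} \<Longrightarrow> norm (step' x) \<le> B"
    using compact_imp_bounded bounded_iff by (metis imageI)
  have "\<bar>step' x\<bar> \<le> max B 1" for x
    using B[of x] step'_eq_0[of x] by (cases "x \<in> {0..1}") auto
  then show thesis using that[of "max B 1"] by auto
qed

section \<open>Measure-preserving affine maps\<close>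

text \<open>Coefficients of modulus 1 treat translations and reflections in coordinate hyperplanes
  at once; these are the changes of variables used below.\<close>

lemma
  fixes c :: "'a::euclidean_space \<Rightarrow> real" and t :: 'a
  defines "T \<equiv> \<lambda>x. t + (\<Sum>j\<in>Basis. (c j * (x \<bullet> j)) *\<^sub>R j)"
  assumes "\<And>j. j \<in> Basis \<Longrightarrow> \<bar>c j\<bar> = 1"
  shows measurable_unit_affine: "T \<in> lebesgue \<rightarrow>\<^sub>M lebesgue"
    and distr_unit_affine: "distr lebesgue lebesgue T = lebesgue"
proof -
  have c: "\<And>j. j \<in> Basis \<Longrightarrow> c j \<noteq> 0" using assms(2) by fastforce
  show "T \<in> lebesgue \<rightarrow>\<^sub>M lebesgue"
    unfolding T_def by (rule lebesgue_affine_measurable[OF c])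
  have "lebesgue = density (distr lebesgue lebesgue T) (\<lambda>_. ennreal (\<Prod>j\<in>Basis. \<bar>c j\<bar>))"
    unfolding T_def by (rule lebesgue_affine_euclidean[OF c])
  also have "(\<Prod>j\<in>Basis. \<bar>c j\<bar>) = 1" using assms(2) by (intro prod.neutral) auto
  finally show "distr lebesgue lebesgue T = lebesgue" by (simp add: density_1)
qed

text \<open>Mirror image in the hyperplane \<open>x \<bullet> i = a\<close> for a unit vector
  \<open>i\<close>. Its linear part is \<open>reflect i 0\<close>, which is how gradients
  transform.\<close>

definition reflect :: "'a::euclidean_space \<Rightarrow> real \<Rightarrow> 'a \<Rightarrow> 'a" where
  "reflect i a x = x + (2 * (a - x \<bullet> i)) *\<^sub>R i"

lemma reflect_inner:
  "i \<in> Basis \<Longrightarrow> k \<in> Basis \<Longrightarrow> reflect i a x \<bullet> k = (if k = i then 2 * a - x \<bullet> i else x \<bullet> k)"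
  by (auto simp: reflect_def inner_add_left inner_Basis)

lemma reflect_reflect [simp]: "i \<in> Basis \<Longrightarrow> reflect i a (reflect i a x) = x"
  by (rule euclidean_eqI) (simp add: reflect_inner)

lemma reflect_affine: "reflect i a x = (2 * a) *\<^sub>R i + reflect i 0 x"
  by (simp add: reflect_def algebra_simps)

lemma bounded_linear_reflect0: "bounded_linear (reflect i 0)"
  unfolding linear_conv_bounded_linear[symmetric]
  by (intro linearI) (simp_all add: reflect_def inner_add_left algebra_simps)

lemma norm_reflect0: "i \<in> Basis \<Longrightarrow> norm (reflect i 0 x) = norm x"
  unfolding norm_eq_sqrt_inner euclidean_inner[of "reflect i 0 x" "reflect i 0 x"] euclidean_inner[of x x]
  by (auto simp: reflect_inner intro!: sum.cong)

lemma reflect_unit_affine: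
  assumes i: "i \<in> Basis"
  shows "reflect i a = (\<lambda>x. (2*a) *\<^sub>R i + (\<Sum>j\<in>Basis. ((if j = i then -1 else 1) * (x \<bullet> j)) *\<^sub>R j))"
proof
  fix x
  show "reflect i a x = (2*a) *\<^sub>R i + (\<Sum>j\<in>Basis. ((if j = i then -1 else 1) * (x \<bullet> j)) *\<^sub>R j)"
  proof (rule euclidean_eqI)
    fix k :: 'a assume k: "k \<in> Basis"
    have "(\<Sum>j\<in>Basis. ((if j = i then -1 else 1) * (x \<bullet> j)) *\<^sub>R j) \<bullet> k = (if k = i then -1 else 1) * (x \<bullet> k)"
      using k by simp
    then show "reflect i a x \<bullet> k = ((2*a) *\<^sub>R i + (\<Sum>j\<in>Basis. ((if j = i then -1 else 1) * (x \<bullet> j)) *\<^sub>R j)) \<bullet> k"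
      using k i by (auto simp: reflect_inner inner_add_left inner_Basis)
  qed
qed

lemma measurable_reflect [measurable]: "i \<in> Basis \<Longrightarrow> reflect i a \<in> lebesgue \<rightarrow>\<^sub>M lebesgue"
  and distr_reflect: "i \<in> Basis \<Longrightarrow> distr lebesgue lebesgue (reflect i a) = lebesgue"
  unfolding atomize_imp
  by (intro impI, subst reflect_unit_affine, assumption, rule measurable_unit_affine, simp)
    (intro impI, subst reflect_unit_affine, assumption, rule distr_unit_affine, simp)

lemma translation_unit_affine:
  "(\<lambda>x::'a::euclidean_space. t + x) = (\<lambda>x. t + (\<Sum>j\<in>Basis. (1 * (x \<bullet> j)) *\<^sub>R j))"
  by (simp add: euclidean_representation)

lemma measurable_lebesgue_translation:
    "(\<lambda>x::'a::euclidean_space. t + x) \<in> lebesgue \<rightarrow>\<^sub>M lebesgue"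
  and distr_lebesgue_translation: "distr lebesgue lebesgue (\<lambda>x::'a. t + x) = lebesgue"
  by (subst translation_unit_affine, rule measurable_unit_affine, simp)
    (subst translation_unit_affine, rule distr_unit_affine, simp)

lemma
  fixes f :: "'a::euclidean_space \<Rightarrow> 'b::{banach, second_countable_topology}"
  assumes i: "i \<in> Basis"
  shows integral_reflect: "f \<in> borel_measurable lebesgue \<Longrightarrow> (LINT x|lebesgue. f (reflect i a x)) = (LINT x|lebesgue. f x)"
    and integrable_reflect: "integrable lebesgue f \<Longrightarrow> integrable lebesgue (\<lambda>x. f (reflect i a x))"
  using integral_distr[OF measurable_reflect[OF i, of a], of f]
    integrable_distr[OF measurable_reflect[OF i, of a], of f] distr_reflect[OF i, of a] by simp_all

lemma nn_integral_reflect: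
  fixes f :: "'a::euclidean_space \<Rightarrow> ennreal"
  assumes i: "i \<in> Basis" and "f \<in> borel_measurable lebesgue"
  shows "(\<integral>\<^sup>+x. f (reflect i a x) \<partial>lebesgue) = (\<integral>\<^sup>+x. f x \<partial>lebesgue)"
  using nn_integral_distr[OF measurable_reflect[OF i, of a], of f] assms distr_reflect[OF i, of a] by simp

lemma continuous_imp_measurable_lebesgue:
  fixes f :: "'a::euclidean_space \<Rightarrow> 'b::{banach, second_countable_topology}"
  shows "continuous_on UNIV f \<Longrightarrow> f \<in> borel_measurable lebesgue"
  by (intro measurable_completion) (simp add: borel_measurable_continuous_onI)

section \<open>Test functions\<close>

lemma test_fun_smooth: "test_fun S \<phi> \<Longrightarrow> smooth_fun \<phi>"
  by (simp add: test_fun_def)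

lemma test_fun_mono: "test_fun S \<phi> \<Longrightarrow> S \<subseteq> T \<Longrightarrow> test_fun T \<phi>"
  by (auto simp: test_fun_def)

lemma pderiv_i_zero_outside:
  assumes "closed K" "\<And>x. x \<notin> K \<Longrightarrow> \<phi> x = 0" "x \<notin> K"
  shows "pderiv_i \<phi> i x = 0"
proof -
  have "((\<lambda>_. 0) has_derivative (\<lambda>_. 0)) (at x)" by simp
  then have "(\<phi> has_derivative (\<lambda>_. 0)) (at x)"
    by (rule has_derivative_transform_within_open[of _ _ _ _ "- K"]) (use assms in auto)
  then show ?thesis by (rule pderiv_i_eq)
qed

lemma pderiv_i_mult:
  assumes "smooth_fun f" "smooth_fun g"
  shows "pderiv_i (\<lambda>x. f x * g x) i x = f x * pderiv_i g i x + pderiv_i f i x * g x"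
  using assms by (intro pderiv_i_eq has_derivative_mult smooth_fun_has_derivative)

lemma pderiv_i_coord:
  fixes i :: "'a::euclidean_space"
  assumes "smooth_fun h"
  shows "pderiv_i (\<lambda>x::'a. h (c + m * (x \<bullet> i))) k x = pderiv_i h 1 (c + m * (x \<bullet> i)) * (m * (k \<bullet> i))"
proof -
  have "((\<lambda>x::'a. c + m * (x \<bullet> i)) has_derivative (\<lambda>k. m * (k \<bullet> i))) (at x)"
    by (auto intro!: derivative_eq_intros)
  from has_derivative_compose[OF this smooth_fun_has_field_derivative[OF assms, THEN
      has_field_derivative_imp_has_derivative]]
  show ?thesis by (intro pderiv_i_eq) simp
qed

lemma pderiv_i_reflect:
  assumes "smooth_fun \<phi>" and i: "i \<in> Basis" and k: "k \<in> Basis"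
  shows "pderiv_i (\<lambda>x. \<phi> (reflect i a x)) k x = (if k = i then -1 else 1) * pderiv_i \<phi> k (reflect i a x)"
proof -
  have "((\<lambda>x. (2 * a) *\<^sub>R i + reflect i 0 x) has_derivative reflect i 0) (at x)"
    by (auto intro!: derivative_eq_intros bounded_linear_imp_has_derivative bounded_linear_reflect0)
  then have "(reflect i a has_derivative reflect i 0) (at x)"
    by (simp add: reflect_affine[symmetric])
  from has_derivative_compose[OF this smooth_fun_has_derivative[OF assms(1)]]
  have "pderiv_i (\<lambda>x. \<phi> (reflect i a x)) k x = pderiv_i \<phi> (reflect i 0 k) (reflect i a x)"
    by (rule pderiv_i_eq)
  moreover have "reflect i 0 k = (if k = i then -1 else 1) *\<^sub>R k"
    using i k by (auto simp: reflect_def inner_Basis scaleR_2)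
  ultimately show ?thesis
    using linear_scale[OF smooth_fun_linear_pderiv[OF assms(1)]] by simp
qed

lemma smooth_fun_reflect: "smooth_fun \<phi> \<Longrightarrow> smooth_fun (\<lambda>x. \<phi> (reflect i a x))"
  using smooth_fun_affine[OF bounded_linear_reflect0, of \<phi> "(2 * a) *\<^sub>R i" i]
  by (simp add: reflect_affine[symmetric])

lemma test_fun_pderiv:
  assumes "test_fun S \<phi>" "i \<in> Basis"
  shows "test_fun S (pderiv_i \<phi> i)"
proof -
  obtain K where K: "smooth_fun \<phi>" "compact K" "K \<subseteq> S" "\<And>x. x \<notin> K \<Longrightarrow> \<phi> x = 0"
    using assms by (auto simp: test_fun_def)
  have "pderiv_i \<phi> i x = 0" if "x \<notin> K" for x
    by (rule pderiv_i_zero_outside[OF compact_imp_closed[OF K(2)] _ that]) (rule K(4))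
  then show ?thesis
    using K smooth_fun_pderiv[OF K(1) assms(2)] unfolding test_fun_def by auto
qed

lemma test_fun_mult_smooth:
  assumes "test_fun S \<phi>" "smooth_fun f"
  shows "test_fun S (\<lambda>x. f x * \<phi> x)"
  using assms smooth_fun_mult[of f \<phi>] by (auto simp: test_fun_def)

lemma test_fun_bounded:
  assumes "test_fun S \<phi>"
  obtains B where "B \<ge> 0" "\<And>x. \<bar>\<phi> x\<bar> \<le> B"
proof -
  obtain K where K: "smooth_fun \<phi>" "compact K" "\<And>x. x \<notin> K \<Longrightarrow> \<phi> x = 0"
    using assms by (auto simp: test_fun_def)
  have "bounded (\<phi> ` K)"
    using K by (intro compact_imp_bounded compact_continuous_image smooth_fun_continuous_on)
  then obtain B where B: "\<And>x. x \<in> K \<Longrightarrow> norm (\<phi> x) \<le> B"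
    unfolding bounded_iff by blast
  have "\<bar>\<phi> x\<bar> \<le> max B 0" for x
    using B[of x] K(3)[of x] by (cases "x \<in> K") auto
  then show thesis using that[of "max B 0"] by auto
qed

lemma test_fun_measurable: "test_fun S \<phi> \<Longrightarrow> \<phi> \<in> borel_measurable lebesgue"
  by (intro continuous_imp_measurable_lebesgue smooth_fun_continuous_on test_fun_smooth)

lemma test_fun_Lipschitz:
  assumes "test_fun S \<phi>" and i: "i \<in> Basis"
  obtains B where "B \<ge> 0" "\<And>x t. \<bar>\<phi> (x + t *\<^sub>R i) - \<phi> x\<bar> \<le> B * \<bar>t\<bar>"
proof -
  obtain B where B: "B \<ge> 0" "\<And>x. \<bar>pderiv_i \<phi> i x\<bar> \<le> B"
    using test_fun_bounded[OF test_fun_pderiv[OF assms]] by blast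
  have "\<bar>\<phi> (x + t *\<^sub>R i) - \<phi> x\<bar> \<le> B * \<bar>t\<bar>" for x t
  proof -
    have "((\<lambda>t. \<phi> (x + t *\<^sub>R i)) has_real_derivative pderiv_i \<phi> i (x + s *\<^sub>R i)) (at s within UNIV)" for s
      using smooth_fun_line_derivative[OF test_fun_smooth[OF assms(1)]] by simp
    from field_differentiable_bound[OF convex_UNIV this, of B t 0] B show ?thesis by simp
  qed
  then show thesis using that B(1) by blast
qed

lemma integrable_mult_bounded:
  fixes u \<phi> :: "'a \<Rightarrow> real"
  assumes u: "integrable M u" and \<phi>: "\<phi> \<in> borel_measurable M" "\<And>x. \<bar>\<phi> x\<bar> \<le> B"
  shows "integrable M (\<lambda>x. u x * \<phi> x)"
proof (rule Bochner_Integration.integrable_bound)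
  show "integrable M (\<lambda>x. B * u x)" using u by simp
  have "\<bar>\<phi> x\<bar> \<le> \<bar>B\<bar>" for x using \<phi>(2)[of x] by linarith
  then show "AE x in M. norm (u x * \<phi> x) \<le> norm (B * u x)"
    by (auto simp: abs_mult mult.commute intro!: mult_right_mono)
qed (use u \<phi> in auto)

lemma integrable_mult_test:
  assumes "integrable lebesgue u" "test_fun S \<phi>"
  shows "integrable lebesgue (\<lambda>x. u x * \<phi> x)"
  using test_fun_bounded[OF assms(2)] integrable_mult_bounded[OF assms(1) test_fun_measurable[OF assms(2)]]
  by blast

lemma integrable_test_fun:
  assumes "test_fun S \<phi>"
  shows "integrable lebesgue \<phi>"
proof -
  obtain K where K: "compact K" "\<And>x. x \<notin> K \<Longrightarrow> \<phi> x = 0"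
    using assms by (auto simp: test_fun_def)
  have "integrable lebesgue (\<lambda>x. indicat_real K x * \<phi> x)"
    using K(1) by (intro integrable_mult_test[OF _ assms])
      (simp add: lmeasurable_compact lmeasurable_iff_integrable[symmetric])
  moreover have "indicat_real K x * \<phi> x = \<phi> x" for x
    using K(2)[of x] by (cases "x \<in> K") auto
  ultimately show ?thesis by simp
qed

text \<open>The integrals of the difference quotients vanish by translation invariance.\<close>

lemma integral_pderiv_test_eq_0:
  assumes \<psi>: "test_fun S \<psi>" and i: "i \<in> Basis"
  shows "(LINT x|lebesgue. pderiv_i \<psi> i x) = 0"
proof -
  define h where "h n = inverse (real (Suc n))" for n
  define D where "D n x = (\<psi> (x + h n *\<^sub>R i) - \<psi> x) / h n" for n x
  have h: "h n > 0" "h n \<le> 1" for n by (auto simp: h_def field_simps)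
  obtain B where B: "B \<ge> 0" "\<And>x t. \<bar>\<psi> (x + t *\<^sub>R i) - \<psi> x\<bar> \<le> B * \<bar>t\<bar>"
    using test_fun_Lipschitz[OF assms] by blast
  obtain K where K: "compact K" "\<And>x. x \<notin> K \<Longrightarrow> \<psi> x = 0"
    using \<psi> by (auto simp: test_fun_def)
  obtain R where R: "K \<subseteq> cball 0 R"
    using compact_imp_bounded[OF K(1)] by (auto simp: bounded_iff subset_iff)
  have mD: "D n \<in> borel_measurable lebesgue" for n
    unfolding D_def
    by (intro continuous_imp_measurable_lebesgue continuous_intros
        continuous_on_compose2[OF smooth_fun_continuous_on[OF test_fun_smooth[OF \<psi>], of UNIV]]
        smooth_fun_continuous_on[OF test_fun_smooth[OF \<psi>]]) (use h(1)[of n] in auto)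
  have "(\<lambda>n. LINT x|lebesgue. D n x) \<longlonglongrightarrow> (LINT x|lebesgue. pderiv_i \<psi> i x)"
  proof (rule integral_dominated_convergence[where w = "\<lambda>x. B * indicator (cball 0 (R+1)) x"])
    show "pderiv_i \<psi> i \<in> borel_measurable lebesgue"
      by (rule test_fun_measurable[OF test_fun_pderiv[OF assms]])
    show "integrable lebesgue (\<lambda>x::'a. B * indicat_real (cball 0 (R+1)) x)"
      by (intro integrable_mult_right) (simp add: lmeasurable_cball lmeasurable_iff_integrable[symmetric])
    have "(\<lambda>n. D n x) \<longlonglongrightarrow> pderiv_i \<psi> i x" for x
    proof -
      have "((\<lambda>t. \<psi> (x + t *\<^sub>R i)) has_real_derivative pderiv_i \<psi> i x) (at 0)"
        using smooth_fun_line_derivative[OF test_fun_smooth[OF \<psi>], of x i 0] by simp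
      then have "((\<lambda>t. (\<psi> (x + t *\<^sub>R i) - \<psi> x) / t) \<longlongrightarrow> pderiv_i \<psi> i x) (at 0)"
        by (simp add: has_field_derivative_iff)
      moreover have "filterlim h (at 0) sequentially"
        unfolding h_def using LIMSEQ_inverse_real_of_nat
        by (auto simp: filterlim_at)
      ultimately show ?thesis
        unfolding D_def by (rule filterlim_compose)
    qed
    then show "AE x in lebesgue. (\<lambda>n. D n x) \<longlonglongrightarrow> pderiv_i \<psi> i x" by simp
    fix n
    \<comment> \<open>Since \<open>h n\<close> is at most 1, all difference quotients vanish outside
      one ball of radius \<open>R + 1\<close>, and the Lipschitz constant \<open>B\<close> dominates
      them inside.\<close>
    have "norm (D n x) \<le> B * indicator (cball 0 (R+1)) x" for x
    proof (cases "x \<in> cball 0 (R+1)")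
      case True
      have "\<bar>D n x\<bar> \<le> B * h n / h n"
        unfolding D_def using B(2)[of x "h n"] h[of n] by (simp add: field_simps)
      then show ?thesis using True h[of n] by simp
    next
      case False
      have "norm x \<le> norm (x + h n *\<^sub>R i) + norm (h n *\<^sub>R i)"
        by (metis add_diff_cancel_right' norm_triangle_ineq4)
      then have "norm x \<le> norm (x + h n *\<^sub>R i) + 1"
        using h[of n] i by simp
      then have "x + h n *\<^sub>R i \<notin> K" "x \<notin> K" using R False by auto
      then show ?thesis using K(2) False B(1) by (simp add: D_def)
    qed
    then show "AE x in lebesgue. norm (D n x) \<le> B * indicator (cball 0 (R+1)) x" by simp
  qed (rule mD)
  moreover have "(LINT x|lebesgue. D n x) = 0" for n
  proof -
    have m: "\<psi> \<in> borel_measurable lebesgue" and I: "integrable lebesgue \<psi>"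
      using test_fun_measurable integrable_test_fun \<psi> by blast+
    have "integrable lebesgue (\<lambda>x. \<psi> (h n *\<^sub>R i + x))"
      using integrable_distr[OF measurable_lebesgue_translation[of "h n *\<^sub>R i"], of \<psi>] I
      by (simp add: distr_lebesgue_translation)
    moreover have "(LINT x|lebesgue. \<psi> (h n *\<^sub>R i + x)) = (LINT x|lebesgue. \<psi> x)"
      using integral_distr[OF measurable_lebesgue_translation[of "h n *\<^sub>R i"], of \<psi>] m
      by (simp add: distr_lebesgue_translation)
    ultimately show ?thesis
      unfolding D_def using I by (simp add: add.commute)
  qed
  ultimately show ?thesis by (simp add: LIMSEQ_const_iff)
qed

lemma integral_by_parts_test:
  assumes u: "smooth_fun u" and \<phi>: "test_fun S \<phi>" and i: "i \<in> Basis"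
  shows "(LINT x|lebesgue. u x * pderiv_i \<phi> i x) = - (LINT x|lebesgue. pderiv_i u i x * \<phi> x)"
proof -
  have I: "integrable lebesgue (\<lambda>x. u x * pderiv_i \<phi> i x)" "integrable lebesgue (\<lambda>x. pderiv_i u i x * \<phi> x)"
    using u \<phi> i by (auto intro!: integrable_test_fun test_fun_mult_smooth test_fun_pderiv smooth_fun_pderiv)
  have "(LINT x|lebesgue. u x * pderiv_i \<phi> i x + pderiv_i u i x * \<phi> x) = 0"
    using integral_pderiv_test_eq_0[OF test_fun_mult_smooth[OF \<phi> u] i]
      pderiv_i_mult[OF u test_fun_smooth[OF \<phi>], of i] by simp
  then show ?thesis using I by simp
qed

section \<open>Uniqueness of weak gradients\<close>

text \<open>For m > 0 each factor is 0 up to distance 1/m from its face and 1 from distance 2/m on.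
  The products are thus smooth, vanish off \<open>box a b\<close>, and converge pointwise to the
  indicator of the open box.\<close>

definition box_cutoff :: "'a::euclidean_space \<Rightarrow> 'a \<Rightarrow> nat \<Rightarrow> 'a \<Rightarrow> real" where
  "box_cutoff a b m x =
     (\<Prod>k\<in>Basis. step (real m * (x \<bullet> k - a \<bullet> k) - 1) * step (real m * (b \<bullet> k - x \<bullet> k) - 1))"

lemma smooth_fun_box_cutoff: "smooth_fun (box_cutoff a b m)"
proof -
  have "smooth_fun (\<lambda>x. step ((- real m * (a \<bullet> k) - 1) + real m * (x \<bullet> k)) *
      step ((real m * (b \<bullet> k) - 1) + (- real m) * (x \<bullet> k)))" for k
    by (intro smooth_fun_mult smooth_fun_coord smooth_fun_step)
  then show ?thesis
    unfolding box_cutoff_def[abs_def] by (intro smooth_fun_prod) (simp add: algebra_simps)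
qed

lemma box_cutoff_bounds: "0 \<le> box_cutoff a b m x" "box_cutoff a b m x \<le> 1"
  by (auto simp: box_cutoff_def step_nonneg step_le_1 intro!: prod_nonneg prod_le_1 mult_le_one)

lemma box_cutoff_eq_0: assumes "x \<notin> box a b" shows "box_cutoff a b m x = 0"
proof -
  obtain k where k: "k \<in> Basis" "x \<bullet> k - a \<bullet> k \<le> 0 \<or> b \<bullet> k - x \<bullet> k \<le> 0"
    using assms by (auto simp: mem_box not_less)
  have "step (real m * t - 1) = 0" if "t \<le> 0" for t
    using mult_nonneg_nonpos[of "real m" t] that by (intro step_eq_0) simp
  then have "step (real m * (x \<bullet> k - a \<bullet> k) - 1) * step (real m * (b \<bullet> k - x \<bullet> k) - 1) = 0"
    using k(2) by auto
  then show ?thesis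
    unfolding box_cutoff_def using k(1) by (intro prod_zero) auto
qed

lemma test_fun_box_cutoff: "test_fun (cbox a b) (box_cutoff a b m)"
  unfolding test_fun_def
  using smooth_fun_box_cutoff[of a b m] box_cutoff_eq_0[of _ a b m] box_subset_cbox[of a b]
  by (intro conjI exI[of _ "cbox a b"]) auto

lemma box_cutoff_tendsto: "(\<lambda>m. box_cutoff a b m x) \<longlonglongrightarrow> indicator (box a b) x"
proof (cases "x \<in> box a b")
  case False
  then show ?thesis by (simp add: box_cutoff_eq_0)
next
  case True
  have *: "(\<lambda>m. step (real m * t - 1)) \<longlonglongrightarrow> 1" if "t > 0" for t :: real
  proof (rule tendsto_eventually)
    obtain N where "2 / t < real N" using reals_Archimedean2 by blast
    then have N: "2 \<le> real N * t" using \<open>t > 0\<close> by (simp add: field_simps less_imp_le)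
    have "real m * t - 1 \<ge> 1" if "m \<ge> N" for m
    proof -
      have "real N * t \<le> real m * t" using that \<open>t > 0\<close> by (intro mult_right_mono) auto
      then show ?thesis using N by linarith
    qed
    then show "eventually (\<lambda>m. step (real m * t - 1) = 1) sequentially"
      unfolding eventually_sequentially using step_eq_1 by blast
  qed
  have "(\<lambda>m. box_cutoff a b m x) \<longlonglongrightarrow> (\<Prod>k\<in>(Basis::'a set). 1 * 1)"
    unfolding box_cutoff_def using True by (intro tendsto_prod tendsto_mult *) (auto simp: mem_box)
  then show ?thesis using True by simp
qed

text \<open>Cutoffs of boxes are enough test functions, since boxes generate the Borel sets.\<close>

lemma AE_eq_0_if_orthogonal_test:
  fixes f :: "'a::euclidean_space \<Rightarrow> real"
  assumes f: "set_integrable lebesgue (cbox c d) f"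
    and orth: "\<And>\<phi>. test_fun (cbox c d) \<phi> \<Longrightarrow> (LINT x:cbox c d|lebesgue. f x * \<phi> x) = 0"
  shows "AE x in lebesgue. x \<in> cbox c d \<longrightarrow> f x = 0"
proof -
  define h where "h x = indicator (cbox c d) x * f x" for x
  have h: "integrable lebesgue h"
    using f by (simp add: set_integrable_def h_def[abs_def])
  have mI: "(\<lambda>x. indicator A x * h x) \<in> borel_measurable lebesgue" if "A \<in> sets borel" for A
    using that h by (intro borel_measurable_times borel_measurable_indicator borel_measurable_integrable)
      (simp_all add: sets_completionI_sets)
  have h0: "AE x in lebesgue. x \<notin> box c d \<longrightarrow> h x = 0"
  proof -
    have "AE x in lebesgue. x \<notin> cbox c d - box c d"
      using negligible_frontier_interval[of c d] by (intro AE_not_in) (simp add: negligible_iff_null_sets)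
    then show ?thesis by eventually_elim (auto simp: h_def)
  qed
  have box0: "(LINT x|lebesgue. indicator (box a b) x * h x) = 0" for a b
  proof -
    \<comment> \<open>Orthogonality is known only for test functions supported in
      \<open>cbox c d\<close>, so the box is first clipped to it. What is cut away does not matter,
      since \<open>h\<close> vanishes almost everywhere off \<open>box c d\<close> by
      \<open>h0\<close>.\<close>
    define a' b' where "a' = (\<Sum>i\<in>Basis. max (a \<bullet> i) (c \<bullet> i) *\<^sub>R i)"
      and "b' = (\<Sum>i\<in>Basis. min (b \<bullet> i) (d \<bullet> i) *\<^sub>R i)"
    have ab': "box a b \<inter> box c d = box a' b'"
      by (auto simp: box_Int_box a'_def b'_def)
    have sub: "cbox a' b' \<subseteq> cbox c d"
      by (auto simp: mem_box a'_def b'_def)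
    have "(\<lambda>m. LINT x|lebesgue. box_cutoff a' b' m x * h x) \<longlonglongrightarrow> (LINT x|lebesgue. indicator (box a' b') x * h x)"
    proof (rule integral_dominated_convergence[where w = "\<lambda>x. norm (h x)"])
      show "AE x in lebesgue. (\<lambda>m. box_cutoff a' b' m x * h x) \<longlonglongrightarrow> indicator (box a' b') x * h x"
        by (intro AE_I2 tendsto_mult box_cutoff_tendsto tendsto_const)
      show "AE x in lebesgue. norm (box_cutoff a' b' m x * h x) \<le> norm (h x)" for m
        using box_cutoff_bounds[of a' b' m] by (auto simp: abs_mult intro!: mult_left_le_one_le)
      show "(\<lambda>x. box_cutoff a' b' m x * h x) \<in> borel_measurable lebesgue" for m
        using h test_fun_measurable[OF test_fun_box_cutoff, of a' b' m] by auto
    qed (use h in \<open>auto intro: mI\<close>)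
    moreover have "(LINT x|lebesgue. box_cutoff a' b' m x * h x) = 0" for m
      using orth[OF test_fun_mono[OF test_fun_box_cutoff sub, of m]]
      by (simp add: set_lebesgue_integral_def h_def mult_ac)
    ultimately have "(LINT x|lebesgue. indicator (box a' b') x * h x) = 0"
      by (simp add: LIMSEQ_const_iff)
    moreover have "(LINT x|lebesgue. indicator (box a b) x * h x) = (LINT x|lebesgue. indicator (box a' b') x * h x)"
    proof (rule integral_cong_AE)
      show "AE x in lebesgue. indicator (box a b) x * h x = indicator (box a' b') x * h x"
        using h0 by eventually_elim (auto simp: ab'[symmetric] indicator_def)
    qed (auto intro: mI)
    ultimately show ?thesis by simp
  qed
  \<comment> \<open>Boxes generate the Borel sets but not the Lebesgue measurable ones. The Dynkin
    argument is therefore run for a Borel representative \<open>h'\<close>, and the result is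
    carried back to \<open>h\<close> almost everywhere.\<close>
  obtain h' where h': "h' \<in> borel_measurable lborel" "AE x in lborel. h x = h' x"
    using completion_ex_borel_measurable_real[OF borel_measurable_integrable[OF h]] by blast
  have ae: "AE x in lebesgue. h x = h' x" using h'(2) by (rule AE_completion)
  have mh': "h' \<in> borel_measurable lebesgue" using h'(1) by (rule measurable_completion)
  have ih': "integrable lborel h'"
    using Bochner_Integration.integrable_cong_AE[OF borel_measurable_integrable[OF h] mh' ae] h
    by (simp add: integrable_completion[OF h'(1)])
  have eq: "(LINT x|lborel. indicator A x * h' x) = (LINT x|lebesgue. indicator A x * h x)" if "A \<in> sets borel" for A
  proof -
    have "(\<lambda>x. indicator A x * h' x) \<in> borel_measurable lborel" using h'(1) that by auto
    from integral_completion[OF this]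
    have "(LINT x|lborel. indicator A x * h' x) = (LINT x|lebesgue. indicator A x * h' x)" by simp
    also have "\<dots> = (LINT x|lebesgue. indicator A x * h x)"
    proof (rule integral_cong_AE)
      show "AE x in lebesgue. indicator A x * h' x = indicator A x * h x"
        using ae by eventually_elim auto
      show "(\<lambda>x. indicator A x * h' x) \<in> borel_measurable lebesgue"
        using that mh' by (intro borel_measurable_times borel_measurable_indicator) (simp_all add: sets_completionI_sets)
    qed (use that in \<open>auto intro: mI\<close>)
    finally show ?thesis .
  qed
  have iA: "integrable lborel (\<lambda>x. indicator A x * h' x)" if "A \<in> sets borel" for A
    using integrable_mult_indicator[OF _ ih', of A] that by simp
  have tot: "(LINT x|lborel. h' x) = 0"
  proof -
    have "(LINT x|lborel. h' x) = (LINT x|lebesgue. indicator UNIV x * h x)"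
      using eq[of UNIV] by simp
    also have "\<dots> = (LINT x|lebesgue. indicator (box c d) x * h x)"
    proof (rule integral_cong_AE)
      show "AE x in lebesgue. indicator UNIV x * h x = indicator (box c d) x * h x"
        using h0 by eventually_elim (auto simp: indicator_def)
    qed (use mI[of UNIV] in \<open>auto intro: mI\<close>)
    finally show ?thesis using box0 by simp
  qed
  have "(LINT x|lborel. indicator A x * h' x) = 0" if "A \<in> sets borel" for A
  proof -
    have A: "A \<in> sigma_sets UNIV (range (\<lambda>(a, b). box a b :: 'a set))"
      using that by (simp add: borel_eq_box)
    have int: "Int_stable (range (\<lambda>(a, b). box a b :: 'a set))"
      by (auto simp: Int_stable_def box_Int_box)
    have meas: "B \<in> sets borel" if "B \<in> sigma_sets UNIV (range (\<lambda>(a, b). box a b :: 'a set))" for B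
      using that by (simp add: borel_eq_box)
    show ?thesis
    proof (rule sigma_sets_induct_disjoint[OF int _ A])
      fix B assume "B \<in> range (\<lambda>(a, b). box a b :: 'a set)"
      then show "(LINT x|lborel. indicator B x * h' x) = 0" using eq box0 by auto
    next
      fix B assume B: "B \<in> sigma_sets UNIV (range (\<lambda>(a, b). box a b :: 'a set))"
        and 0: "(LINT x|lborel. indicator B x * h' x) = 0"
      have "(\<lambda>x. indicator (UNIV - B) x * h' x) = (\<lambda>x. h' x - indicator B x * h' x)"
        by (auto simp: indicator_def)
      then show "(LINT x|lborel. indicator (UNIV - B) x * h' x) = 0"
        using ih' iA[OF meas[OF B]] 0 tot by simp
    next
      fix B :: "nat \<Rightarrow> 'a set"
      assume B: "disjoint_family B" "range B \<subseteq> sigma_sets UNIV (range (\<lambda>(a, b). box a b))"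
        and 0: "\<And>i. (LINT x|lborel. indicator (B i) x * h' x) = 0"
      have Bm: "B i \<in> sets borel" for i using B(2) meas by auto
      have "(LINT x:(\<Union>i. B i)|lborel. h' x) = (\<Sum>i. LINT x:B i|lborel. h' x)"
        using Bm B(1) iA[of "\<Union>i. B i"]
        by (intro lebesgue_integral_countable_add) (auto simp: disjoint_family_on_def set_integrable_def)
      then show "(LINT x|lborel. indicator (\<Union>(range B)) x * h' x) = 0"
        using 0 by (simp add: set_lebesgue_integral_def)
    qed auto
  qed
  then have "AE x in lborel. h' x = 0"
    by (intro density_unique_real[OF ih', of "\<lambda>_. 0"]) (simp_all add: set_lebesgue_integral_def)
  then have "AE x in lebesgue. h' x = 0" by (rule AE_completion)
  with ae show ?thesis by eventually_elim (auto simp: h_def)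
qed

lemma set_integral_test_eq:
  fixes f :: "'a::euclidean_space \<Rightarrow> real"
  assumes "\<forall>x. x \<notin> K \<longrightarrow> \<phi> x = 0" "K \<subseteq> S"
  shows "(LINT x:S|lebesgue. f x * \<phi> x) = (LINT x:K|lebesgue. f x * \<phi> x)"
  unfolding set_lebesgue_integral_def using assms
  by (intro Bochner_Integration.integral_cong) (auto simp: indicator_def)

text \<open>Since \<open>wgrad\<close> is an arbitrary choice, this is what allows an explicitly
  computed weak gradient to stand in for it. The open set is covered by countably many closed boxes
  inside it, on which local integrability is plain integrability, and the previous lemma is applied
  to each component.\<close>

lemma weak_grad_unique:
  assumes \<Omega>: "open \<Omega>" and g: "weak_grad \<Omega> u g" "weak_grad \<Omega> u g'"
  shows "AE x in lebesgue. x \<in> \<Omega> \<longrightarrow> g x = g' x"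
proof -
  obtain \<D> where \<D>: "countable \<D>" "\<And>X. X \<in> \<D> \<Longrightarrow> X \<subseteq> \<Omega>" "\<And>X. X \<in> \<D> \<Longrightarrow> \<exists>a b. X = cbox a b" "\<Union>\<D> = \<Omega>"
    using open_countable_Union_open_cbox[OF \<Omega>] by (metis PowD subsetD)
  have "AE x in lebesgue. x \<in> X \<longrightarrow> (g x - g' x) \<bullet> i = 0" if X: "X \<in> \<D>" and i: "i \<in> Basis" for X i
  proof -
    obtain c d where cd: "X = cbox c d" "cbox c d \<subseteq> \<Omega>" using \<D> X by metis
    have gi: "set_integrable lebesgue (cbox c d) g" "set_integrable lebesgue (cbox c d) g'"
      using g cd by (auto simp: weak_grad_def L1loc_def compact_cbox)
    have gi': "set_integrable lebesgue (cbox c d) (\<lambda>x. g x \<bullet> i)" "set_integrable lebesgue (cbox c d) (\<lambda>x. g' x \<bullet> i)"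
      using gi[unfolded set_integrable_def, THEN integrable_inner_left, of i]
      by (auto simp: set_integrable_def)
    have "AE x in lebesgue. x \<in> cbox c d \<longrightarrow> (g x - g' x) \<bullet> i = 0"
    proof (rule AE_eq_0_if_orthogonal_test)
      show "set_integrable lebesgue (cbox c d) (\<lambda>x. (g x - g' x) \<bullet> i)"
        using gi' by (simp add: inner_diff_left set_integral_diff)
      fix \<phi> assume \<phi>: "test_fun (cbox c d) \<phi>"
      then  have \<phi>0: "\<forall>x. x \<notin> cbox c d \<longrightarrow> \<phi> x = 0" by (auto simp: test_fun_def)
      have "(LINT x:\<Omega>|lebesgue. (g x \<bullet> i) * \<phi> x) = (LINT x:\<Omega>|lebesgue. (g' x \<bullet> i) * \<phi> x)"
      proof -
        have *: "(LINT x:\<Omega>|lebesgue. u x * pderiv_i \<phi> i x) = - (LINT x:\<Omega>|lebesgue. (k x \<bullet> i) * \<phi> x)"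
          if "weak_grad \<Omega> u k" for k
          using that test_fun_mono[OF \<phi> cd(2)] i by (simp add: weak_grad_def)
        show ?thesis using *[OF g(1)] *[OF g(2)] by simp
      qed
      then have "(LINT x:cbox c d|lebesgue. (g x \<bullet> i) * \<phi> x) = (LINT x:cbox c d|lebesgue. (g' x \<bullet> i) * \<phi> x)"
        by (simp only: set_integral_test_eq[OF \<phi>0 cd(2)])
      moreover have "set_integrable lebesgue (cbox c d) (\<lambda>x. (g x \<bullet> i) * \<phi> x)"
        "set_integrable lebesgue (cbox c d) (\<lambda>x. (g' x \<bullet> i) * \<phi> x)"
        using gi'[unfolded set_integrable_def, THEN integrable_mult_test[OF _ \<phi>]]
        by (simp_all add: set_integrable_def mult.assoc)
      ultimately show "(LINT x:cbox c d|lebesgue. (g x - g' x) \<bullet> i * \<phi> x) = 0"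
        by (simp add: inner_diff_left left_diff_distrib set_integral_diff)
    qed
    then show ?thesis using cd by simp
  qed
  then have "AE x in lebesgue. \<forall>i\<in>Basis. x \<in> X \<longrightarrow> (g x - g' x) \<bullet> i = 0" if "X \<in> \<D>" for X
    using that by (subst AE_ball_countable[OF countable_finite[OF finite_Basis]]) blast
  then have "AE x in lebesgue. \<forall>X\<in>\<D>. \<forall>i\<in>Basis. x \<in> X \<longrightarrow> (g x - g' x) \<bullet> i = 0"
    by (subst AE_ball_countable[OF \<D>(1)]) blast
  then show ?thesis
  proof eventually_elim
    case (elim x)
    show ?case
    proof (rule impI, rule euclidean_eqI)
      fix i :: 'a assume "x \<in> \<Omega>" and i: "i \<in> Basis"
      then obtain X where "X \<in> \<D>" "x \<in> X"
        using \<D>(4) by blast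
      then have "(g x - g' x) \<bullet> i = 0" using elim i by blast
      then show "g x \<bullet> i = g' x \<bullet> i" by (simp add: inner_diff_left)
    qed
  qed
qed

section \<open>Weakly differentiable functions extended by zero\<close>

text \<open>Function and gradient are defined everywhere and are zero off \<open>S\<close>, which
  turns all integrals into integrals over the whole space. This imposes no boundary condition: the
  test functions are supported in \<open>S\<close> and do not see a jump across its boundary. Only
  for \<open>S = UNIV\<close> does the clause express weak differentiability on the whole
  space.\<close>

definition W11 :: "'a::euclidean_space set \<Rightarrow> ('a \<Rightarrow> real) \<Rightarrow> ('a \<Rightarrow> 'a) \<Rightarrow> bool" where
  "W11 S u g \<longleftrightarrow> integrable lebesgue u \<and> integrable lebesgue g \<and>
     (\<forall>x. x \<notin> S \<longrightarrow> u x = 0 \<and> g x = 0) \<and>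
     (\<forall>\<phi>. test_fun S \<phi> \<longrightarrow> (\<forall>i\<in>Basis.
        (LINT x|lebesgue. u x * pderiv_i \<phi> i x) = - (LINT x|lebesgue. (g x \<bullet> i) * \<phi> x)))"

lemma W11_integrable: "W11 S u g \<Longrightarrow> integrable lebesgue u" "W11 S u g \<Longrightarrow> integrable lebesgue g"
  and W11_eq_0: "W11 S u g \<Longrightarrow> x \<notin> S \<Longrightarrow> u x = 0" "W11 S u g \<Longrightarrow> x \<notin> S \<Longrightarrow> g x = 0"
  and W11_test: "W11 S u g \<Longrightarrow> test_fun S \<phi> \<Longrightarrow> i \<in> Basis \<Longrightarrow>
     (LINT x|lebesgue. u x * pderiv_i \<phi> i x) = - (LINT x|lebesgue. (g x \<bullet> i) * \<phi> x)"
  by (auto simp: W11_def)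

lemma W11I:
  assumes "integrable lebesgue u" "integrable lebesgue g"
    and "\<And>x. x \<notin> S \<Longrightarrow> u x = 0" "\<And>x. x \<notin> S \<Longrightarrow> g x = 0"
    and "\<And>\<phi> i. test_fun S \<phi> \<Longrightarrow> i \<in> Basis \<Longrightarrow>
     (LINT x|lebesgue. u x * pderiv_i \<phi> i x) = - (LINT x|lebesgue. (g x \<bullet> i) * \<phi> x)"
  shows "W11 S u g"
  using assms by (auto simp: W11_def)

lemma W11_measurable:
  assumes "W11 S u g"
  shows "u \<in> borel_measurable lebesgue" "g \<in> borel_measurable lebesgue"
  using W11_integrable[OF assms] by auto

lemma W11_integrable_mult:
  assumes "W11 S u g" "test_fun T \<phi>" "i \<in> Basis"
  shows "integrable lebesgue (\<lambda>x. u x * pderiv_i \<phi> i x)" "integrable lebesgue (\<lambda>x. (g x \<bullet> i) * \<phi> x)"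
  by (intro integrable_mult_test[OF W11_integrable(1)[OF assms(1)] test_fun_pderiv[OF assms(2,3)]])
    (intro integrable_mult_test[OF _ assms(2)] integrable_inner_left W11_integrable(2)[OF assms(1)])

lemma W11_add:
  assumes "W11 S u g" "W11 S v h"
  shows "W11 S (\<lambda>x. u x + v x) (\<lambda>x. g x + h x)"
proof (rule W11I)
  fix \<phi> :: "'a \<Rightarrow> real" and i :: 'a assume \<phi>: "test_fun S \<phi>" "i \<in> Basis"
  note I = W11_integrable_mult[OF assms(1) \<phi>] W11_integrable_mult[OF assms(2) \<phi>]
  show "(LINT x|lebesgue. (u x + v x) * pderiv_i \<phi> i x) = - (LINT x|lebesgue. ((g x + h x) \<bullet> i) * \<phi> x)"
    using I W11_test[OF assms(1) \<phi>] W11_test[OF assms(2) \<phi>]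
    by (simp add: distrib_right inner_add_left)
qed (use W11_integrable[OF assms(1)] W11_integrable[OF assms(2)] W11_eq_0[OF assms(1)] W11_eq_0[OF assms(2)] in auto)

lemma W11_cmult:
  assumes "W11 S u g"
  shows "W11 S (\<lambda>x. c * u x) (\<lambda>x. c *\<^sub>R g x)"
proof (rule W11I)
  fix \<phi> :: "'a \<Rightarrow> real" and i :: 'a assume \<phi>: "test_fun S \<phi>" "i \<in> Basis"
  show "(LINT x|lebesgue. c * u x * pderiv_i \<phi> i x) = - (LINT x|lebesgue. (c *\<^sub>R g x \<bullet> i) * \<phi> x)"
    using W11_test[OF assms(1) \<phi>] by (simp add: mult.assoc)
qed (use W11_integrable[OF assms(1)] W11_eq_0[OF assms(1)] in auto)

lemma W11_restrict:
  assumes W: "W11 S u g" and T: "T \<subseteq> S" "T \<in> sets lebesgue"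
  shows "W11 T (\<lambda>x. indicator T x * u x) (\<lambda>x. indicator T x *\<^sub>R g x)"
proof (rule W11I)
  fix \<phi> :: "'a \<Rightarrow> real" and i :: 'a assume \<phi>: "test_fun T \<phi>" and i: "i \<in> Basis"
  have 0: "\<phi> x = 0" "pderiv_i \<phi> i x = 0" if "x \<notin> T" for x
    using that \<phi> test_fun_pderiv[OF \<phi> i] by (auto simp: test_fun_def)
  have "(LINT x|lebesgue. indicator T x * u x * pderiv_i \<phi> i x) = (LINT x|lebesgue. u x * pderiv_i \<phi> i x)"
    "(LINT x|lebesgue. (indicator T x *\<^sub>R g x \<bullet> i) * \<phi> x) = (LINT x|lebesgue. (g x \<bullet> i) * \<phi> x)"
    using 0 by (auto intro!: Bochner_Integration.integral_cong simp: indicator_def)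
  then show "(LINT x|lebesgue. indicator T x * u x * pderiv_i \<phi> i x)
      = - (LINT x|lebesgue. (indicator T x *\<^sub>R g x \<bullet> i) * \<phi> x)"
    using W11_test[OF W test_fun_mono[OF \<phi> T(1)] i] by simp
qed (use integrable_mult_indicator[OF T(2) W11_integrable(1)[OF W]]
    integrable_mult_indicator[OF T(2) W11_integrable(2)[OF W]] in auto)

lemma weak_grad_imp_W11:
  assumes g: "weak_grad \<Omega> u g" and S: "S \<subseteq> \<Omega>"
    and int: "set_integrable lebesgue S u" "set_integrable lebesgue S g"
  shows "W11 S (\<lambda>x. indicator S x * u x) (\<lambda>x. indicator S x *\<^sub>R g x)"
proof (rule W11I)
  fix \<phi> :: "'a \<Rightarrow> real" and i :: 'a assume \<phi>: "test_fun S \<phi>" and i: "i \<in> Basis"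
  have 0: "\<phi> x = 0" "pderiv_i \<phi> i x = 0" if "x \<notin> S" for x
    using that \<phi> test_fun_pderiv[OF \<phi> i] by (auto simp: test_fun_def)
  have "(LINT x|lebesgue. indicator S x * u x * pderiv_i \<phi> i x) = (LINT x:\<Omega>|lebesgue. u x * pderiv_i \<phi> i x)"
    "(LINT x|lebesgue. (indicator S x *\<^sub>R g x \<bullet> i) * \<phi> x) = (LINT x:\<Omega>|lebesgue. (g x \<bullet> i) * \<phi> x)"
    unfolding set_lebesgue_integral_def
    using 0 S by (auto intro!: Bochner_Integration.integral_cong simp: indicator_def)
  then show "(LINT x|lebesgue. indicator S x * u x * pderiv_i \<phi> i x)
      = - (LINT x|lebesgue. (indicator S x *\<^sub>R g x \<bullet> i) * \<phi> x)"
    using g test_fun_mono[OF \<phi> S] i by (simp add: weak_grad_def)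
qed (use int in \<open>auto simp: set_integrable_def\<close>)

lemma W11_UNIV_imp_weak_grad:
  assumes W: "W11 UNIV u g"
  shows "weak_grad UNIV u g"
proof -
  have K: "K \<in> sets lebesgue" if "compact K" for K :: "'a set"
    using that by (intro fmeasurableD lmeasurable_compact)
  show ?thesis
    using W11_test[OF W] integrable_mult_indicator[OF K W11_integrable(1)[OF W]]
      integrable_mult_indicator[OF K W11_integrable(2)[OF W]]
    unfolding weak_grad_def L1loc_def set_integrable_def set_lebesgue_integral_def by auto
qed

text \<open>The point is the passage from \<open>S\<close> to the larger \<open>T\<close>: if
  \<open>\<phi>\<close> is supported in a compact \<open>K\<close> inside \<open>T\<close>, then
  \<open>h * \<phi>\<close> is supported in \<open>K \<inter> Z\<close>, which is compact and lies
  in \<open>S\<close>, so it is admissible for \<open>u\<close>. Thus a cutoff that vanishes near a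
  face makes the extension by zero past that face weakly differentiable.\<close>

lemma W11_cutoff:
  fixes i :: "'a::euclidean_space"
  assumes W: "W11 S u g" and ST: "S \<subseteq> T" and i: "i \<in> Basis"
    and h: "smooth_fun h" "\<And>t. \<bar>h t\<bar> \<le> B" "\<And>t. \<bar>pderiv_i h 1 t\<bar> \<le> B'"
    and Z: "closed Z" "\<And>x. x \<notin> Z \<Longrightarrow> h (x \<bullet> i) = 0" "T \<inter> Z \<subseteq> S"
  shows "W11 T (\<lambda>x. h (x \<bullet> i) * u x) (\<lambda>x. h (x \<bullet> i) *\<^sub>R g x + (u x * pderiv_i h 1 (x \<bullet> i)) *\<^sub>R i)"
proof (rule W11I)
  have 0: "u x = 0" "g x = 0" if "x \<notin> T" for x
    using that ST W11_eq_0[OF W, of x] by auto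
  then show "h (x \<bullet> i) * u x = 0" "h (x \<bullet> i) *\<^sub>R g x + (u x * pderiv_i h 1 (x \<bullet> i)) *\<^sub>R i = 0"
    if "x \<notin> T" for x
    using that by simp_all
  have sm: "smooth_fun (\<lambda>x::'a. h (x \<bullet> i))"
    using smooth_fun_coord[OF h(1), of 0 1 i] by simp
  have sm': "smooth_fun (\<lambda>x::'a. pderiv_i h 1 (x \<bullet> i))"
    using smooth_fun_coord[OF smooth_fun_pderiv[OF h(1), of 1], of 0 1 i] by simp
  have m: "(\<lambda>x::'a. h (x \<bullet> i)) \<in> borel_measurable lebesgue"
    "(\<lambda>x::'a. pderiv_i h 1 (x \<bullet> i)) \<in> borel_measurable lebesgue"
    using sm sm' by (auto intro!: continuous_imp_measurable_lebesgue smooth_fun_continuous_on)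
  have Iu: "integrable lebesgue (\<lambda>x. u x * h (x \<bullet> i))"
    "integrable lebesgue (\<lambda>x. u x * pderiv_i h 1 (x \<bullet> i))"
    by (rule integrable_mult_bounded[OF W11_integrable(1)[OF W] m(1) h(2)],
        rule integrable_mult_bounded[OF W11_integrable(1)[OF W] m(2) h(3)])
  then show "integrable lebesgue (\<lambda>x. h (x \<bullet> i) * u x)" by (simp add: mult.commute)
  have Ig: "integrable lebesgue (\<lambda>x. h (x \<bullet> i) *\<^sub>R g x)"
  proof (rule Bochner_Integration.integrable_bound)
    show "integrable lebesgue (\<lambda>x. B *\<^sub>R g x)" using W11_integrable(2)[OF W] by simp
    show "AE x in lebesgue. norm (h (x \<bullet> i) *\<^sub>R g x) \<le> norm (B *\<^sub>R g x)"
    proof (rule AE_I2)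
      fix x :: 'a
      have "\<bar>h (x \<bullet> i)\<bar> \<le> \<bar>B\<bar>" using h(2)[of "x \<bullet> i"] by linarith
      then show "norm (h (x \<bullet> i) *\<^sub>R g x) \<le> norm (B *\<^sub>R g x)" by (simp add: mult_right_mono)
    qed
  qed (use m W11_measurable[OF W] in simp)
  show "integrable lebesgue (\<lambda>x. h (x \<bullet> i) *\<^sub>R g x + (u x * pderiv_i h 1 (x \<bullet> i)) *\<^sub>R i)"
    by (intro Bochner_Integration.integrable_add Ig integrable_scaleR_left Iu(2))
  fix \<phi> :: "'a \<Rightarrow> real" and k :: 'a assume \<phi>: "test_fun T \<phi>" and k: "k \<in> Basis"
  have h\<phi>: "test_fun S (\<lambda>x. h (x \<bullet> i) * \<phi> x)"
  proof -
    obtain K where K: "smooth_fun \<phi>" "compact K" "K \<subseteq> T" "\<forall>x. x \<notin> K \<longrightarrow> \<phi> x = 0"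
      using \<phi> by (auto simp: test_fun_def)
    then show ?thesis
      using Z smooth_fun_mult[OF sm K(1)] compact_Int_closed[OF K(2) Z(1)] unfolding test_fun_def
      by (intro conjI exI[of _ "K \<inter> Z"]) auto
  qed
  have d: "pderiv_i (\<lambda>x. h (x \<bullet> i) * \<phi> x) k x
      = h (x \<bullet> i) * pderiv_i \<phi> k x + pderiv_i h 1 (x \<bullet> i) * (k \<bullet> i) * \<phi> x" for x
    using pderiv_i_mult[OF sm test_fun_smooth[OF \<phi>], of k x] pderiv_i_coord[OF h(1), of 0 1 i k x] by simp
  have I1: "integrable lebesgue (\<lambda>x. u x * h (x \<bullet> i) * pderiv_i \<phi> k x)"
    by (rule integrable_mult_test[OF Iu(1) test_fun_pderiv[OF \<phi> k]])
  have I2: "integrable lebesgue (\<lambda>x. u x * pderiv_i h 1 (x \<bullet> i) * \<phi> x)"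
    by (intro integrable_mult_test[OF Iu(2) \<phi>])
  have I3: "integrable lebesgue (\<lambda>x. (h (x \<bullet> i) *\<^sub>R g x \<bullet> k) * \<phi> x)"
    by (intro integrable_mult_test[OF _ \<phi>] integrable_inner_left Ig)
  have "(LINT x|lebesgue. u x * pderiv_i (\<lambda>x. h (x \<bullet> i) * \<phi> x) k x)
      = (LINT x|lebesgue. u x * h (x \<bullet> i) * pderiv_i \<phi> k x + (k \<bullet> i) * (u x * pderiv_i h 1 (x \<bullet> i) * \<phi> x))"
    by (simp only: d) (simp add: algebra_simps)
  also have "\<dots> = (LINT x|lebesgue. u x * h (x \<bullet> i) * pderiv_i \<phi> k x)
      + (k \<bullet> i) * (LINT x|lebesgue. u x * pderiv_i h 1 (x \<bullet> i) * \<phi> x)"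
    using I1 I2 by simp
  finally have 1: "(LINT x|lebesgue. u x * h (x \<bullet> i) * pderiv_i \<phi> k x)
      = - (LINT x|lebesgue. (g x \<bullet> k) * (h (x \<bullet> i) * \<phi> x))
      - (k \<bullet> i) * (LINT x|lebesgue. u x * pderiv_i h 1 (x \<bullet> i) * \<phi> x)"
    using W11_test[OF W h\<phi> k] by simp
  have "(LINT x|lebesgue. ((h (x \<bullet> i) *\<^sub>R g x + (u x * pderiv_i h 1 (x \<bullet> i)) *\<^sub>R i) \<bullet> k) * \<phi> x)
      = (LINT x|lebesgue. (h (x \<bullet> i) *\<^sub>R g x \<bullet> k) * \<phi> x + (k \<bullet> i) * (u x * pderiv_i h 1 (x \<bullet> i) * \<phi> x))"
    by (simp add: inner_add_left algebra_simps inner_commute[of i k])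
  also have "\<dots> = (LINT x|lebesgue. (h (x \<bullet> i) *\<^sub>R g x \<bullet> k) * \<phi> x)
      + (k \<bullet> i) * (LINT x|lebesgue. u x * pderiv_i h 1 (x \<bullet> i) * \<phi> x)"
    using I3 I2 by simp
  finally show "(LINT x|lebesgue. h (x \<bullet> i) * u x * pderiv_i \<phi> k x)
      = - (LINT x|lebesgue. ((h (x \<bullet> i) *\<^sub>R g x + (u x * pderiv_i h 1 (x \<bullet> i)) *\<^sub>R i) \<bullet> k) * \<phi> x)"
    using 1 by (simp add: mult_ac)
qed

section \<open>Extension by reflection\<close>

text \<open>Since \<^term>\<open>u\<close> vanishes off the half space, \<^term>\<open>u x + u (reflect i a x)\<close> is its even reflection.
  The test function obtained by folding vanishes on the hyperplane when it is differentiated in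
  normal direction, which compensates for the derivative of the cutoff.\<close>

lemma W11_reflect:
  fixes i :: "'a::euclidean_space"
  assumes W: "W11 (T \<inter> {x. 0 < \<sigma> * (x \<bullet> i - a)}) u g" and i: "i \<in> Basis"
    and \<sigma>: "\<bar>\<sigma>\<bar> = 1" and T: "\<And>x. x \<in> T \<Longrightarrow> reflect i a x \<in> T"
  shows "W11 T (\<lambda>x. u x + u (reflect i a x)) (\<lambda>x. g x + reflect i 0 (g (reflect i a x)))"
proof (rule W11I)
  let ?S = "T \<inter> {x. 0 < \<sigma> * (x \<bullet> i - a)}"
  let ?\<rho> = "reflect i a"
  note Iu = W11_integrable(1)[OF W] and Ig = W11_integrable(2)[OF W]
  note mu = W11_measurable(1)[OF W] and mg = W11_measurable(2)[OF W]
  have Irg: "integrable lebesgue (\<lambda>x. reflect i 0 (g x))"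
    by (rule integrable_bounded_linear[OF bounded_linear_reflect0 Ig])
  show "integrable lebesgue (\<lambda>x. u x + u (?\<rho> x))"
    by (intro Bochner_Integration.integrable_add Iu integrable_reflect[OF i])
  show "integrable lebesgue (\<lambda>x. g x + reflect i 0 (g (?\<rho> x)))"
    by (intro Bochner_Integration.integrable_add Ig integrable_reflect[OF i, where f = "\<lambda>x. reflect i 0 (g x)"] Irg)
  fix x assume x: "x \<notin> T"
  then have x': "?\<rho> x \<notin> T" using T[of "?\<rho> x"] i by auto
  show "u x + u (?\<rho> x) = 0" "g x + reflect i 0 (g (?\<rho> x)) = 0"
    using W11_eq_0[OF W] x x' by (auto simp: reflect_def)
next
  let ?S = "T \<inter> {x. 0 < \<sigma> * (x \<bullet> i - a)}"
  let ?\<rho> = "reflect i a"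
  note Iu = W11_integrable(1)[OF W] and Ig = W11_integrable(2)[OF W]
  note mu = W11_measurable(1)[OF W] and mg = W11_measurable(2)[OF W]
  fix \<phi> :: "'a \<Rightarrow> real" and k :: 'a assume \<phi>: "test_fun T \<phi>" and k: "k \<in> Basis"
  \<comment> \<open>The sign is chosen so that the \<open>k\<close>-derivative of
    \<open>\<psi>\<close> is the sum of the \<open>k\<close>-derivatives of \<open>\<phi>\<close> at
    a point and at its mirror image. For \<open>k = i\<close> this makes \<open>\<psi>\<close> odd,
    hence zero on the hyperplane; for other \<open>k\<close> it is even.\<close>
  define \<epsilon> :: real where "\<epsilon> = (if k = i then -1 else 1)"
  have \<epsilon>\<epsilon>: "\<epsilon> * \<epsilon> = 1" by (simp add: \<epsilon>_def)
  define \<psi> where "\<psi> x = \<phi> x + \<epsilon> * \<phi> (?\<rho> x)" for x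
  note sm\<phi> = test_fun_smooth[OF \<phi>]
  have sm: "smooth_fun \<psi>"
    unfolding \<psi>_def[abs_def]
    by (intro smooth_fun_add smooth_fun_mult smooth_fun_const smooth_fun_reflect sm\<phi>)
  have d\<psi>: "pderiv_i \<psi> k x = pderiv_i \<phi> k x + pderiv_i \<phi> k (?\<rho> x)" for x
  proof -
    have "((\<lambda>x. \<phi> x + \<epsilon> * \<phi> (?\<rho> x)) has_derivative
        (\<lambda>h. pderiv_i \<phi> h x + \<epsilon> * pderiv_i (\<lambda>x. \<phi> (?\<rho> x)) h x)) (at x)"
      by (intro has_derivative_add has_derivative_mult_right smooth_fun_has_derivative smooth_fun_reflect sm\<phi>)
    from pderiv_i_eq[OF this, of k]
    have "pderiv_i \<psi> k x = pderiv_i \<phi> k x + \<epsilon> * (\<epsilon> * pderiv_i \<phi> k (?\<rho> x))"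
      using pderiv_i_reflect[OF sm\<phi> i k, of a x] by (simp add: \<psi>_def[abs_def] \<epsilon>_def)
    then show ?thesis using \<epsilon>\<epsilon> by (simp add: mult.assoc[symmetric])
  qed
  obtain K where K: "compact K" "K \<subseteq> T" "\<And>x. x \<notin> K \<Longrightarrow> \<phi> x = 0"
    using \<phi> by (auto simp: test_fun_def)
  have cont\<rho>: "continuous_on A ?\<rho>" for A
    unfolding reflect_def[abs_def] by (intro continuous_intros)
  define K' where "K' = K \<union> ?\<rho> ` K"
  have K': "compact K'" "K' \<subseteq> T" "\<And>x. x \<notin> K' \<Longrightarrow> \<psi> x = 0"
  proof -
    show "compact K'" unfolding K'_def by (intro compact_Un K compact_continuous_image cont\<rho>)
    show "K' \<subseteq> T" unfolding K'_def using K(2) T by auto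
    fix x assume x: "x \<notin> K'"
    have "?\<rho> x \<notin> K"
    proof
      assume "?\<rho> x \<in> K"
      then have "?\<rho> (?\<rho> x) \<in> K'" unfolding K'_def by blast
      then show False using x i by simp
    qed
    then show "\<psi> x = 0" using x K(3) by (simp add: \<psi>_def K'_def)
  qed
  have t\<psi>: "test_fun T \<psi>" unfolding test_fun_def using sm K' by blast
  obtain L where L: "L \<ge> 0" "\<And>x t. \<bar>\<phi> (x + t *\<^sub>R i) - \<phi> x\<bar> \<le> L * \<bar>t\<bar>"
    using test_fun_Lipschitz[OF \<phi> i] by blast
  obtain D where D: "D \<ge> 1" "\<And>t. \<bar>step' t\<bar> \<le> D" using step'_bounded by blast
  obtain B where B: "B \<ge> 0" "\<And>x. \<bar>\<psi> x\<bar> \<le> B" using test_fun_bounded[OF t\<psi>] by blast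
  obtain B' where B': "B' \<ge> 0" "\<And>x. \<bar>pderiv_i \<psi> k x\<bar> \<le> B'"
    using test_fun_bounded[OF test_fun_pderiv[OF t\<psi> k]] by blast
  \<comment> \<open>The function \<open>\<psi>\<close> need not be supported in the open half. The
    cutoff \<open>\<theta> m\<close> is 0 up to distance 1/m from the hyperplane and 1 beyond 2/m,
    so the product with \<open>\<psi>\<close> is admissible for \<open>u\<close>, and m then tends
    to infinity.\<close>
  define \<tau> where "\<tau> m x = (- \<sigma> * real m * a - 1) + (\<sigma> * real m) * (x \<bullet> i)" for m :: nat and x :: 'a
  have \<tau>: "\<tau> m x = real m * (\<sigma> * (x \<bullet> i - a)) - 1" for m x
    by (simp add: \<tau>_def algebra_simps)
  define \<theta> where "\<theta> m x = step (\<tau> m x)" for m :: nat and x :: 'a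
  have sm\<theta>: "smooth_fun (\<theta> m)" for m
    unfolding \<theta>_def[abs_def] \<tau>_def by (rule smooth_fun_coord[OF smooth_fun_step])
  have d\<theta>: "pderiv_i (\<theta> m) k x = step' (\<tau> m x) * (\<sigma> * real m * (k \<bullet> i))" for m x
    unfolding \<theta>_def[abs_def] \<tau>_def by (rule pderiv_i_coord[OF smooth_fun_step])
  have m\<theta>: "\<theta> m \<in> borel_measurable lebesgue" for m
    by (intro continuous_imp_measurable_lebesgue smooth_fun_continuous_on sm\<theta>)
  have m\<psi>: "\<psi> \<in> borel_measurable lebesgue" "pderiv_i \<psi> k \<in> borel_measurable lebesgue"
    by (rule test_fun_measurable[OF t\<psi>], rule test_fun_measurable[OF test_fun_pderiv[OF t\<psi> k]])
  have md\<theta>: "pderiv_i (\<theta> m) k \<in> borel_measurable lebesgue" for m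
    by (intro continuous_imp_measurable_lebesgue smooth_fun_continuous_on smooth_fun_pderiv sm\<theta> k)
  have \<theta>\<psi>: "test_fun ?S (\<lambda>x. \<theta> m x * \<psi> x)" for m
  proof -
    have cl: "closed {x. 0 \<le> \<tau> m x}"
      unfolding \<tau>_def by (intro closed_Collect_le continuous_intros)
    have 1: "K' \<inter> {x. 0 \<le> \<tau> m x} \<subseteq> ?S"
    proof
      fix x assume x: "x \<in> K' \<inter> {x. 0 \<le> \<tau> m x}"
      then have "0 < real m * (\<sigma> * (x \<bullet> i - a))" by (simp add: \<tau>)
      then show "x \<in> ?S" using x K'(2) by (auto simp: zero_less_mult_iff)
    qed
    have 2: "\<forall>x. x \<notin> K' \<inter> {x. 0 \<le> \<tau> m x} \<longrightarrow> \<theta> m x * \<psi> x = 0"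
      using K'(3) by (auto simp: \<theta>_def step_eq_0 not_le)
    show ?thesis
      unfolding test_fun_def
      using 1 2 smooth_fun_mult[OF sm\<theta> sm] compact_Int_closed[OF K'(1) cl] by blast
  qed
  have \<tau>1: "eventually (\<lambda>m. \<tau> m x > 1) sequentially" if "x \<in> ?S" for x
  proof -
    define t where "t = \<sigma> * (x \<bullet> i - a)"
    have t: "t > 0" using that by (simp add: t_def)
    obtain N where N: "2 / t < real N" using reals_Archimedean2 by blast
    have "\<tau> m x > 1" if "m \<ge> N" for m
    proof -
      have "2 < real N * t" using N t by (simp add: field_simps)
      also have "\<dots> \<le> real m * t" using that t by (intro mult_right_mono) auto
      finally show ?thesis by (simp add: \<tau> t_def)
    qed
    then show ?thesis unfolding eventually_sequentially by blast
  qed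
  have lim1: "(\<lambda>m. LINT x|lebesgue. u x * (\<theta> m x * pderiv_i \<psi> k x)) \<longlonglongrightarrow> (LINT x|lebesgue. u x * pderiv_i \<psi> k x)"
  proof (rule integral_dominated_convergence[where w = "\<lambda>x. B' * norm (u x)"])
    show "AE x in lebesgue. (\<lambda>m. u x * (\<theta> m x * pderiv_i \<psi> k x)) \<longlonglongrightarrow> u x * pderiv_i \<psi> k x"
    proof (rule AE_I2)
      fix x
      show "(\<lambda>m. u x * (\<theta> m x * pderiv_i \<psi> k x)) \<longlonglongrightarrow> u x * pderiv_i \<psi> k x"
      proof (cases "x \<in> ?S")
        case True
        from \<tau>1[OF this] have "eventually (\<lambda>m. u x * (\<theta> m x * pderiv_i \<psi> k x) = u x * pderiv_i \<psi> k x) sequentially"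
          by eventually_elim (simp add: \<theta>_def step_eq_1)
        then show ?thesis by (rule tendsto_eventually)
      next
        case False
        then show ?thesis using W11_eq_0(1)[OF W False] by simp
      qed
    qed
    fix m
    show "AE x in lebesgue. norm (u x * (\<theta> m x * pderiv_i \<psi> k x)) \<le> B' * norm (u x)"
    proof (rule AE_I2)
      fix x
      have "\<bar>\<theta> m x * pderiv_i \<psi> k x\<bar> \<le> 1 * B'"
        unfolding abs_mult using B' step_nonneg[of "\<tau> m x"] step_le_1[of "\<tau> m x"]
        by (intro mult_mono) (auto simp: \<theta>_def)
      then have "\<bar>u x\<bar> * \<bar>\<theta> m x * pderiv_i \<psi> k x\<bar> \<le> \<bar>u x\<bar> * B'" by (intro mult_left_mono) auto
      then show "norm (u x * (\<theta> m x * pderiv_i \<psi> k x)) \<le> B' * norm (u x)"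
        by (simp add: abs_mult mult.commute)
    qed
  qed (use mu m\<theta> m\<psi> Iu in auto)
  have lim2: "(\<lambda>m. LINT x|lebesgue. (g x \<bullet> k) * (\<theta> m x * \<psi> x)) \<longlonglongrightarrow> (LINT x|lebesgue. (g x \<bullet> k) * \<psi> x)"
  proof (rule integral_dominated_convergence[where w = "\<lambda>x. B * norm (g x \<bullet> k)"])
    show "AE x in lebesgue. (\<lambda>m. (g x \<bullet> k) * (\<theta> m x * \<psi> x)) \<longlonglongrightarrow> (g x \<bullet> k) * \<psi> x"
    proof (rule AE_I2)
      fix x
      show "(\<lambda>m. (g x \<bullet> k) * (\<theta> m x * \<psi> x)) \<longlonglongrightarrow> (g x \<bullet> k) * \<psi> x"
      proof (cases "x \<in> ?S")
        case True
        from \<tau>1[OF this] have "eventually (\<lambda>m. (g x \<bullet> k) * (\<theta> m x * \<psi> x) = (g x \<bullet> k) * \<psi> x) sequentially"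
          by eventually_elim (simp add: \<theta>_def step_eq_1)
        then show ?thesis by (rule tendsto_eventually)
      next
        case False
        then show ?thesis using W11_eq_0(2)[OF W False] by simp
      qed
    qed
    fix m
    show "AE x in lebesgue. norm ((g x \<bullet> k) * (\<theta> m x * \<psi> x)) \<le> B * norm (g x \<bullet> k)"
    proof (rule AE_I2)
      fix x
      have "\<bar>\<theta> m x * \<psi> x\<bar> \<le> 1 * B"
        unfolding abs_mult using B step_nonneg[of "\<tau> m x"] step_le_1[of "\<tau> m x"]
        by (intro mult_mono) (auto simp: \<theta>_def)
      then have "\<bar>g x \<bullet> k\<bar> * \<bar>\<theta> m x * \<psi> x\<bar> \<le> \<bar>g x \<bullet> k\<bar> * B" by (intro mult_left_mono) auto
      then show "norm ((g x \<bullet> k) * (\<theta> m x * \<psi> x)) \<le> B * norm (g x \<bullet> k)"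
        by (simp add: abs_mult mult.commute)
    qed
  qed (use mg m\<theta> m\<psi> Ig in auto)
  \<comment> \<open>The slope of \<open>\<theta> m\<close> is at most \<open>D * m\<close>, and it
    lives where the distance t from the hyperplane satisfies \<open>m * t \<le> 2\<close>. The
    oddness of \<open>\<psi>\<close> gives \<open>2 * L * t\<close> there, so the product stays
    below \<open>4 * D * L\<close> uniformly in m. This is the domination needed for
    \<open>lim3\<close>.\<close>
  have bd3: "\<bar>pderiv_i (\<theta> m) k x * \<psi> x\<bar> \<le> D * (4 * L)" if x: "x \<in> ?S" for m x
  proof (cases "k = i \<and> step' (\<tau> m x) \<noteq> 0")
    case False
    then have "pderiv_i (\<theta> m) k x = 0" using i k by (auto simp: d\<theta> inner_Basis)
    then show ?thesis using D L by simp
  next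
    case True
    define t where "t = \<sigma> * (x \<bullet> i - a)"
    have t: "t > 0" "\<bar>x \<bullet> i - a\<bar> = t" using x \<sigma> by (auto simp: t_def abs_mult abs_if split: if_splits)
    have "\<tau> m x \<le> 1" using True step'_eq_0[of "\<tau> m x"] by force
    then have mt: "real m * t \<le> 2" by (simp add: \<tau> t_def)
    have "\<psi> x = - (\<phi> (x + (2 * (a - x \<bullet> i)) *\<^sub>R i) - \<phi> x)"
      using True by (simp add: \<psi>_def \<epsilon>_def reflect_def)
    then have "\<bar>\<psi> x\<bar> \<le> L * \<bar>2 * (a - x \<bullet> i)\<bar>" using L(2)[of x "2 * (a - x \<bullet> i)"] by simp
    then have \<psi>L: "\<bar>\<psi> x\<bar> \<le> L * (2 * t)"
    proof -
      have "\<bar>2 * (a - x \<bullet> i)\<bar> = 2 * t" using t(2) by (simp only: abs_mult abs_minus_commute)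
      then show ?thesis using \<open>\<bar>\<psi> x\<bar> \<le> L * \<bar>2 * (a - x \<bullet> i)\<bar>\<close> by metis
    qed
    have "\<bar>pderiv_i (\<theta> m) k x * \<psi> x\<bar> = \<bar>step' (\<tau> m x)\<bar> * (real m * \<bar>\<psi> x\<bar>)"
      using d\<theta>[of m x] True i \<sigma> by (simp add: abs_mult)
    also have "\<dots> \<le> D * (real m * (L * (2 * t)))"
      using D \<psi>L by (intro mult_mono) auto
    also have "\<dots> = D * (2 * L * (real m * t))" by simp
    also have "\<dots> \<le> D * (2 * L * 2)" using mt D L by (intro mult_left_mono) auto
    finally show ?thesis by simp
  qed
  have lim3: "(\<lambda>m. LINT x|lebesgue. u x * (pderiv_i (\<theta> m) k x * \<psi> x)) \<longlonglongrightarrow> (LINT x|(lebesgue::'a measure). 0)"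
  proof (rule integral_dominated_convergence[where w = "\<lambda>x. D * (4 * L) * norm (u x)"])
    show "AE x in lebesgue. (\<lambda>m. u x * (pderiv_i (\<theta> m) k x * \<psi> x)) \<longlonglongrightarrow> 0"
    proof (rule AE_I2)
      fix x
      show "(\<lambda>m. u x * (pderiv_i (\<theta> m) k x * \<psi> x)) \<longlonglongrightarrow> 0"
      proof (cases "x \<in> ?S")
        case True
        from \<tau>1[OF this] have "eventually (\<lambda>m. u x * (pderiv_i (\<theta> m) k x * \<psi> x) = 0) sequentially"
          by eventually_elim (simp add: d\<theta> step'_eq_0)
        then show ?thesis by (rule tendsto_eventually)
      next
        case False
        then show ?thesis using W11_eq_0(1)[OF W False] by simp
      qed
    qed
    fix m
    show "AE x in lebesgue. norm (u x * (pderiv_i (\<theta> m) k x * \<psi> x)) \<le> D * (4 * L) * norm (u x)"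
    proof (rule AE_I2)
      fix x
      show "norm (u x * (pderiv_i (\<theta> m) k x * \<psi> x)) \<le> D * (4 * L) * norm (u x)"
      proof (cases "x \<in> ?S")
        case True
        then have "\<bar>u x\<bar> * \<bar>pderiv_i (\<theta> m) k x * \<psi> x\<bar> \<le> \<bar>u x\<bar> * (D * (4 * L))"
          using bd3 by (intro mult_left_mono) auto
        then show ?thesis by (simp add: abs_mult mult.commute)
      next
        case False
        then show ?thesis using W11_eq_0(1)[OF W False] by simp
      qed
    qed
  qed (use mu md\<theta> m\<psi> Iu in auto)
  have weak: "(LINT x|lebesgue. u x * (\<theta> m x * pderiv_i \<psi> k x)) + (LINT x|lebesgue. u x * (pderiv_i (\<theta> m) k x * \<psi> x))
      = - (LINT x|lebesgue. (g x \<bullet> k) * (\<theta> m x * \<psi> x))" for m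
  proof -
    have I: "integrable lebesgue (\<lambda>x. u x * (\<theta> m x * pderiv_i \<psi> k x))"
      "integrable lebesgue (\<lambda>x. u x * (pderiv_i (\<theta> m) k x * \<psi> x))"
      by (rule integrable_mult_test[OF Iu test_fun_mult_smooth[OF test_fun_pderiv[OF t\<psi> k] sm\<theta>]],
        rule integrable_mult_test[OF Iu test_fun_mult_smooth[OF t\<psi> smooth_fun_pderiv[OF sm\<theta> k]]])
    have "(LINT x|lebesgue. u x * (\<theta> m x * pderiv_i \<psi> k x) + u x * (pderiv_i (\<theta> m) k x * \<psi> x))
      = (LINT x|lebesgue. u x * pderiv_i (\<lambda>x. \<theta> m x * \<psi> x) k x)"
      by (simp add: pderiv_i_mult[OF sm\<theta> sm] distrib_left)
    then show ?thesis using W11_test[OF W \<theta>\<psi> k] I by simp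
  qed
  have "(\<lambda>m. - (LINT x|lebesgue. (g x \<bullet> k) * (\<theta> m x * \<psi> x))) \<longlonglongrightarrow> (LINT x|lebesgue. u x * pderiv_i \<psi> k x)"
    using tendsto_add[OF lim1 lim3] by (simp add: weak)
  then have main: "(LINT x|lebesgue. u x * pderiv_i \<psi> k x) = - (LINT x|lebesgue. (g x \<bullet> k) * \<psi> x)"
    using tendsto_minus[OF lim2] LIMSEQ_unique by blast
  have dt: "test_fun T (pderiv_i \<phi> k)" by (rule test_fun_pderiv[OF \<phi> k])
  have reft: "test_fun T (\<lambda>x. f (?\<rho> x))" if f: "test_fun T f" for f
  proof -
    obtain C where C: "compact C" "C \<subseteq> T" "\<And>x. x \<notin> C \<Longrightarrow> f x = 0" using f by (auto simp: test_fun_def)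
    have "f (?\<rho> x) = 0" if "x \<notin> ?\<rho> ` C" for x
    proof (rule C(3))
      show "?\<rho> x \<notin> C" using that i by (metis imageI reflect_reflect)
    qed
    moreover have "?\<rho> ` C \<subseteq> T" using C(2) T by auto
    moreover have "compact (?\<rho> ` C)" by (intro compact_continuous_image cont\<rho> C)
    ultimately show ?thesis
      unfolding test_fun_def using smooth_fun_reflect[OF test_fun_smooth[OF f]] by blast
  qed
  have J1: "integrable lebesgue (\<lambda>x. u x * pderiv_i \<phi> k x)" by (rule integrable_mult_test[OF Iu dt])
  have J2: "integrable lebesgue (\<lambda>x. u x * pderiv_i \<phi> k (?\<rho> x))" by (rule integrable_mult_test[OF Iu reft[OF dt]])
  have Igk: "integrable lebesgue (\<lambda>x. g x \<bullet> k)" by (intro integrable_inner_left Ig)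
  have J3: "integrable lebesgue (\<lambda>x. (g x \<bullet> k) * \<phi> x)" by (rule integrable_mult_test[OF Igk \<phi>])
  have J4: "integrable lebesgue (\<lambda>x. (g x \<bullet> k) * \<phi> (?\<rho> x))" by (rule integrable_mult_test[OF Igk reft[OF \<phi>]])
  have J2': "integrable lebesgue (\<lambda>x. u (?\<rho> x) * pderiv_i \<phi> k x)"
    using integrable_reflect[OF i J2, of a] i by simp
  have J4': "integrable lebesgue (\<lambda>x. (g (?\<rho> x) \<bullet> k) * \<phi> x)"
    using integrable_reflect[OF i J4, of a] i by simp
  have e2: "(LINT x|lebesgue. u (?\<rho> x) * pderiv_i \<phi> k x) = (LINT x|lebesgue. u x * pderiv_i \<phi> k (?\<rho> x))"
    using integral_reflect[OF i borel_measurable_integrable[OF J2], of a] i by simp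
  have e4: "(LINT x|lebesgue. (g (?\<rho> x) \<bullet> k) * \<phi> x) = (LINT x|lebesgue. (g x \<bullet> k) * \<phi> (?\<rho> x))"
    using integral_reflect[OF i borel_measurable_integrable[OF J4], of a] i by simp
  have "(LINT x|lebesgue. (u x + u (?\<rho> x)) * pderiv_i \<phi> k x) = (LINT x|lebesgue. u x * pderiv_i \<psi> k x)"
    using J1 J2 J2' e2 by (simp add: distrib_right d\<psi> distrib_left)
  also have "\<dots> = - (LINT x|lebesgue. (g x \<bullet> k) * \<psi> x)" by (rule main)
  also have "(LINT x|lebesgue. (g x \<bullet> k) * \<psi> x) = (LINT x|lebesgue. (g x \<bullet> k) * \<phi> x + \<epsilon> * ((g x \<bullet> k) * \<phi> (?\<rho> x)))"
    by (simp add: \<psi>_def algebra_simps)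
  also have "\<dots> = (LINT x|lebesgue. (g x \<bullet> k) * \<phi> x) + \<epsilon> * (LINT x|lebesgue. (g x \<bullet> k) * \<phi> (?\<rho> x))"
    using J3 J4 by simp
  also have "\<dots> = (LINT x|lebesgue. (g x \<bullet> k) * \<phi> x + \<epsilon> * ((g (?\<rho> x) \<bullet> k) * \<phi> x))"
    using J3 J4' e4 by simp
  also have "\<dots> = (LINT x|lebesgue. ((g x + reflect i 0 (g (?\<rho> x))) \<bullet> k) * \<phi> x)"
    using i k by (intro Bochner_Integration.integral_cong)
      (auto simp: inner_add_left reflect_inner \<epsilon>_def algebra_simps)
  finally show "(LINT x|lebesgue. (u x + u (?\<rho> x)) * pderiv_i \<phi> k x)
      = - (LINT x|lebesgue. ((g x + reflect i 0 (g (?\<rho> x))) \<bullet> k) * \<phi> x)" .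
qed

text \<open>For \<open>s = 1\<close> this is the p-th power of the \<open>W^{1,p}\<close> norm. The
  weight on \<open>u\<close> is matched to a box of width \<open>s\<close>: cutting off at scale
  \<open>s\<close> creates a term of size \<open>u / s\<close>, which the weighted energy already
  controls, so extension constants become independent of the width.\<close>

definition energy :: "real \<Rightarrow> real \<Rightarrow> ('a::euclidean_space \<Rightarrow> real) \<Rightarrow> ('a \<Rightarrow> 'a) \<Rightarrow> ennreal" where
  "energy p s u g = (\<integral>\<^sup>+x. ennreal (\<bar>u x\<bar> powr p / s powr p + norm (g x) powr p) \<partial>lebesgue)"

lemma powr_add_le:
  fixes a b p :: real
  assumes "a \<ge> 0" "b \<ge> 0" "p \<ge> 0"
  shows "(a + b) powr p \<le> 2 powr p * (a powr p + b powr p)"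
proof -
  have "(a + b) powr p \<le> (2 * max a b) powr p" using assms by (intro powr_mono2) auto
  also have "\<dots> = 2 powr p * max a b powr p" by (rule powr_mult)
  also have "\<dots> \<le> 2 powr p * (a powr p + b powr p)"
    by (intro mult_left_mono) (auto simp: max_def)
  finally show ?thesis .
qed

lemma measurable_energy_density:
  fixes u :: "'a \<Rightarrow> real" and g :: "'a \<Rightarrow> 'b::euclidean_space"
  assumes "u \<in> borel_measurable M" "g \<in> borel_measurable M"
  shows "(\<lambda>x. \<bar>u x\<bar> powr p / c + norm (g x) powr p) \<in> borel_measurable M"
  using assms by measurable

lemma energy_le:
  assumes m: "u \<in> borel_measurable lebesgue" "g \<in> borel_measurable lebesgue" and c: "c \<ge> 0"
    and le: "\<And>x. \<bar>u' x\<bar> powr p / s' powr p + norm (g' x) powr p \<le> c * (\<bar>u x\<bar> powr p / s powr p + norm (g x) powr p)"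
  shows "energy p s' u' g' \<le> ennreal c * energy p s u g"
proof -
  have "energy p s' u' g' \<le> (\<integral>\<^sup>+x. ennreal c * ennreal (\<bar>u x\<bar> powr p / s powr p + norm (g x) powr p) \<partial>lebesgue)"
    unfolding energy_def using le c
    by (intro nn_integral_mono) (simp add: ennreal_mult[symmetric] ennreal_leI del: ennreal_plus)
  also have "\<dots> = ennreal c * energy p s u g"
    unfolding energy_def
    by (intro nn_integral_cmult measurable_compose[OF measurable_energy_density measurable_ennreal] m)
  finally show ?thesis .
qed

lemma energy_add:
  assumes p: "p \<ge> 0"
    and mu: "u \<in> borel_measurable lebesgue" "g \<in> borel_measurable lebesgue"
    and mv: "v \<in> borel_measurable lebesgue" "h \<in> borel_measurable lebesgue"
  shows "energy p s (\<lambda>x. u x + v x) (\<lambda>x. g x + h x) \<le> ennreal (2 powr p) * (energy p s u g + energy p s v h)"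
proof -
  let ?d = "\<lambda>u g x. ennreal (\<bar>u x\<bar> powr p / s powr p + norm (g x) powr p)"
  have m: "?d u g \<in> borel_measurable lebesgue" "?d v h \<in> borel_measurable lebesgue"
    by (intro measurable_compose[OF measurable_energy_density measurable_ennreal] mu mv)+
  have "\<bar>u x + v x\<bar> powr p / s powr p + norm (g x + h x) powr p
    \<le> 2 powr p * ((\<bar>u x\<bar> powr p / s powr p + norm (g x) powr p) + (\<bar>v x\<bar> powr p / s powr p + norm (h x) powr p))" for x
  proof -
    have "\<bar>u x + v x\<bar> powr p \<le> (\<bar>u x\<bar> + \<bar>v x\<bar>) powr p" using p by (intro powr_mono2) auto
    also have "\<dots> \<le> 2 powr p * (\<bar>u x\<bar> powr p + \<bar>v x\<bar> powr p)" using p by (intro powr_add_le) auto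
    finally have 1: "\<bar>u x + v x\<bar> powr p / s powr p \<le> 2 powr p * (\<bar>u x\<bar> powr p + \<bar>v x\<bar> powr p) / s powr p"
      by (intro divide_right_mono) auto
    have "norm (g x + h x) powr p \<le> (norm (g x) + norm (h x)) powr p"
      using p by (intro powr_mono2 norm_triangle_ineq) auto
    also have "\<dots> \<le> 2 powr p * (norm (g x) powr p + norm (h x) powr p)" using p by (intro powr_add_le) auto
    finally show ?thesis using 1 by (simp add: algebra_simps add_divide_distrib)
  qed
  then have "energy p s (\<lambda>x. u x + v x) (\<lambda>x. g x + h x) \<le> (\<integral>\<^sup>+x. ennreal (2 powr p) * (?d u g x + ?d v h x) \<partial>lebesgue)"
    unfolding energy_def
    by (intro nn_integral_mono) (simp add: ennreal_plus[symmetric] ennreal_mult[symmetric] ennreal_leI del: ennreal_plus)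
  also have "\<dots> = ennreal (2 powr p) * (energy p s u g + energy p s v h)"
    unfolding energy_def using m by (simp add: nn_integral_cmult nn_integral_add)
  finally show ?thesis .
qed

lemma energy_reflect:
  assumes m: "u \<in> borel_measurable lebesgue" "g \<in> borel_measurable lebesgue" and i: "i \<in> Basis"
  shows "energy p s (\<lambda>x. u (reflect i a x)) (\<lambda>x. reflect i 0 (g (reflect i a x))) = energy p s u g"
  unfolding energy_def norm_reflect0[OF i]
  by (rule nn_integral_reflect[OF i, where f = "\<lambda>x. ennreal (\<bar>u x\<bar> powr p / s powr p + norm (g x) powr p)"])
    (intro measurable_compose[OF measurable_energy_density measurable_ennreal] m)

lemma energy_half_reflect:
  fixes i :: "'a::euclidean_space"
  assumes m: "u \<in> borel_measurable lebesgue" "g \<in> borel_measurable lebesgue" and i: "i \<in> Basis" and p: "p \<ge> 0"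
  shows "energy p s (\<lambda>x. u x + u (reflect i a x)) (\<lambda>x. g x + reflect i 0 (g (reflect i a x)))
    \<le> ennreal (2 powr p * 2) * energy p s u g"
proof -
  have mr: "(\<lambda>x. u (reflect i a x)) \<in> borel_measurable lebesgue"
    "(\<lambda>x. reflect i 0 (g (reflect i a x))) \<in> borel_measurable lebesgue"
    using measurable_compose[OF measurable_reflect[OF i, of a] m(1)]
      measurable_compose[OF measurable_compose[OF measurable_reflect[OF i, of a] m(2)]
        borel_measurable_continuous_onI[OF linear_continuous_on[OF bounded_linear_reflect0[of i]]]]
    by simp_all
  have "energy p s (\<lambda>x. u x + u (reflect i a x)) (\<lambda>x. g x + reflect i 0 (g (reflect i a x)))
    \<le> ennreal (2 powr p) * (energy p s u g + energy p s u g)"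
    using energy_add[OF p m mr, of s] energy_reflect[OF m i, of p s a] by simp
  also have "\<dots> = ennreal (2 powr p * 2) * energy p s u g"
    by (simp add: ennreal_mult mult_2[symmetric] mult.assoc)
  finally show ?thesis .
qed

text \<open>By the product rule the new gradient term is at most \<open>D\<close> times the absolute
  value of \<open>u\<close> over \<open>s\<close>, whose p-th power is \<open>D powr p\<close> times
  the weighted part of the energy. Hence the constant does not involve \<open>s\<close>.\<close>

lemma energy_cutoff:
  fixes i :: "'a::euclidean_space"
  assumes m: "u \<in> borel_measurable lebesgue" "g \<in> borel_measurable lebesgue" and i: "i \<in> Basis" and p: "p \<ge> 0"
    and h: "\<And>x. \<bar>h x\<bar> \<le> 1" "\<And>x. \<bar>h' x\<bar> \<le> D / s" and s: "s > 0" and D: "D \<ge> 1"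
  shows "energy p s (\<lambda>x. h x * u x) (\<lambda>x. h x *\<^sub>R g x + (u x * h' x) *\<^sub>R i)
    \<le> ennreal (1 + 2 powr p * D powr p) * energy p s u g"
proof (rule energy_le[OF m])
  fix x
  have 1: "\<bar>h x * u x\<bar> powr p / s powr p \<le> \<bar>u x\<bar> powr p / s powr p"
    using h(1)[of x] p by (intro divide_right_mono powr_mono2) (auto simp: abs_mult mult_left_le_one_le)
  have "norm (h x *\<^sub>R g x + (u x * h' x) *\<^sub>R i) \<le> \<bar>h x\<bar> * norm (g x) + \<bar>u x\<bar> * \<bar>h' x\<bar>"
    using norm_triangle_ineq[of "h x *\<^sub>R g x" "(u x * h' x) *\<^sub>R i"] i by (simp add: abs_mult)
  also have "\<dots> \<le> norm (g x) + \<bar>u x\<bar> * (D / s)"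
    using h[of x] by (intro add_mono mult_left_mono) (auto simp: mult_left_le_one_le)
  finally have "norm (h x *\<^sub>R g x + (u x * h' x) *\<^sub>R i) powr p \<le> (norm (g x) + \<bar>u x\<bar> * (D / s)) powr p"
    using p by (intro powr_mono2) auto
  also have "\<dots> \<le> 2 powr p * (norm (g x) powr p + (\<bar>u x\<bar> * (D / s)) powr p)"
    using p s D by (intro powr_add_le) auto
  also have "(\<bar>u x\<bar> * (D / s)) powr p = D powr p * (\<bar>u x\<bar> powr p / s powr p)"
    using s D by (simp add: powr_mult powr_divide)
  finally have 2: "norm (h x *\<^sub>R g x + (u x * h' x) *\<^sub>R i) powr p
      \<le> 2 powr p * norm (g x) powr p + 2 powr p * D powr p * (\<bar>u x\<bar> powr p / s powr p)"
    by (simp add: algebra_simps)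
  have "1 \<le> D powr p" using D p by (simp add: ge_one_powr_ge_zero)
  then have "2 powr p * 1 \<le> 2 powr p * D powr p" by (intro mult_left_mono) auto
  then have "2 powr p * norm (g x) powr p \<le> (1 + 2 powr p * D powr p) * norm (g x) powr p"
    by (intro mult_right_mono) (linarith, simp)
  with 1 2 show "\<bar>h x * u x\<bar> powr p / s powr p + norm (h x *\<^sub>R g x + (u x * h' x) *\<^sub>R i) powr p
      \<le> (1 + 2 powr p * D powr p) * (\<bar>u x\<bar> powr p / s powr p + norm (g x) powr p)"
    by (simp add: algebra_simps)
qed simp

section \<open>Extension from strips and boxes with constants independent of the side
  lengths\<close>

lemma pderiv_i_real_affine:
  "smooth_fun h \<Longrightarrow> pderiv_i (\<lambda>t::real. h (c + m * t)) 1 t = pderiv_i h 1 (c + m * t) * m"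
  using pderiv_i_coord[of h c m "1::real" 1 t] by simp

text \<open>This makes the two ramps used across a strip a partition of unity.\<close>

lemma step_symmetric: "step (1 - x) = 1 - step x"
  using step_denom_pos[of x] by (simp add: step_def field_simps)

text \<open>The bounds \<open>2 * \<alpha> - \<beta>\<close> and
  \<open>2 * \<beta> - \<alpha>\<close> describe the strip together with its mirror images in both
  faces. The clauses that compare \<open>x\<close> with some \<open>y\<close> record that a
  reflection moves the coordinate \<open>i\<close> only, and nothing inside the strip. They are
  stated for supports so that they can be composed when one direction after another is
  treated.\<close>

definition strip_extension ::
  "real \<Rightarrow> real \<Rightarrow> 'a::euclidean_space \<Rightarrow> real \<Rightarrow> real \<Rightarrow> real \<Rightarrow> 'a set \<Rightarrow>
    ('a \<Rightarrow> real) \<Rightarrow> ('a \<Rightarrow> 'a) \<Rightarrow> ('a \<Rightarrow> real) \<Rightarrow> ('a \<Rightarrow> 'a) \<Rightarrow> bool"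
where
  "strip_extension p K i \<alpha> \<beta> s T u g v G \<longleftrightarrow> W11 T v G \<and> (\<forall>x. \<alpha> < x \<bullet> i \<and> x \<bullet> i < \<beta> \<longrightarrow> v x = u x) \<and>
    (\<forall>x. v x \<noteq> 0 \<longrightarrow> (\<exists>y. u y \<noteq> 0 \<and> (\<forall>k\<in>Basis. k \<noteq> i \<or> (\<alpha> < x \<bullet> i \<and> x \<bullet> i < \<beta>) \<longrightarrow> y \<bullet> k = x \<bullet> k))) \<and>
    (\<forall>x. v x \<noteq> 0 \<or> G x \<noteq> 0 \<longrightarrow> 2 * \<alpha> - \<beta> < x \<bullet> i \<and> x \<bullet> i < 2 * \<beta> - \<alpha> \<and>
       (\<exists>y. (u y \<noteq> 0 \<or> g y \<noteq> 0) \<and> (\<forall>k\<in>Basis. k \<noteq> i \<longrightarrow> y \<bullet> k = x \<bullet> k))) \<and>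
    energy p s v G \<le> ennreal K * energy p s u g"

text \<open>Both cutoffs of a partition of unity across the strip are extended by zero past the face at
  which they vanish and reflected across the other one.\<close>

lemma W11_strip_extend:
  fixes p :: real
  assumes p: "p \<ge> 0"
  obtains K where "K \<ge> 0"
    "\<And>(i::'a::euclidean_space) \<alpha> \<beta> s T u g. i \<in> Basis \<Longrightarrow> 0 < s \<Longrightarrow> s \<le> \<beta> - \<alpha> \<Longrightarrow>
      (\<forall>a. \<forall>x\<in>T. reflect i a x \<in> T) \<Longrightarrow> W11 (T \<inter> {x. \<alpha> < x \<bullet> i \<and> x \<bullet> i < \<beta>}) u g \<Longrightarrow>
      \<exists>v G. strip_extension p K i \<alpha> \<beta> s T u g v G"
proof -
  obtain D where D: "D \<ge> 1" "\<And>t. \<bar>step' t\<bar> \<le> D" using step'_bounded by blast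
  define c where "c = 1 + 2 powr p * (3 * D) powr p"
  \<comment> \<open>Each half contributes \<open>c\<close> for the cutoff, whose slope is at most
    \<open>3 * D / s\<close>, and \<open>2 powr p * 2\<close> for the even reflection. Adding the
    two halves gives the outer \<open>2 powr p * 2\<close>.\<close>
  define K where "K = 2 powr p * (2 * (2 powr p * 2 * c))"
  have c: "c \<ge> 0" by (simp add: c_def)
  show thesis
  proof (rule that[of K])
    show "K \<ge> 0" using c by (simp add: K_def)
    fix i :: 'a and \<alpha> \<beta> s :: real and T and u g
    assume i: "i \<in> Basis" and s: "0 < s" "s \<le> \<beta> - \<alpha>" and T': "\<forall>a. \<forall>x\<in>T. reflect i a x \<in> T"
      and W: "W11 (T \<inter> {x. \<alpha> < x \<bullet> i \<and> x \<bullet> i < \<beta>}) u g"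
    have T: "\<And>a x. x \<in> T \<Longrightarrow> reflect i a x \<in> T" using T' by blast
    let ?S = "T \<inter> {x. \<alpha> < x \<bullet> i \<and> x \<bullet> i < \<beta>}"
    note m = W11_measurable[OF W]
    define w where "w = \<beta> - \<alpha>"
    have w: "w > 0" "s \<le> w" using s by (auto simp: w_def)
    have w3: "\<alpha> + 2 * w / 3 < \<beta>" "\<alpha> < \<alpha> + w / 3"
      using w(1) by (simp_all add: w_def field_simps)
    \<comment> \<open>The ramp occupies the middle third: \<open>hb\<close> is 0 below
      \<open>\<alpha> + w / 3\<close> and 1 above \<open>\<alpha> + 2 * w / 3\<close>, and
      \<open>ha\<close> is its complement. So \<open>ha * u\<close> may be extended by zero past
      \<beta> and is then reflected at \<alpha>; for \<open>hb * u\<close> the faces are exchanged.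
      The affine form in \<open>t\<close> suits the rules for smoothness and derivatives.\<close>
    define hb where "hb t = step ((- (3 * \<alpha> / w) - 1) + (3 / w) * t)" for t
    define ha where "ha t = step ((2 + 3 * \<alpha> / w) + (- (3 / w)) * t)" for t
    have hb: "hb t = step (3 * (t - \<alpha>) / w - 1)" for t
      by (simp add: hb_def algebra_simps diff_divide_distrib)
    have ha: "ha t = step (1 - (3 * (t - \<alpha>) / w - 1))" for t
      by (simp add: ha_def algebra_simps diff_divide_distrib)
    have hab: "ha t + hb t = 1" for t using step_symmetric[of "3 * (t - \<alpha>) / w - 1"] unfolding ha hb by linarith
    have sm: "smooth_fun ha" "smooth_fun hb"
      unfolding ha_def[abs_def] hb_def[abs_def] by (rule smooth_fun_real_affine[OF smooth_fun_step])+
    have bd: "\<bar>ha t\<bar> \<le> 1" "\<bar>hb t\<bar> \<le> 1" for t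
      by (simp_all add: ha_def hb_def step_nonneg step_le_1)
    have sb: "\<bar>step' \<tau> * m\<bar> \<le> 3 * D / s" if "\<bar>m\<bar> = 3 / w" for \<tau> m
    proof -
      have "\<bar>step' \<tau> * m\<bar> \<le> D * (3 / w)"
        unfolding abs_mult that using D w by (intro mult_right_mono) auto
      also have "\<dots> \<le> D * (3 / s)" using D w s by (intro mult_left_mono divide_left_mono) auto
      finally show ?thesis by (simp add: mult.commute)
    qed
    have dh: "pderiv_i ha 1 t = step' ((2 + 3 * \<alpha> / w) + (- (3 / w)) * t) * (- (3 / w))"
      "pderiv_i hb 1 t = step' ((- (3 * \<alpha> / w) - 1) + (3 / w) * t) * (3 / w)" for t
      unfolding ha_def[abs_def] hb_def[abs_def] by (rule pderiv_i_real_affine[OF smooth_fun_step])+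
    have bd': "\<bar>pderiv_i ha 1 t\<bar> \<le> 3 * D / s" "\<bar>pderiv_i hb 1 t\<bar> \<le> 3 * D / s" for t
      unfolding dh by (rule sb; use w(1) in simp)+
    define ua where "ua x = ha (x \<bullet> i) * u x" for x
    define ub where "ub x = hb (x \<bullet> i) * u x" for x
    define ga where "ga x = ha (x \<bullet> i) *\<^sub>R g x + (u x * pderiv_i ha 1 (x \<bullet> i)) *\<^sub>R i" for x
    define gb where "gb x = hb (x \<bullet> i) *\<^sub>R g x + (u x * pderiv_i hb 1 (x \<bullet> i)) *\<^sub>R i" for x
    have za: "ha t = 0" if "t > \<alpha> + 2 * w / 3" for t
      unfolding ha using w that by (intro step_eq_0) (simp add: field_simps)
    have zb: "hb t = 0" if "t < \<alpha> + w / 3" for t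
      unfolding hb using w that by (intro step_eq_0) (simp add: field_simps)
    have Wa: "W11 (T \<inter> {x. 0 < 1 * (x \<bullet> i - \<alpha>)}) ua ga"
      unfolding ua_def[abs_def] ga_def[abs_def]
    proof (rule W11_cutoff[OF W _ i sm(1) bd(1) bd'(1), where Z = "{x. x \<bullet> i \<le> \<alpha> + 2 * w / 3}"])
      show "closed {x. x \<bullet> i \<le> \<alpha> + 2 * w / 3}" by (intro closed_Collect_le continuous_intros)
      show "ha (x \<bullet> i) = 0" if "x \<notin> {x. x \<bullet> i \<le> \<alpha> + 2 * w / 3}" for x
        using that by (intro za) auto
      show "T \<inter> {x. 0 < 1 * (x \<bullet> i - \<alpha>)} \<inter> {x. x \<bullet> i \<le> \<alpha> + 2 * w / 3} \<subseteq> ?S"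
        using w3 by auto
    qed auto
    have Wb: "W11 (T \<inter> {x. 0 < (-1) * (x \<bullet> i - \<beta>)}) ub gb"
      unfolding ub_def[abs_def] gb_def[abs_def]
    proof (rule W11_cutoff[OF W _ i sm(2) bd(2) bd'(2), where Z = "{x. \<alpha> + w / 3 \<le> x \<bullet> i}"])
      show "closed {x. \<alpha> + w / 3 \<le> x \<bullet> i}" by (intro closed_Collect_le continuous_intros)
      show "hb (x \<bullet> i) = 0" if "x \<notin> {x. \<alpha> + w / 3 \<le> x \<bullet> i}" for x
        using that by (intro zb) auto
      show "T \<inter> {x. 0 < (-1) * (x \<bullet> i - \<beta>)} \<inter> {x. \<alpha> + w / 3 \<le> x \<bullet> i} \<subseteq> ?S"
        using w3 by auto
    qed auto
    define va where "va x = ua x + ua (reflect i \<alpha> x)" for x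
    define vb where "vb x = ub x + ub (reflect i \<beta> x)" for x
    define Ga where "Ga x = ga x + reflect i 0 (ga (reflect i \<alpha> x))" for x
    define Gb where "Gb x = gb x + reflect i 0 (gb (reflect i \<beta> x))" for x
    define v where "v x = va x + vb x" for x
    define G where "G x = Ga x + Gb x" for x
    have Wva: "W11 T va Ga"
      unfolding va_def[abs_def] Ga_def[abs_def] by (rule W11_reflect[OF Wa i _ T]) auto
    have Wvb: "W11 T vb Gb"
      unfolding vb_def[abs_def] Gb_def[abs_def] by (rule W11_reflect[OF Wb i _ T]) auto
    have Wv: "W11 T v G"
      unfolding v_def[abs_def] G_def[abs_def] by (rule W11_add[OF Wva Wvb])
    have in_S: "\<alpha> < x \<bullet> i \<and> x \<bullet> i < \<beta>" if "ua x \<noteq> 0 \<or> ga x \<noteq> 0 \<or> ub x \<noteq> 0 \<or> gb x \<noteq> 0" for x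
    proof (rule ccontr)
      assume "\<not> (\<alpha> < x \<bullet> i \<and> x \<bullet> i < \<beta>)"
      then have "x \<notin> ?S" by blast
      from W11_eq_0[OF W this] that show False by (simp add: ua_def ub_def ga_def gb_def)
    qed
    have r: "reflect i a x \<bullet> i = 2 * a - x \<bullet> i" for a x using i by (simp add: reflect_inner)
    have r0: "reflect i 0 z = 0" if "z = 0" for z using that by (simp add: reflect_def)
    \<comment> \<open>Inside the strip no mirror image contributes: reflecting in either face leads
      out of the strip, where \<open>u\<close> vanishes.\<close>
    have out: "ua (reflect i \<alpha> x) = 0 \<and> ub (reflect i \<beta> x) = 0" if "\<alpha> < x \<bullet> i \<and> x \<bullet> i < \<beta>" for x
      using in_S[of "reflect i \<alpha> x"] in_S[of "reflect i \<beta> x"] that by (auto simp: r)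
    have v_eq: "v x = u x" if "\<alpha> < x \<bullet> i \<and> x \<bullet> i < \<beta>" for x
    proof -
      have "v x = ua x + ub x" using out[OF that] by (simp add: v_def va_def vb_def)
      also have "\<dots> = (ha (x \<bullet> i) + hb (x \<bullet> i)) * u x" by (simp add: ua_def ub_def distrib_right)
      finally show ?thesis using hab by simp
    qed
    have v_ne: "\<exists>y. u y \<noteq> 0 \<and> (\<forall>k\<in>Basis. k \<noteq> i \<or> (\<alpha> < x \<bullet> i \<and> x \<bullet> i < \<beta>) \<longrightarrow> y \<bullet> k = x \<bullet> k)"
      if vx: "v x \<noteq> 0" for x
    proof (cases "\<alpha> < x \<bullet> i \<and> x \<bullet> i < \<beta>")
      case True
      then show ?thesis using v_eq vx by auto
    next
      case False
      have "u x \<noteq> 0 \<or> u (reflect i \<alpha> x) \<noteq> 0 \<or> u (reflect i \<beta> x) \<noteq> 0"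
        using vx by (auto simp: v_def va_def vb_def ua_def ub_def)
      then obtain y where y: "u y \<noteq> 0" "y = x \<or> y = reflect i \<alpha> x \<or> y = reflect i \<beta> x" by blast
      have "\<forall>k\<in>Basis. k \<noteq> i \<longrightarrow> y \<bullet> k = x \<bullet> k" using y(2) i by (auto simp: reflect_inner)
      then show ?thesis using False y(1) by blast
    qed
    have ne: "u y \<noteq> 0 \<or> g y \<noteq> 0" if "ua y \<noteq> 0 \<or> ga y \<noteq> 0 \<or> ub y \<noteq> 0 \<or> gb y \<noteq> 0" for y
      using that by (auto simp: ua_def ub_def ga_def gb_def)
    have G_ne: "2 * \<alpha> - \<beta> < x \<bullet> i \<and> x \<bullet> i < 2 * \<beta> - \<alpha> \<and>
           (\<exists>y. (u y \<noteq> 0 \<or> g y \<noteq> 0) \<and> (\<forall>k\<in>Basis. k \<noteq> i \<longrightarrow> y \<bullet> k = x \<bullet> k))"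
      if "v x \<noteq> 0 \<or> G x \<noteq> 0" for x
    proof -
      let ?P = "\<lambda>y. ua y \<noteq> 0 \<or> ga y \<noteq> 0 \<or> ub y \<noteq> 0 \<or> gb y \<noteq> 0"
      have "?P x \<or> ?P (reflect i \<alpha> x) \<or> ?P (reflect i \<beta> x)"
        using that by (auto simp: v_def G_def va_def vb_def Ga_def Gb_def r0)
      then obtain y where y: "?P y" "y = x \<or> y = reflect i \<alpha> x \<or> y = reflect i \<beta> x" by blast
      have "\<forall>k\<in>Basis. k \<noteq> i \<longrightarrow> y \<bullet> k = x \<bullet> k" using y(2) i by (auto simp: reflect_inner)
      moreover have "2 * \<alpha> - \<beta> < x \<bullet> i \<and> x \<bullet> i < 2 * \<beta> - \<alpha>"
        using in_S[OF y(1)] y(2) w(1) by (auto simp: r w_def)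
      ultimately show ?thesis using ne[OF y(1)] by blast
    qed
    have Ea: "energy p s va Ga \<le> ennreal (2 powr p * 2 * c) * energy p s u g"
    proof -
      have "energy p s va Ga \<le> ennreal (2 powr p * 2) * energy p s ua ga"
        unfolding va_def[abs_def] Ga_def[abs_def] by (rule energy_half_reflect[OF W11_measurable[OF Wa] i p])
      also have "\<dots> \<le> ennreal (2 powr p * 2) * (ennreal c * energy p s u g)"
        unfolding ua_def[abs_def] ga_def[abs_def] c_def
        using D s by (intro mult_left_mono energy_cutoff[OF m i p bd(1) bd'(1)]) auto
      finally show ?thesis using c by (simp add: ennreal_mult mult.assoc)
    qed
    have Eb: "energy p s vb Gb \<le> ennreal (2 powr p * 2 * c) * energy p s u g"
    proof -
      have "energy p s vb Gb \<le> ennreal (2 powr p * 2) * energy p s ub gb"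
        unfolding vb_def[abs_def] Gb_def[abs_def] by (rule energy_half_reflect[OF W11_measurable[OF Wb] i p])
      also have "\<dots> \<le> ennreal (2 powr p * 2) * (ennreal c * energy p s u g)"
        unfolding ub_def[abs_def] gb_def[abs_def] c_def
        using D s by (intro mult_left_mono energy_cutoff[OF m i p bd(2) bd'(2)]) auto
      finally show ?thesis using c by (simp add: ennreal_mult mult.assoc)
    qed
    have "energy p s v G \<le> ennreal (2 powr p) * (energy p s va Ga + energy p s vb Gb)"
      unfolding v_def[abs_def] G_def[abs_def]
      by (rule energy_add[OF p W11_measurable[OF Wva] W11_measurable[OF Wvb]])
    also have "\<dots> \<le> ennreal (2 powr p) * (ennreal (2 powr p * 2 * c) * energy p s u g + ennreal (2 powr p * 2 * c) * energy p s u g)"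
      by (intro mult_left_mono add_mono Ea Eb) auto
    also have "\<dots> = ennreal K * energy p s u g"
      unfolding K_def using c by (simp add: ennreal_mult mult_2[symmetric] mult_ac)
    finally have E: "energy p s v G \<le> ennreal K * energy p s u g" .
    show "\<exists>v G. strip_extension p K i \<alpha> \<beta> s T u g v G"
      unfolding strip_extension_def
      by (rule exI[of _ v], rule exI[of _ G], intro conjI allI impI Wv v_eq v_ne G_ne[THEN conjunct1]
          G_ne[THEN conjunct2, THEN conjunct1] G_ne[THEN conjunct2, THEN conjunct2] E) blast+
  qed
qed

text \<open>The clause relating \<open>v x \<noteq> 0\<close> to some \<open>u y \<noteq> 0\<close> says that reflections across the other faces
  preserve vanishing on slabs orthogonal to a basis vector.\<close>

definition box_extension ::
  "real \<Rightarrow> real \<Rightarrow> 'a::euclidean_space \<Rightarrow> 'a \<Rightarrow> 'a set \<Rightarrow> real \<Rightarrow>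
    ('a \<Rightarrow> real) \<Rightarrow> ('a \<Rightarrow> 'a) \<Rightarrow> ('a \<Rightarrow> real) \<Rightarrow> ('a \<Rightarrow> 'a) \<Rightarrow> bool"
where
  "box_extension p K a b J s u g v G \<longleftrightarrow> W11 {x. \<forall>k\<in>Basis - J. a \<bullet> k < x \<bullet> k \<and> x \<bullet> k < b \<bullet> k} v G \<and> (\<forall>x\<in>box a b. v x = u x) \<and>
    (\<forall>x. v x \<noteq> 0 \<longrightarrow> (\<exists>y. u y \<noteq> 0 \<and> (\<forall>k\<in>Basis. a \<bullet> k < x \<bullet> k \<and> x \<bullet> k < b \<bullet> k \<longrightarrow> y \<bullet> k = x \<bullet> k))) \<and>
    (\<forall>x. v x \<noteq> 0 \<or> G x \<noteq> 0 \<longrightarrow> (\<forall>k\<in>J. 2 * (a \<bullet> k) - b \<bullet> k < x \<bullet> k \<and> x \<bullet> k < 2 * (b \<bullet> k) - a \<bullet> k)) \<and>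
    energy p s v G \<le> ennreal K * energy p s u g"

text \<open>Induction over the set \<open>J\<close> of directions already treated; the constants of
  the successive strips multiply. The constant is quantified before box, scale and function because
  it has to serve infinitely many boxes of very different proportions. Only a lower bound
  \<open>s\<close> for all sides enters.\<close>

lemma W11_box_extend:
  fixes p :: real and J :: "'a::euclidean_space set"
  assumes p: "p \<ge> 0" and J: "J \<subseteq> Basis"
  shows "\<exists>K\<ge>0. \<forall>a b s u g. 0 < s \<longrightarrow> (\<forall>k\<in>Basis. s \<le> b \<bullet> k - a \<bullet> k) \<longrightarrow> W11 (box a b) u g \<longrightarrow>
     (\<exists>v G. box_extension p K a b J s u g v G)"
proof -
  have "finite J" using J finite_Basis finite_subset by blast
  then show ?thesis using J
  proof (induction J rule: finite_induct)
    case empty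
    show ?case
    proof (intro exI[of _ 1] conjI allI impI)
      fix a b :: 'a and s :: real and u :: "'a \<Rightarrow> real" and g
      assume W: "W11 (box a b) u g"
      have "{x. \<forall>k\<in>Basis - {}. a \<bullet> k < x \<bullet> k \<and> x \<bullet> k < b \<bullet> k} = box a b" by (auto simp: mem_box)
      then show "\<exists>v G. box_extension p 1 a b {} s u g v G"
        using W unfolding box_extension_def by (intro exI[of _ u] exI[of _ g]) auto
    qed simp
  next
    case (insert i J)
    then have i: "i \<in> Basis" and "J \<subseteq> Basis" by auto
    then have "\<exists>K\<ge>0. \<forall>a b s u g. 0 < s \<longrightarrow> (\<forall>k\<in>Basis. s \<le> b \<bullet> k - a \<bullet> k) \<longrightarrow> W11 (box a b) u g \<longrightarrow> (\<exists>v G. box_extension p K a b J s u g v G)"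
      using insert.IH by blast
    then obtain K1 where K1: "K1 \<ge> 0"
      "\<forall>a b s u g. 0 < s \<longrightarrow> (\<forall>k\<in>Basis. s \<le> b \<bullet> k - a \<bullet> k) \<longrightarrow> W11 (box a b) u g \<longrightarrow> (\<exists>v G. box_extension p K1 a b J s u g v G)"
      by (elim exE conjE) (rule that)
    show ?case
    proof (rule W11_strip_extend[OF p])
      fix K2 :: real
      assume K2: "K2 \<ge> 0"
      "\<And>(i::'a) \<alpha> \<beta> s T u g. i \<in> Basis \<Longrightarrow> 0 < s \<Longrightarrow> s \<le> \<beta> - \<alpha> \<Longrightarrow>
      (\<forall>a. \<forall>x\<in>T. reflect i a x \<in> T) \<Longrightarrow> W11 (T \<inter> {x. \<alpha> < x \<bullet> i \<and> x \<bullet> i < \<beta>}) u g \<Longrightarrow>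
      \<exists>v G. strip_extension p K2 i \<alpha> \<beta> s T u g v G"
      show ?case
      proof (intro exI[of _ "K2 * K1"] conjI allI impI)
        show "0 \<le> K2 * K1" using K1(1) K2(1) by simp
        fix a b :: 'a and s :: real and u :: "'a \<Rightarrow> real" and g
        assume s: "0 < s" "\<forall>k\<in>Basis. s \<le> b \<bullet> k - a \<bullet> k" and W: "W11 (box a b) u g"
        \<comment> \<open>The directions not yet treated still confine the function to this product
          of strips. It puts no condition on the coordinate \<open>i\<close>, hence is invariant
          under the reflections that treat it.\<close>
        let ?T = "{x. \<forall>k\<in>Basis - insert i J. a \<bullet> k < x \<bullet> k \<and> x \<bullet> k < b \<bullet> k}"
        from K1(2)[THEN spec[of _ a], THEN spec[of _ b], THEN spec[of _ s], THEN spec[of _ u], THEN spec[of _ g], THEN mp, THEN mp, THEN mp, OF s W, unfolded box_extension_def] obtain v G where v: "W11 {x. \<forall>k\<in>Basis - J. a \<bullet> k < x \<bullet> k \<and> x \<bullet> k < b \<bullet> k} v G"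
          "\<forall>x\<in>box a b. v x = u x"
          "\<forall>x. v x \<noteq> 0 \<longrightarrow> (\<exists>y. u y \<noteq> 0 \<and> (\<forall>k\<in>Basis. a \<bullet> k < x \<bullet> k \<and> x \<bullet> k < b \<bullet> k \<longrightarrow> y \<bullet> k = x \<bullet> k))"
          "\<forall>x. v x \<noteq> 0 \<or> G x \<noteq> 0 \<longrightarrow> (\<forall>k\<in>J. 2 * (a \<bullet> k) - b \<bullet> k < x \<bullet> k \<and> x \<bullet> k < 2 * (b \<bullet> k) - a \<bullet> k)"
          "energy p s v G \<le> ennreal K1 * energy p s u g"
          by (elim exE conjE) (rule that)
        have eq: "{x. \<forall>k\<in>Basis - J. a \<bullet> k < x \<bullet> k \<and> x \<bullet> k < b \<bullet> k} = ?T \<inter> {x. a \<bullet> i < x \<bullet> i \<and> x \<bullet> i < b \<bullet> i}"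
          using i insert.hyps by auto
        have inv: "\<forall>c. \<forall>x\<in>?T. reflect i c x \<in> ?T"
          using i by (auto simp: reflect_inner)
        have si: "s \<le> b \<bullet> i - a \<bullet> i" using s i by blast
        from K2(2)[OF i s(1) si inv v(1)[unfolded eq], unfolded strip_extension_def] obtain v' G' where v': "W11 ?T v' G'"
          "\<forall>x. a \<bullet> i < x \<bullet> i \<and> x \<bullet> i < b \<bullet> i \<longrightarrow> v' x = v x"
          "\<forall>x. v' x \<noteq> 0 \<longrightarrow> (\<exists>y. v y \<noteq> 0 \<and> (\<forall>k\<in>Basis. k \<noteq> i \<or> (a \<bullet> i < x \<bullet> i \<and> x \<bullet> i < b \<bullet> i) \<longrightarrow> y \<bullet> k = x \<bullet> k))"
          "\<forall>x. v' x \<noteq> 0 \<or> G' x \<noteq> 0 \<longrightarrow> 2 * (a \<bullet> i) - b \<bullet> i < x \<bullet> i \<and> x \<bullet> i < 2 * (b \<bullet> i) - a \<bullet> i \<and>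
             (\<exists>y. (v y \<noteq> 0 \<or> G y \<noteq> 0) \<and> (\<forall>k\<in>Basis. k \<noteq> i \<longrightarrow> y \<bullet> k = x \<bullet> k))"
          "energy p s v' G' \<le> ennreal K2 * energy p s v G"
          by (elim exE conjE) (rule that)
        show "\<exists>v G. box_extension p (K2 * K1) a b (insert i J) s u g v G"
          unfolding box_extension_def
        proof (rule exI[of _ v'], rule exI[of _ G'], intro conjI)
          show "W11 ?T v' G'" by (rule v'(1))
          show "\<forall>x\<in>box a b. v' x = u x" using v'(2) v(2) i by (simp add: mem_box)
          show "\<forall>x. v' x \<noteq> 0 \<longrightarrow> (\<exists>y. u y \<noteq> 0 \<and> (\<forall>k\<in>Basis. a \<bullet> k < x \<bullet> k \<and> x \<bullet> k < b \<bullet> k \<longrightarrow> y \<bullet> k = x \<bullet> k))"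
          proof (intro allI impI)
            fix x assume "v' x \<noteq> 0"
            then obtain y where y: "v y \<noteq> 0"
              "\<forall>k\<in>Basis. k \<noteq> i \<or> (a \<bullet> i < x \<bullet> i \<and> x \<bullet> i < b \<bullet> i) \<longrightarrow> y \<bullet> k = x \<bullet> k" using v'(3)[THEN spec, THEN mp] by blast
            then obtain z where z: "u z \<noteq> 0" "\<forall>k\<in>Basis. a \<bullet> k < y \<bullet> k \<and> y \<bullet> k < b \<bullet> k \<longrightarrow> z \<bullet> k = y \<bullet> k"
              using v(3)[THEN spec, THEN mp] by blast
            have "z \<bullet> k = x \<bullet> k" if "k \<in> Basis" "a \<bullet> k < x \<bullet> k" "x \<bullet> k < b \<bullet> k" for k
            proof -
              have "y \<bullet> k = x \<bullet> k" using y(2) that by (cases "k = i") auto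
              then show ?thesis using z(2) that by auto
            qed
            then show "\<exists>y. u y \<noteq> 0 \<and> (\<forall>k\<in>Basis. a \<bullet> k < x \<bullet> k \<and> x \<bullet> k < b \<bullet> k \<longrightarrow> y \<bullet> k = x \<bullet> k)"
              using z(1) by blast
          qed
          show "\<forall>x. v' x \<noteq> 0 \<or> G' x \<noteq> 0 \<longrightarrow> (\<forall>k\<in>insert i J. 2 * (a \<bullet> k) - b \<bullet> k < x \<bullet> k \<and> x \<bullet> k < 2 * (b \<bullet> k) - a \<bullet> k)"
          proof (intro allI impI ballI)
            fix x k assume x: "v' x \<noteq> 0 \<or> G' x \<noteq> 0" and k: "k \<in> insert i J"
            note x' = v'(4)[THEN spec, THEN mp, OF x]
            show "2 * (a \<bullet> k) - b \<bullet> k < x \<bullet> k \<and> x \<bullet> k < 2 * (b \<bullet> k) - a \<bullet> k"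
            proof (cases "k = i")
              case True
              then show ?thesis using x' by blast
            next
              case False
              from x' obtain y where y: "v y \<noteq> 0 \<or> G y \<noteq> 0" "\<forall>k\<in>Basis. k \<noteq> i \<longrightarrow> y \<bullet> k = x \<bullet> k" by blast
              have "k \<in> J" "k \<in> Basis" using False k insert.prems by auto
              then have "y \<bullet> k = x \<bullet> k" using y(2) False by blast
              then show ?thesis using bspec[OF v(4)[THEN spec, THEN mp, OF y(1)] \<open>k \<in> J\<close>] by simp
            qed
          qed
          have "energy p s v' G' \<le> ennreal K2 * (ennreal K1 * energy p s u g)"
            using v'(5) v(5) by (meson mult_left_mono order_trans zero_le)
          then show "energy p s v' G' \<le> ennreal (K2 * K1) * energy p s u g"
            using K1(1) K2(1) by (simp add: ennreal_mult mult.assoc)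
        qed
      qed
    qed
  qed
qed

text \<open>With all directions treated, the extension is supported in the concentric box with sides
  three times as long, called the halo below.\<close>

lemma box_extension_Basis:
  assumes "box_extension p K a b Basis s u g v G"
  shows "W11 UNIV v G" "\<forall>x\<in>box a b. v x = u x"
    "\<forall>x. v x \<noteq> 0 \<longrightarrow> (\<exists>y. u y \<noteq> 0 \<and> (\<forall>k\<in>Basis. a \<bullet> k < x \<bullet> k \<and> x \<bullet> k < b \<bullet> k \<longrightarrow> y \<bullet> k = x \<bullet> k))"
    "\<forall>x. x \<notin> box (2 *\<^sub>R a - b) (2 *\<^sub>R b - a) \<longrightarrow> v x = 0 \<and> G x = 0"
    "energy p s v G \<le> ennreal K * energy p s u g"
proof -
  note E = assms[unfolded box_extension_def]
  show "W11 UNIV v G" using E by simp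
  have "\<forall>x. v x \<noteq> 0 \<or> G x \<noteq> 0 \<longrightarrow> (\<forall>k\<in>Basis. 2 * (a \<bullet> k) - b \<bullet> k < x \<bullet> k \<and> x \<bullet> k < 2 * (b \<bullet> k) - a \<bullet> k)"
    using E by (elim conjE)
  then show "\<forall>x. x \<notin> box (2 *\<^sub>R a - b) (2 *\<^sub>R b - a) \<longrightarrow> v x = 0 \<and> G x = 0"
    unfolding mem_box inner_diff_left inner_scaleR_left by blast
  show "\<forall>x\<in>box a b. v x = u x"
    "\<forall>x. v x \<noteq> 0 \<longrightarrow> (\<exists>y. u y \<noteq> 0 \<and> (\<forall>k\<in>Basis. a \<bullet> k < x \<bullet> k \<and> x \<bullet> k < b \<bullet> k \<longrightarrow> y \<bullet> k = x \<bullet> k))"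
    "energy p s v G \<le> ennreal K * energy p s u g"
    using E by - (elim conjE, assumption)+
qed

section \<open>Lowering the exponent on disjoint supports\<close>

text \<open>Split at the threshold \<open>L\<close>: below it the first term suffices, above it
  t^(q-p) is at most L^(q-p). With a suitable threshold this pointwise inequality takes the place of
  Hoelder's.\<close>

lemma powr_le_interpolate:
  fixes t L p q :: real
  assumes "t \<ge> 0" "L > 0" "0 < q" "q \<le> p"
  shows "t powr q \<le> L powr q + L powr (q - p) * t powr p"
proof (cases "t \<le> L")
  case True
  then have "t powr q \<le> L powr q" using assms by (intro powr_mono2) auto
  then show ?thesis by (simp add: add_increasing2)
next
  case False
  then have t: "t > L" "t > 0" using assms by auto
  have "t powr q = t powr (q - p) * t powr p" by (simp add: powr_add[symmetric])
  also have "\<dots> \<le> L powr (q - p) * t powr p"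
    using t assms by (intro mult_right_mono powr_mono2') auto
  finally show ?thesis by (simp add: add_increasing)
qed

text \<open>Hoelder's inequality on a set of volume \<open>V\<close>, obtained by integrating the
  pointwise interpolation. The volume term occurs once for \<open>v\<close> and once for
  \<open>G\<close>, the energy term once, whence the factor 3. Since \<open>s \<le> 1\<close>, the
  weight on \<open>v\<close> may be dropped in the passage to scale 1.\<close>

lemma energy_lower_exponent:
  fixes v :: "'a::euclidean_space \<Rightarrow> real"
  assumes m: "v \<in> borel_measurable lebesgue" "G \<in> borel_measurable lebesgue"
    and Q: "Q \<in> sets lebesgue" "emeasure lebesgue Q = ennreal V" "V > 0"
    and out: "\<And>x. x \<notin> Q \<Longrightarrow> v x = 0 \<and> G x = 0"
    and pq: "0 < q" "q \<le> p" and s: "0 < s" "s \<le> 1"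
    and A: "energy p s v G \<le> ennreal A" "A \<ge> 0"
  shows "energy q 1 v G \<le> ennreal (3 * (A powr (q / p) * V powr (1 - q / p)))"
proof (cases "A = 0")
  case True
  have "(\<lambda>x. ennreal (\<bar>v x\<bar> powr p / s powr p + norm (G x) powr p)) \<in> borel_measurable lebesgue"
    by (intro measurable_compose[OF measurable_energy_density measurable_ennreal] m)
  moreover have "energy p s v G = 0" using A True by simp
  ultimately have "AE x in lebesgue. ennreal (\<bar>v x\<bar> powr p / s powr p + norm (G x) powr p) = 0"
    unfolding energy_def by (subst (asm) nn_integral_0_iff_AE) auto
  then have "AE x in lebesgue. v x = 0 \<and> G x = 0"
  proof eventually_elim
    case (elim x)
    then have 0: "\<bar>v x\<bar> powr p / s powr p + norm (G x) powr p \<le> 0" using ennreal_eq_0_iff by blast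
    have "norm (G x) powr p \<ge> 0" "\<bar>v x\<bar> powr p / s powr p \<ge> 0" by simp_all
    with 0 have "norm (G x) powr p = 0" "\<bar>v x\<bar> powr p / s powr p = 0" by linarith+
    then show ?case using s by (simp add: powr_eq_0_iff)
  qed
  then have "energy q 1 v G = (\<integral>\<^sup>+(x::'a). 0 \<partial>lebesgue)"
    unfolding energy_def by (intro nn_integral_cong_AE) (use pq in auto)
  then show ?thesis by simp
next
  case False
  then have A0: "A > 0" using A by simp
  \<comment> \<open>This threshold balances the volume term against the energy term: both become
    \<open>A powr (q / p) * V powr (1 - q / p)\<close>. It would be 0 for \<open>A = 0\<close>,
    which is why that case was treated apart.\<close>
  define L where "L = (A / V) powr (1 / p)"
  have L: "L > 0" using A0 Q(3) by (simp add: L_def)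
  have Lq: "L powr q * V = A powr (q / p) * V powr (1 - q / p)"
    using A0 Q(3) by (simp add: L_def powr_powr powr_divide powr_diff)
  have Lqp: "L powr (q - p) * A = A powr (q / p) * V powr (1 - q / p)"
  proof -
    have "L powr (q - p) = (A / V) powr (q / p - 1)"
      using pq by (simp add: L_def powr_powr diff_divide_distrib)
    also have "\<dots> = A powr (q / p - 1) * V powr (1 - q / p)"
      using A0 Q(3) by (simp add: powr_divide powr_diff)
    also have "\<dots> * A = A powr (q / p) * V powr (1 - q / p)"
      using A0 by (simp add: powr_diff)
    finally show ?thesis .
  qed
  let ?d = "\<lambda>x. ennreal (\<bar>v x\<bar> powr p / s powr p + norm (G x) powr p)"
  have md: "?d \<in> borel_measurable lebesgue"
    by (intro measurable_compose[OF measurable_energy_density measurable_ennreal] m)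
  have le: "ennreal (\<bar>v x\<bar> powr q / 1 powr q + norm (G x) powr q)
      \<le> ennreal (2 * L powr q) * indicator Q x + ennreal (L powr (q - p)) * ?d x" for x
  proof (cases "x \<in> Q")
    case False
    then show ?thesis using out[OF False] pq by simp
  next
    case True
    have s1: "s powr p \<le> 1" using s pq by (simp add: powr_le1)
    have "\<bar>v x\<bar> powr p * s powr p \<le> \<bar>v x\<bar> powr p * 1" using s1 by (intro mult_left_mono) auto
    then have "\<bar>v x\<bar> powr p \<le> \<bar>v x\<bar> powr p / s powr p" using s by (simp add: field_simps)
    then have "L powr (q - p) * \<bar>v x\<bar> powr p \<le> L powr (q - p) * (\<bar>v x\<bar> powr p / s powr p)"
      by (intro mult_left_mono) auto
    then have "\<bar>v x\<bar> powr q + norm (G x) powr q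
       \<le> 2 * L powr q + L powr (q - p) * (\<bar>v x\<bar> powr p / s powr p + norm (G x) powr p)"
      using powr_le_interpolate[OF _ L pq, of "\<bar>v x\<bar>"] powr_le_interpolate[OF _ L pq, of "norm (G x)"]
      unfolding distrib_left by simp
    then show ?thesis using True
      by (simp add: ennreal_plus[symmetric] ennreal_mult[symmetric] ennreal_leI del: ennreal_plus)
  qed
  have "energy q 1 v G \<le> (\<integral>\<^sup>+x. ennreal (2 * L powr q) * indicator Q x + ennreal (L powr (q - p)) * ?d x \<partial>lebesgue)"
    unfolding energy_def by (intro nn_integral_mono le)
  also have "\<dots> = ennreal (2 * L powr q) * emeasure lebesgue Q + ennreal (L powr (q - p)) * energy p s v G"
    unfolding energy_def using md Q(1) by (simp add: nn_integral_add nn_integral_cmult)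
  also have "\<dots> \<le> ennreal (2 * L powr q) * ennreal V + ennreal (L powr (q - p)) * ennreal A"
    using A(1) unfolding Q(2) by (intro add_left_mono mult_left_mono) auto
  also have "\<dots> = ennreal (2 * (L powr q * V) + L powr (q - p) * A)"
    using A0 Q(3) by (simp add: ennreal_mult[symmetric] ennreal_plus[symmetric] del: ennreal_plus)
  also have "\<dots> = ennreal (3 * (A powr (q / p) * V powr (1 - q / p)))"
    unfolding Lq Lqp by simp
  finally show ?thesis .
qed

text \<open>At each point at most one summand is nonzero, so the only issue is to exchange sum and
  integral in the weak formulation. For this the \<open>L^1\<close> norms must be summable, and they
  are bounded by volume plus \<open>q\<close>-energy.\<close>

lemma W11_disjoint_sum:
  fixes v :: "nat \<Rightarrow> 'a::euclidean_space \<Rightarrow> real"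
  assumes W: "\<And>j. W11 UNIV (v j) (G j)"
    and Q: "disjoint_family Q" "\<And>j. Q j \<in> sets lebesgue" "\<And>j. emeasure lebesgue (Q j) \<le> ennreal (V j)"
    and V: "summable V" "\<And>j. V j \<ge> 0"
    and out0: "\<forall>j x. x \<notin> Q j \<longrightarrow> v j x = 0 \<and> G j x = 0"
    and e: "\<And>j. energy q 1 (v j) (G j) \<le> ennreal (e j)" "summable e" "\<And>j. e j \<ge> 0" and q: "q \<ge> 1"
  shows "\<exists>U H. W11 UNIV U H \<and> (\<forall>j. \<forall>x\<in>Q j. U x = v j x \<and> H x = G j x) \<and>
    (\<forall>x. (\<forall>j. x \<notin> Q j) \<longrightarrow> U x = 0 \<and> H x = 0) \<and> energy q 1 U H \<le> ennreal (\<Sum>j. e j)"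
proof -
  have out: "\<And>j x. x \<notin> Q j \<Longrightarrow> v j x = 0 \<and> G j x = 0" using out0 by blast
  define U where "U x = (\<Sum>j. v j x)" for x
  define H where "H x = (\<Sum>j. G j x)" for x
  have fin: "finite {j. x \<in> Q j}" for x
  proof -
    have "{j. x \<in> Q j} \<subseteq> {SOME j. x \<in> Q j}"
      using Q(1) by (auto simp: disjoint_family_on_def) (metis disjoint_iff someI)
    then show ?thesis by (rule finite_subset) simp
  qed
  have sv: "summable (\<lambda>j. v j x)" "summable (\<lambda>j. norm (v j x))"
    "summable (\<lambda>j. G j x)" "summable (\<lambda>j. norm (G j x))" for x
    by (rule summable_finite[OF fin[of x]]; use out in auto)+
  have one: "U x = v j x" "H x = G j x" if "x \<in> Q j" for j x
  proof -
    have "x \<notin> Q k" if "k \<noteq> j" for k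
      using Q(1) \<open>x \<in> Q j\<close> that by (auto simp: disjoint_family_on_def)
    then show "U x = v j x" "H x = G j x"
      unfolding U_def H_def using out by (subst suminf_finite[of "{j}"]; force)+
  qed
  have zero: "U x = 0" "H x = 0" if "\<And>j. x \<notin> Q j" for x
    using out that by (simp_all add: U_def H_def)
  \<comment> \<open>Converts bounds on q-th powers into \<open>L^1\<close> bounds on sets of finite
    volume.\<close>
  have Lpow: "t \<le> 1 + t powr q" if "t \<ge> 0" for t :: real
  proof (cases "t \<le> 1")
    case False
    then have "t powr 1 \<le> t powr q" using q by (intro powr_mono) auto
    then show ?thesis using False by simp
  qed (simp add: add_increasing2)
  have nb: "(\<integral>\<^sup>+x. ennreal (norm (f x)) \<partial>lebesgue) \<le> ennreal (V j + e j)"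
    if f: "\<And>x. x \<notin> Q j \<Longrightarrow> norm (f x) = 0" "\<And>x. norm (f x) powr q \<le> \<bar>v j x\<bar> powr q / 1 powr q + norm (G j x) powr q"
    for f :: "'a \<Rightarrow> 'b::real_normed_vector" and j
  proof -
    let ?d = "\<lambda>x. ennreal (\<bar>v j x\<bar> powr q / 1 powr q + norm (G j x) powr q)"
    have md: "?d \<in> borel_measurable lebesgue"
      by (intro measurable_compose[OF measurable_energy_density measurable_ennreal] W11_measurable[OF W])
    have "ennreal (norm (f x)) \<le> indicator (Q j) x + ?d x" for x
    proof (cases "x \<in> Q j")
      case True
      have "norm (f x) \<le> 1 + (\<bar>v j x\<bar> powr q / 1 powr q + norm (G j x) powr q)"
        using Lpow[of "norm (f x)"] f(2)[of x] by simp
      then have "ennreal (norm (f x)) \<le> ennreal (1 + (\<bar>v j x\<bar> powr q / 1 powr q + norm (G j x) powr q))"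
        by (rule ennreal_leI)
      also have "\<dots> = ennreal 1 + ?d x" by (rule ennreal_plus) auto
      finally show ?thesis using True by simp
    qed (use f(1) in simp)
    then have "(\<integral>\<^sup>+x. ennreal (norm (f x)) \<partial>lebesgue) \<le> (\<integral>\<^sup>+x. indicator (Q j) x + ?d x \<partial>lebesgue)"
      by (intro nn_integral_mono)
    also have "\<dots> = emeasure lebesgue (Q j) + energy q 1 (v j) (G j)"
      unfolding energy_def using md Q(2) by (simp add: nn_integral_add)
    also have "\<dots> \<le> ennreal (V j) + ennreal (e j)" by (intro add_mono Q(3) e(1))
    also have "\<dots> = ennreal (V j + e j)" using V(2) e(3) by (simp add: ennreal_plus)
    finally show ?thesis .
  qed
  have sVe: "summable (\<lambda>j. V j + e j)" by (intro summable_add V e)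
  have nv: "(LINT x|lebesgue. norm (v j x)) \<le> V j + e j" for j
  proof -
    have "ennreal (LINT x|lebesgue. norm (v j x)) = (\<integral>\<^sup>+x. ennreal (norm (v j x)) \<partial>lebesgue)"
      using W11_integrable(1)[OF W[of j]] by (intro nn_integral_eq_integral[symmetric]) auto
    also have "\<dots> \<le> ennreal (V j + e j)" by (rule nb) (use out in auto)
    finally show ?thesis
      using V(2)[of j] e(3)[of j] by (subst (asm) ennreal_le_iff) auto
  qed
  have ng: "(LINT x|lebesgue. norm (G j x)) \<le> V j + e j" for j
  proof -
    have "ennreal (LINT x|lebesgue. norm (G j x)) = (\<integral>\<^sup>+x. ennreal (norm (G j x)) \<partial>lebesgue)"
      using W11_integrable(2)[OF W[of j]] by (intro nn_integral_eq_integral[symmetric]) auto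
    also have "\<dots> \<le> ennreal (V j + e j)" by (rule nb) (use out in auto)
    finally show ?thesis
      using V(2)[of j] e(3)[of j] by (subst (asm) ennreal_le_iff) auto
  qed
  have snv: "summable (\<lambda>j. LINT x|lebesgue. norm (v j x))" "summable (\<lambda>j. LINT x|lebesgue. norm (G j x))"
    by (rule summable_comparison_test'[OF sVe, of 0]; use nv ng in simp)+
  have IU: "integrable lebesgue U" "integrable lebesgue H"
    unfolding U_def[abs_def] H_def[abs_def]
    by (intro integrable_suminf W11_integrable[OF W] AE_I2 sv snv)+
  have WU: "W11 UNIV U H"
  proof (rule W11I)
    fix \<phi> :: "'a \<Rightarrow> real" and i :: 'a assume \<phi>: "test_fun UNIV \<phi>" and i: "i \<in> Basis"
    have sum_int: "(\<lambda>j. LINT x|lebesgue. f j x * \<psi> x) sums (LINT x|lebesgue. (\<Sum>j. f j x) * \<psi> x)"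
      if f: "\<And>j. integrable lebesgue (f j)" "\<And>x. summable (\<lambda>j. f j x)" "\<And>x. summable (\<lambda>j. norm (f j x))"
        "summable (\<lambda>j. LINT x|lebesgue. norm (f j x))" and \<psi>: "test_fun UNIV \<psi>"
      for f :: "nat \<Rightarrow> 'a \<Rightarrow> real" and \<psi>
    proof -
      obtain B where B: "B \<ge> 0" "\<And>x. \<bar>\<psi> x\<bar> \<le> B" using test_fun_bounded[OF \<psi>] by blast
      have I: "integrable lebesgue (\<lambda>x. f j x * \<psi> x)" for j by (rule integrable_mult_test[OF f(1) \<psi>])
      have "(\<lambda>j. LINT x|lebesgue. f j x * \<psi> x) sums (LINT x|lebesgue. (\<Sum>j. f j x * \<psi> x))"
      proof (rule sums_integral[OF I])
        show "AE x in lebesgue. summable (\<lambda>j. norm (f j x * \<psi> x))"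
          by (intro AE_I2) (simp add: abs_mult, intro summable_mult2, use f(3) in simp)
        show "summable (\<lambda>j. LINT x|lebesgue. norm (f j x * \<psi> x))"
        proof (rule summable_comparison_test'[OF summable_mult2[OF f(4), of B], of 0])
          fix j :: nat
          have "(LINT x|lebesgue. norm (f j x * \<psi> x)) \<le> (LINT x|lebesgue. norm (f j x) * B)"
          proof (rule integral_mono)
            show "integrable lebesgue (\<lambda>x. norm (f j x * \<psi> x))" by (rule integrable_norm[OF I])
            show "integrable lebesgue (\<lambda>x. norm (f j x) * B)" using f(1)[of j] by simp
          qed (use B(2) in \<open>simp add: abs_mult mult_left_mono\<close>)
          then show "norm (LINT x|lebesgue. norm (f j x * \<psi> x)) \<le> (LINT x|lebesgue. norm (f j x)) * B"
            using f(1)[of j] by simp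
        qed
      qed
      then show ?thesis using suminf_mult2[OF f(2)] by simp
    qed
    have 1: "(\<lambda>j. LINT x|lebesgue. v j x * pderiv_i \<phi> i x) sums (LINT x|lebesgue. U x * pderiv_i \<phi> i x)"
      unfolding U_def by (intro sum_int W11_integrable[OF W] sv snv test_fun_pderiv[OF \<phi> i])
    have sG: "summable (\<lambda>j. norm (G j x \<bullet> i))" for x
      by (rule summable_comparison_test'[OF sv(4)[of x], of 0]) (use i Basis_le_norm in auto)
    have snG: "summable (\<lambda>j. LINT x|lebesgue. norm (G j x \<bullet> i))"
    proof (rule summable_comparison_test'[OF snv(2), of 0])
      fix j :: nat
      have "(LINT x|lebesgue. norm (G j x \<bullet> i)) \<le> (LINT x|lebesgue. norm (G j x))"
        using W11_integrable(2)[OF W[of j]] i Basis_le_norm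
        by (intro integral_mono integrable_norm integrable_inner_left) auto
      then show "norm (LINT x|lebesgue. norm (G j x \<bullet> i)) \<le> (LINT x|lebesgue. norm (G j x))" by simp
    qed
    have "(\<lambda>j. LINT x|lebesgue. (G j x \<bullet> i) * \<phi> x) sums (LINT x|lebesgue. (\<Sum>j. G j x \<bullet> i) * \<phi> x)"
    proof (rule sum_int)
      show "integrable lebesgue (\<lambda>x. G j x \<bullet> i)" for j
        by (intro integrable_inner_left W11_integrable(2)[OF W])
      show "summable (\<lambda>j. G j x \<bullet> i)" for x using sG[of x] by (rule summable_norm_cancel)
    qed (rule sG snG \<phi>)+
    moreover have "(\<Sum>j. G j x \<bullet> i) = H x \<bullet> i" for x
      unfolding H_def using bounded_linear.suminf[OF bounded_linear_inner_left sv(3)] by metis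
    ultimately have 2: "(\<lambda>j. LINT x|lebesgue. (G j x \<bullet> i) * \<phi> x) sums (LINT x|lebesgue. (H x \<bullet> i) * \<phi> x)"
      by simp
    have "(\<lambda>j. LINT x|lebesgue. v j x * pderiv_i \<phi> i x) sums (- (LINT x|lebesgue. (H x \<bullet> i) * \<phi> x))"
      using sums_minus[OF 2] W11_test[OF W \<phi> i] by simp
    then show "(LINT x|lebesgue. U x * pderiv_i \<phi> i x) = - (LINT x|lebesgue. (H x \<bullet> i) * \<phi> x)"
      using 1 sums_unique2 by blast
  qed (use IU in auto)
  have "energy q 1 U H \<le> ennreal (\<Sum>j. e j)"
  proof -
    let ?d = "\<lambda>j x. ennreal (\<bar>v j x\<bar> powr q / 1 powr q + norm (G j x) powr q)"
    have md: "?d j \<in> borel_measurable lebesgue" for j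
      by (intro measurable_compose[OF measurable_energy_density measurable_ennreal] W11_measurable[OF W])
    have "ennreal (\<bar>U x\<bar> powr q / 1 powr q + norm (H x) powr q) \<le> (\<Sum>j. ?d j x)" for x
    proof (cases "\<exists>j. x \<in> Q j")
      case True
      then obtain j where j: "x \<in> Q j" by blast
      have "sum (\<lambda>k. ?d k x) {j} \<le> (\<Sum>k. ?d k x)" by (intro sum_le_suminf) auto
      then show ?thesis using one[OF j] by simp
    next
      case False
      then show ?thesis using zero[of x] q by simp
    qed
    then have "energy q 1 U H \<le> (\<integral>\<^sup>+x. (\<Sum>j. ?d j x) \<partial>lebesgue)"
      unfolding energy_def by (intro nn_integral_mono)
    also have "\<dots> = (\<Sum>j. energy q 1 (v j) (G j))"
      unfolding energy_def by (rule nn_integral_suminf[OF md])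
    also have "\<dots> \<le> (\<Sum>j. ennreal (e j))" by (intro suminf_le e(1)) auto
    also have "\<dots> = ennreal (\<Sum>j. e j)" by (intro suminf_ennreal2 e)
    finally show ?thesis .
  qed
  then show ?thesis
    using WU one zero by (intro exI[of _ U] exI[of _ H] conjI allI impI ballI) blast+
qed

section \<open>Sobolev functions and their zero extensions\<close>

lemma L1loc_measurable:
  fixes f :: "'a::euclidean_space \<Rightarrow> 'b::{banach, second_countable_topology}"
  assumes "open \<Omega>" "L1loc \<Omega> f"
  shows "(\<lambda>x. indicator \<Omega> x *\<^sub>R f x) \<in> borel_measurable lebesgue"
proof -
  obtain C :: "nat \<Rightarrow> 'a set" where C: "\<And>n. compact (C n)" "\<And>n. C n \<subseteq> \<Omega>"
    "\<And>K. \<lbrakk>compact K; K \<subseteq> \<Omega>\<rbrakk> \<Longrightarrow> \<exists>N. \<forall>n\<ge>N. K \<subseteq> C n"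
    by (rule open_Union_compact_subsets[OF assms(1)]) blast
  show ?thesis
  proof (rule borel_measurable_LIMSEQ_metric)
    fix n show "(\<lambda>x. indicator (C n) x *\<^sub>R f x) \<in> borel_measurable lebesgue"
      using assms(2) C(1,2)[of n] unfolding L1loc_def set_integrable_def by auto
  next
    fix x :: 'a
    show "(\<lambda>n. indicator (C n) x *\<^sub>R f x) \<longlonglongrightarrow> indicator \<Omega> x *\<^sub>R f x"
    proof (cases "x \<in> \<Omega>")
      case True
      then obtain N where "\<forall>n\<ge>N. {x} \<subseteq> C n" using C(3)[of "{x}"] by auto
      then have "eventually (\<lambda>n. indicator (C n) x *\<^sub>R f x = indicator \<Omega> x *\<^sub>R f x) sequentially"
        using True unfolding eventually_sequentially by (intro exI[of _ N]) auto
      then show ?thesis by (rule tendsto_eventually)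
    next
      case False
      then have "x \<notin> C n" for n using C(2) by blast
      then show ?thesis using False by simp
    qed
  qed
qed

text \<open>\<open>W11\<close> demands integrability on the whole space. On a set of finite measure
  the \<open>L^p\<close> bound supplies it, which is how boundedness of the domain is used.\<close>

lemma integrable_if_powr:
  fixes f :: "'a::euclidean_space \<Rightarrow> 'b::{banach, second_countable_topology}"
  assumes m: "f \<in> borel_measurable lebesgue" and S: "S \<in> sets lebesgue" "emeasure lebesgue S < \<infinity>"
    and out: "\<And>x. x \<notin> S \<Longrightarrow> f x = 0" and p: "p \<ge> 1"
    and fin: "(\<integral>\<^sup>+x. ennreal (norm (f x) powr p) \<partial>lebesgue) < \<infinity>"
  shows "integrable lebesgue f"
proof (rule integrableI_bounded[OF m])
  have le: "norm (f x) \<le> indicator S x + norm (f x) powr p" for x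
  proof (cases "norm (f x) \<le> 1")
    case True
    then show ?thesis using out[of x] by (cases "x \<in> S") (auto simp: add_increasing2)
  next
    case False
    then have "norm (f x) powr 1 \<le> norm (f x) powr p" using p by (intro powr_mono) auto
    then show ?thesis using False by (simp add: add_increasing)
  qed
  have "ennreal (norm (f x)) \<le> indicator S x + ennreal (norm (f x) powr p)" for x
  proof -
    have "ennreal (norm (f x)) \<le> ennreal (indicat_real S x + norm (f x) powr p)"
      using le by (rule ennreal_leI)
    also have "\<dots> = ennreal (indicat_real S x) + ennreal (norm (f x) powr p)"
      by (rule ennreal_plus) auto
    finally show ?thesis by (simp add: ennreal_indicator)
  qed
  then have "(\<integral>\<^sup>+x. ennreal (norm (f x)) \<partial>lebesgue) \<le> (\<integral>\<^sup>+x. indicator S x + ennreal (norm (f x) powr p) \<partial>lebesgue)"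
    by (intro nn_integral_mono)
  also have "\<dots> = emeasure lebesgue S + (\<integral>\<^sup>+x. ennreal (norm (f x) powr p) \<partial>lebesgue)"
    using m S by (subst nn_integral_add) auto
  also have "\<dots> < \<infinity>" using fin S(2) by simp
  finally show "(\<integral>\<^sup>+x. ennreal (norm (f x)) \<partial>lebesgue) < \<infinity>" .
qed

lemma wgrad_weak_grad: "weakly_diff \<Omega> u \<Longrightarrow> weak_grad \<Omega> u (wgrad \<Omega> u)"
  unfolding weakly_diff_def wgrad_def by (rule someI_ex[of "weak_grad \<Omega> u"])

lemma set_nn_integral_powr:
  fixes f :: "'a \<Rightarrow> 'b::real_normed_vector"
  assumes "p > 0"
  shows "(\<integral>\<^sup>+x\<in>S. ennreal (norm (f x) powr p) \<partial>M) = (\<integral>\<^sup>+x. ennreal (norm (indicator S x *\<^sub>R f x) powr p) \<partial>M)"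
  by (intro nn_integral_cong) (auto simp: indicator_def)

lemma energy_1:
  assumes "v \<in> borel_measurable lebesgue" "G \<in> borel_measurable lebesgue"
  shows "energy p 1 v G = (\<integral>\<^sup>+x. ennreal (norm (v x) powr p) \<partial>lebesgue) + (\<integral>\<^sup>+x. ennreal (norm (G x) powr p) \<partial>lebesgue)"
proof -
  have "(\<lambda>x. ennreal (norm (v x) powr p)) \<in> borel_measurable lebesgue"
    "(\<lambda>x. ennreal (norm (G x) powr p)) \<in> borel_measurable lebesgue"
    using assms by measurable
  then show ?thesis
    unfolding energy_def by (simp add: nn_integral_add[symmetric])
qed

lemma W1p_imp_W11:
  fixes \<Omega> :: "'a::euclidean_space set"
  assumes \<Omega>: "open \<Omega>" "bounded \<Omega>" and u: "W1p \<Omega> p u" and p: "p \<ge> 1"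
  shows "W11 \<Omega> (\<lambda>x. indicator \<Omega> x * u x) (\<lambda>x. indicator \<Omega> x *\<^sub>R wgrad \<Omega> u x)"
    and "energy p 1 (\<lambda>x. indicator \<Omega> x * u x) (\<lambda>x. indicator \<Omega> x *\<^sub>R wgrad \<Omega> u x)
      = ennreal (Lp_pow \<Omega> p u + Lp_pow \<Omega> p (\<lambda>x. norm (wgrad \<Omega> u x)))"
proof -
  let ?g = "wgrad \<Omega> u"
  have wg: "weak_grad \<Omega> u ?g"
    using u by (auto simp: W1p_def L1p_def intro: wgrad_weak_grad)
  have mu: "(\<lambda>x. indicator \<Omega> x * u x) \<in> borel_measurable lebesgue"
    and mg: "(\<lambda>x. indicator \<Omega> x *\<^sub>R ?g x) \<in> borel_measurable lebesgue"
    using L1loc_measurable[OF \<Omega>(1), of u] L1loc_measurable[OF \<Omega>(1), of ?g] wg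
    by (auto simp: weak_grad_def)
  have p0: "p > 0" using p by simp
  have fu: "(\<integral>\<^sup>+x. ennreal (norm (indicator \<Omega> x * u x) powr p) \<partial>lebesgue) < \<infinity>"
    and fu': "(\<integral>\<^sup>+x. ennreal (norm (indicator \<Omega> x * u x) powr p) \<partial>lebesgue) = ennreal (Lp_pow \<Omega> p u)"
    using u set_nn_integral_powr[OF p0, where f = u and S = \<Omega> and M = lebesgue]
    by (simp_all add: W1p_def Lp_on_def Lp_pow_def)
  have fg: "(\<integral>\<^sup>+x. ennreal (norm (indicator \<Omega> x *\<^sub>R ?g x) powr p) \<partial>lebesgue) < \<infinity>"
    and fg': "(\<integral>\<^sup>+x. ennreal (norm (indicator \<Omega> x *\<^sub>R ?g x) powr p) \<partial>lebesgue) = ennreal (Lp_pow \<Omega> p (\<lambda>x. norm (?g x)))"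
    using u set_nn_integral_powr[OF p0, where f = ?g and S = \<Omega> and M = lebesgue]
    by (simp_all add: W1p_def L1p_def Lp_on_def Lp_pow_def)
  have S: "\<Omega> \<in> sets lebesgue" "emeasure lebesgue \<Omega> < \<infinity>"
  proof -
    have "\<Omega> \<in> lmeasurable" using \<Omega> by (rule lmeasurable_open[rotated])
    then show "\<Omega> \<in> sets lebesgue" "emeasure lebesgue \<Omega> < \<infinity>" by (auto simp: fmeasurable_def)
  qed
  have "set_integrable lebesgue \<Omega> u" "set_integrable lebesgue \<Omega> ?g"
    unfolding set_integrable_def
    using integrable_if_powr[OF mu S _ p fu] integrable_if_powr[OF mg S _ p fg] by simp_all
  then show "W11 \<Omega> (\<lambda>x. indicator \<Omega> x * u x) (\<lambda>x. indicator \<Omega> x *\<^sub>R ?g x)"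
    by (intro weak_grad_imp_W11[OF wg subset_refl])
  show "energy p 1 (\<lambda>x. indicator \<Omega> x * u x) (\<lambda>x. indicator \<Omega> x *\<^sub>R ?g x)
      = ennreal (Lp_pow \<Omega> p u + Lp_pow \<Omega> p (\<lambda>x. norm (?g x)))"
    unfolding energy_1[OF mu mg] fu' fg' by (subst ennreal_plus) (auto simp: Lp_pow_def)
qed

lemma wgrad_AE_eq:
  assumes "open \<Omega>" "weak_grad \<Omega> u g"
  shows "AE x in lebesgue. x \<in> \<Omega> \<longrightarrow> wgrad \<Omega> u x = g x"
  using weak_grad_unique[OF assms(1) wgrad_weak_grad assms(2)] assms(2) by (auto simp: weakly_diff_def)

lemma Lp_pow_wgrad_eq:
  assumes "open \<Omega>" "weak_grad \<Omega> u g"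
  shows "(\<integral>\<^sup>+x\<in>\<Omega>. ennreal (\<bar>norm (wgrad \<Omega> u x)\<bar> powr p) \<partial>lebesgue) = (\<integral>\<^sup>+x\<in>\<Omega>. ennreal (norm (g x) powr p) \<partial>lebesgue)"
proof (rule nn_integral_cong_AE)
  show "AE x in lebesgue. ennreal (\<bar>norm (wgrad \<Omega> u x)\<bar> powr p) * indicator \<Omega> x = ennreal (norm (g x) powr p) * indicator \<Omega> x"
    using wgrad_AE_eq[OF assms] by eventually_elim (auto simp: indicator_def)
qed

lemma wgrad_measurable:
  assumes "open \<Omega>" "weakly_diff \<Omega> u"
  shows "(\<lambda>x. norm (wgrad \<Omega> u x)) \<in> borel_measurable (lebesgue_on \<Omega>)"
proof -
  have "L1loc \<Omega> (wgrad \<Omega> u)" using wgrad_weak_grad[OF assms(2)] by (simp add: weak_grad_def)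
  from measurable_compose[OF L1loc_measurable[OF assms(1) this] borel_measurable_continuous_onI[OF continuous_on_norm_id]]
  have "(\<lambda>x. norm (indicator \<Omega> x *\<^sub>R wgrad \<Omega> u x)) \<in> borel_measurable (lebesgue_on \<Omega>)"
    by (rule measurable_restrict_space1)
  then show ?thesis by (rule measurable_cong[THEN iffD1, rotated]) (simp add: space_restrict_space)
qed

lemma W11_imp_W1p:
  fixes v :: "'a::euclidean_space \<Rightarrow> real"
  assumes W: "W11 UNIV v G" and E: "energy q 1 v G \<le> ennreal A" "A \<ge> 0" and q: "q \<ge> 1"
  shows "W1p UNIV q v" "W1p_norm UNIV q v \<le> A powr (1 / q)"
proof -
  let ?X = "\<integral>\<^sup>+x. ennreal (norm (v x) powr q) \<partial>lebesgue" and ?Y = "\<integral>\<^sup>+x. ennreal (norm (G x) powr q) \<partial>lebesgue"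
  note wg = W11_UNIV_imp_weak_grad[OF W]
  have wd: "weakly_diff UNIV v" using wg by (auto simp: weakly_diff_def)
  have XY: "?X + ?Y \<le> ennreal A" using E(1) unfolding energy_1[OF W11_measurable[OF W]] .
  then have fin: "?X < \<infinity>" "?Y < \<infinity>"
    by (auto simp: less_top[symmetric] top_unique dest: order_trans[rotated] intro: ccontr)
  have Y: "(\<integral>\<^sup>+x\<in>UNIV. ennreal (\<bar>norm (wgrad UNIV v x)\<bar> powr q) \<partial>lebesgue) = ?Y"
    using Lp_pow_wgrad_eq[OF open_UNIV wg, of q] by simp
  show "W1p UNIV q v"
    unfolding W1p_def L1p_def Lp_on_def
    using wd wg fin Y wgrad_measurable[OF open_UNIV wd] W11_measurable(1)[OF W]
    by (auto simp: weak_grad_def)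
  have "Lp_pow UNIV q v = enn2real ?X" "Lp_pow UNIV q (\<lambda>x. norm (wgrad UNIV v x)) = enn2real ?Y"
    using Y by (simp_all add: Lp_pow_def)
  moreover have "enn2real ?X + enn2real ?Y = enn2real (?X + ?Y)"
    using fin by (simp add: enn2real_plus)
  moreover have "enn2real (?X + ?Y) \<le> A"
    using XY E(2) by (metis enn2real_mono enn2real_ennreal ennreal_less_top)
  ultimately show "W1p_norm UNIV q v \<le> A powr (1 / q)"
    unfolding W1p_norm_def using q by (intro powr_mono2) (auto simp: Lp_pow_def)
qed

text \<open>The price of a thin box: the extension is uniform in terms of the energy at scale
  \<open>s\<close>, and the given function is bounded only at scale 1.\<close>

lemma energy_scale:
  assumes "u \<in> borel_measurable lebesgue" "g \<in> borel_measurable lebesgue" "0 < s" "s \<le> 1" "p \<ge> 0"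
  shows "energy p s u g \<le> ennreal (s powr (- p)) * energy p 1 u g"
proof (rule energy_le[OF assms(1,2)])
  fix x
  have "1 powr (-p) \<le> s powr (- p)" using assms by (intro powr_mono2') auto
  then have "1 * norm (g x) powr p \<le> s powr (- p) * norm (g x) powr p"
    by (intro mult_right_mono) auto
  then show "\<bar>u x\<bar> powr p / s powr p + norm (g x) powr p \<le> s powr (- p) * (\<bar>u x\<bar> powr p / 1 powr p + norm (g x) powr p)"
    by (simp add: powr_minus distrib_left field_simps)
qed simp

lemma energy_mono_scale:
  assumes "0 < s" "s \<le> 1" "p \<ge> 0"
  shows "energy p 1 u g \<le> energy p s u g"
  unfolding energy_def
proof (intro nn_integral_mono ennreal_leI add_right_mono divide_left_mono)
  show "s powr p \<le> 1 powr p" using assms by (intro powr_mono2) auto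
qed (use assms in auto)

lemma energy_indicator:
  assumes "p > 0"
  shows "energy p s (\<lambda>x. indicator B x * u x) (\<lambda>x. indicator B x *\<^sub>R g x) \<le> energy p s u g"
  unfolding energy_def using assms
  by (intro nn_integral_mono ennreal_leI add_mono divide_right_mono) (auto simp: indicator_def)

lemma energy_cmult_minus: "energy p s (\<lambda>x. (-1) * u x) (\<lambda>x. (-1) *\<^sub>R g x) = energy p s u g"
  by (simp add: energy_def)

text \<open>\<open>A j\<close> bounds the weighted \<open>p\<close>-energy of the j-th piece, and
  \<open>V j\<close> is the volume of its halo. The \<open>p\<close>-energy on each halo is recorded
  in addition to the total \<open>q\<close>-energy, because the remainder \<open>u - U\<close> on a
  corridor is extended once more and has to be controlled with exponent \<open>p\<close> for
  that.\<close>

definition family_extension ::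
  "real \<Rightarrow> real \<Rightarrow> real \<Rightarrow> (nat \<Rightarrow> 'a::euclidean_space) \<Rightarrow> (nat \<Rightarrow> 'a) \<Rightarrow> (nat \<Rightarrow> 'a \<Rightarrow> real) \<Rightarrow>
    (nat \<Rightarrow> real) \<Rightarrow> (nat \<Rightarrow> real) \<Rightarrow> ('a \<Rightarrow> real) \<Rightarrow> ('a \<Rightarrow> 'a) \<Rightarrow> bool"
where
  "family_extension p q K a b u A V U H \<longleftrightarrow> W11 UNIV U H \<and> (\<forall>j. \<forall>x\<in>box (a j) (b j). U x = u j x) \<and>
    (\<forall>x. U x \<noteq> 0 \<longrightarrow> (\<exists>j y. x \<in> box (2 *\<^sub>R a j - b j) (2 *\<^sub>R b j - a j) \<and> u j y \<noteq> 0 \<and>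
       (\<forall>k\<in>Basis. a j \<bullet> k < x \<bullet> k \<and> x \<bullet> k < b j \<bullet> k \<longrightarrow> y \<bullet> k = x \<bullet> k))) \<and>
    (\<forall>x. H x \<noteq> 0 \<longrightarrow> (\<exists>j. x \<in> box (2 *\<^sub>R a j - b j) (2 *\<^sub>R b j - a j))) \<and>
    (\<forall>j. energy p 1 (\<lambda>x. indicator (box (2 *\<^sub>R a j - b j) (2 *\<^sub>R b j - a j)) x * U x)
        (\<lambda>x. indicator (box (2 *\<^sub>R a j - b j) (2 *\<^sub>R b j - a j)) x *\<^sub>R H x) \<le> ennreal (K * A j)) \<and>
    energy q 1 U H \<le> ennreal (K * (\<Sum>j. A j powr (q / p) * V j powr (1 - q / p)))"

lemma W11_box_family_extend:
  fixes p q :: real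
  assumes q: "1 \<le> q" and pq: "q \<le> p"
  obtains K where "K \<ge> 0"
    "\<And>(a::nat \<Rightarrow> 'a::euclidean_space) b s u g A V. (\<And>j. 0 < s j \<and> s j \<le> 1) \<Longrightarrow>
      (\<And>j k. k \<in> Basis \<Longrightarrow> s j \<le> b j \<bullet> k - a j \<bullet> k) \<Longrightarrow>
      disjoint_family (\<lambda>j. box (2 *\<^sub>R a j - b j) (2 *\<^sub>R b j - a j)) \<Longrightarrow>
      (\<And>j. emeasure lebesgue (box (2 *\<^sub>R a j - b j) (2 *\<^sub>R b j - a j)) = ennreal (V j) \<and> V j > 0) \<Longrightarrow>
      summable V \<Longrightarrow> summable (\<lambda>j. A j powr (q / p) * V j powr (1 - q / p)) \<Longrightarrow>
      (\<And>j. W11 (box (a j) (b j)) (u j) (g j) \<and> energy p (s j) (u j) (g j) \<le> ennreal (A j) \<and> A j \<ge> 0) \<Longrightarrow>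
      \<exists>U H. family_extension p q K a b u A V U H"
proof -
  have p0: "p \<ge> 0" "p > 0" using q pq by auto
  obtain K0 where K0: "K0 \<ge> 0"
    "\<forall>(a::'a) b s u g. 0 < s \<longrightarrow> (\<forall>k\<in>Basis. s \<le> b \<bullet> k - a \<bullet> k) \<longrightarrow> W11 (box a b) u g \<longrightarrow>
       (\<exists>v G. box_extension p K0 a b Basis s u g v G)"
    using W11_box_extend[OF p0(1) subset_refl] by (elim exE conjE) (rule that)
  show thesis
  proof -
    \<comment> \<open>The first entry serves the \<open>p\<close>-energy on each halo. The second is
      what becomes of it under \<open>energy_lower_exponent\<close>.\<close>
    define K where "K = max K0 (3 * K0 powr (q / p))"
    have K: "K \<ge> 0" "K0 \<le> K" "3 * K0 powr (q / p) \<le> K" using K0 by (auto simp: K_def)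
    show thesis
    proof (rule that[OF K(1)])
      fix a b :: "nat \<Rightarrow> 'a" and s :: "nat \<Rightarrow> real" and u g A V
      assume s: "\<And>j. 0 < s j \<and> s j \<le> 1" "\<And>j k. k \<in> Basis \<Longrightarrow> s j \<le> b j \<bullet> k - a j \<bullet> k"
        and dj: "disjoint_family (\<lambda>j. box (2 *\<^sub>R a j - b j) (2 *\<^sub>R b j - a j))"
        and V: "\<And>j. emeasure lebesgue (box (2 *\<^sub>R a j - b j) (2 *\<^sub>R b j - a j)) = ennreal (V j) \<and> V j > 0"
        and sV: "summable V" and sA: "summable (\<lambda>j. A j powr (q / p) * V j powr (1 - q / p))"
        and W: "\<And>j. W11 (box (a j) (b j)) (u j) (g j) \<and> energy p (s j) (u j) (g j) \<le> ennreal (A j) \<and> A j \<ge> 0"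
      let ?Q = "\<lambda>j. box (2 *\<^sub>R a j - b j) (2 *\<^sub>R b j - a j)"
      have "\<exists>v G. box_extension p K0 (a j) (b j) Basis (s j) (u j) (g j) v G" for j
        using K0(2) s W by blast
      then obtain v G where vG: "\<And>j. box_extension p K0 (a j) (b j) Basis (s j) (u j) (g j) (v j) (G j)"
        by metis
      have v: "W11 UNIV (v j) (G j)" "\<And>x. x \<in> box (a j) (b j) \<Longrightarrow> v j x = u j x"
        "\<And>x. v j x \<noteq> 0 \<Longrightarrow> (\<exists>y. u j y \<noteq> 0 \<and> (\<forall>k\<in>Basis. a j \<bullet> k < x \<bullet> k \<and> x \<bullet> k < b j \<bullet> k \<longrightarrow> y \<bullet> k = x \<bullet> k))"
        "\<And>x. x \<notin> ?Q j \<Longrightarrow> v j x = 0 \<and> G j x = 0"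
        "energy p (s j) (v j) (G j) \<le> ennreal K0 * energy p (s j) (u j) (g j)" for j
        using box_extension_Basis[OF vG[of j]] by simp_all
      have Ep: "energy p (s j) (v j) (G j) \<le> ennreal (K0 * A j)" for j
      proof -
        have "energy p (s j) (v j) (G j) \<le> ennreal K0 * ennreal (A j)"
          using v(5)[of j] mult_left_mono[of "energy p (s j) (u j) (g j)" "ennreal (A j)" "ennreal K0"] W[of j]
          by (meson order_trans zero_le)
        then show ?thesis using K0(1) W[of j] by (simp add: ennreal_mult)
      qed
      define c where "c j = A j powr (q / p) * V j powr (1 - q / p)" for j
      have c: "c j \<ge> 0" for j by (simp add: c_def)
      have Eq: "energy q 1 (v j) (G j) \<le> ennreal (K * c j)" for j
      proof -
        have "energy q 1 (v j) (G j) \<le> ennreal (3 * ((K0 * A j) powr (q / p) * V j powr (1 - q / p)))"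
          using V[of j] s(1)[of j] q pq W[of j] K0(1)
          by (intro energy_lower_exponent[OF W11_measurable[OF v(1)] _ _ _ v(4) _ _ _ _ Ep]) auto
        also have "(K0 * A j) powr (q / p) = K0 powr (q / p) * A j powr (q / p)"
          by (rule powr_mult)
        also have "3 * (K0 powr (q / p) * A j powr (q / p) * V j powr (1 - q / p)) = (3 * K0 powr (q / p)) * c j"
          by (simp add: c_def)
        also have "ennreal \<dots> \<le> ennreal (K * c j)"
          using K(3) c by (intro ennreal_leI mult_right_mono) auto
        finally show ?thesis .
      qed
      have sc: "summable (\<lambda>j. K * c j)" using sA by (intro summable_mult) (simp add: c_def)
      show "\<exists>U H. family_extension p q K a b u A V U H"
      proof -
        have v4: "\<forall>j x. x \<notin> ?Q j \<longrightarrow> v j x = 0 \<and> G j x = 0" using v(4) by blast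
        have "\<exists>U H. W11 UNIV U H \<and> (\<forall>j. \<forall>x\<in>?Q j. U x = v j x \<and> H x = G j x) \<and>
            (\<forall>x. (\<forall>j. x \<notin> ?Q j) \<longrightarrow> U x = 0 \<and> H x = 0) \<and> energy q 1 U H \<le> ennreal (\<Sum>j. K * c j)"
          using V K(1) c less_imp_le
          by (intro W11_disjoint_sum[OF v(1) dj _ _ sV _ v4 Eq sc _ q]) auto
        then obtain U H where U: "W11 UNIV U H" "\<forall>j. \<forall>x\<in>?Q j. U x = v j x \<and> H x = G j x"
          "\<forall>x. (\<forall>j. x \<notin> ?Q j) \<longrightarrow> U x = 0 \<and> H x = 0" "energy q 1 U H \<le> ennreal (\<Sum>j. K * c j)"
          by (elim exE conjE) (rule that)
        have sub: "x \<in> ?Q j" if "x \<in> box (a j) (b j)" for j x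
          using that s(1)[of j] s(2)[of _ j]
          by (fastforce simp: mem_box inner_diff_left)
        show ?thesis
        unfolding family_extension_def
        proof (rule exI[of _ U], rule exI[of _ H], intro conjI allI ballI impI)
          show "W11 UNIV U H" by (rule U(1))
          show "U x = u j x" if "x \<in> box (a j) (b j)" for j x
            using U(2) sub[OF that] v(2)[OF that] by simp
          show "\<exists>j y. x \<in> ?Q j \<and> u j y \<noteq> 0 \<and>
             (\<forall>k\<in>Basis. a j \<bullet> k < x \<bullet> k \<and> x \<bullet> k < b j \<bullet> k \<longrightarrow> y \<bullet> k = x \<bullet> k)" if x: "U x \<noteq> 0" for x
          proof -
            obtain j where j: "x \<in> ?Q j" using U(3) x by blast
            then have "v j x \<noteq> 0" using U(2) x by auto
            from v(3)[OF this] j show ?thesis by blast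
          qed
          show "\<exists>j. x \<in> ?Q j" if "H x \<noteq> 0" for x using U(3) that by blast
          show "energy p 1 (\<lambda>x. indicator (?Q j) x * U x) (\<lambda>x. indicator (?Q j) x *\<^sub>R H x) \<le> ennreal (K * A j)" for j
          proof -
            have "(\<lambda>x. indicator (?Q j) x * U x) = v j" "(\<lambda>x. indicator (?Q j) x *\<^sub>R H x) = G j"
              using U(2) v(4)[of _ j] by (auto simp: indicator_def fun_eq_iff)
            then have "energy p 1 (\<lambda>x. indicator (?Q j) x * U x) (\<lambda>x. indicator (?Q j) x *\<^sub>R H x) \<le> energy p (s j) (v j) (G j)"
              using energy_mono_scale[of "s j" p "v j" "G j"] s(1)[of j] p0(1) by simp
            also have "\<dots> \<le> ennreal (K0 * A j)" by (rule Ep)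
            also have "\<dots> \<le> ennreal (K * A j)" using K(2) W[of j] by (intro ennreal_leI mult_right_mono) auto
            finally show ?thesis .
          qed
          have "(\<Sum>j. K * c j) = K * (\<Sum>j. c j)"
            using sA by (intro suminf_mult) (simp add: c_def)
          then show "energy q 1 U H \<le> ennreal (K * (\<Sum>j. A j powr (q / p) * V j powr (1 - q / p)))"
            using U(4) by (simp add: c_def)
        qed
      qed
    qed
  qed
qed

section \<open>Rooms and corridors\<close>

text \<open>A column is parallel to \<open>e\<close>, and its axis passes through \<open>c *\<^sub>R f\<close>; its cross-section is a cube of
  half side \<open>r\<close>. The union below consists of a hall, of rooms of width comparable to \<open>2\<^sup>-\<^sup>j\<close> but of
  height 1, and of much thinner corridors that run through each room and into the hall.\<close>

definition corner :: "'a::euclidean_space \<Rightarrow> 'a \<Rightarrow> real \<Rightarrow> real \<Rightarrow> real \<Rightarrow> 'a" where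
  "corner e f c r t = t *\<^sub>R e + c *\<^sub>R f + r *\<^sub>R (\<Sum>k\<in>Basis - {e}. k)"

definition column :: "'a::euclidean_space \<Rightarrow> 'a \<Rightarrow> real \<Rightarrow> real \<Rightarrow> real \<Rightarrow> real \<Rightarrow> 'a set" where
  "column e f c r lo hi = box (corner e f c (- r) lo) (corner e f c r hi)"

lemma corner_inner:
  assumes "e \<in> Basis" "f \<in> Basis" "e \<noteq> f" "k \<in> Basis"
  shows "corner e f c r t \<bullet> k = (if k = e then t else if k = f then c + r else r)"
proof -
  have "(\<Sum>k\<in>Basis - {e}. k) \<bullet> k = (\<Sum>j\<in>Basis - {e}. if j = k then 1 else 0)"
    unfolding inner_sum_left using assms by (intro sum.cong) (auto simp: inner_Basis)
  also have "\<dots> = (if k = e then 0 else 1)" using assms by simp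
  finally show ?thesis using assms by (auto simp: corner_def inner_add_left inner_Basis)
qed

text \<open>The factor 1/16 leaves room for halos: for i < j the centres differ by at least
  \<open>ctr i / 2\<close>, whereas \<open>3 * rad i + 3 * rad j\<close> is at most
  \<open>9/32 * ctr i\<close>.\<close>

definition ctr :: "nat \<Rightarrow> real" where "ctr j = (1/2) ^ j"
definition rad :: "nat \<Rightarrow> real" where "rad j = (1/2) ^ j / 16"

lemma ctr_rad_bounds: "0 < ctr j" "ctr j \<le> 1" "0 < rad j" "rad j \<le> 1/16"
  by (simp_all add: ctr_def rad_def power_le_one)

lemma ctr_separated:
  assumes "i \<noteq> j"
  shows "3 * rad i + 3 * rad j < \<bar>ctr i - ctr j\<bar>"
proof -
  have *: "3 * rad i + 3 * rad j < \<bar>ctr i - ctr j\<bar>" if "i < j" for i j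
  proof -
    have "(1/2::real) ^ j \<le> (1/2) ^ Suc i" using that by (intro power_decreasing) auto
    then have "ctr j \<le> ctr i / 2" by (simp add: ctr_def)
    moreover have "rad i = ctr i / 16" "rad j = ctr j / 16" by (simp_all add: ctr_def rad_def)
    ultimately show ?thesis using ctr_rad_bounds(1)[of i] by simp
  qed
  from assms consider "i < j" | "j < i" by linarith
  then show ?thesis by cases (use *[of i j] *[of j i] in auto)
qed

locale rooms =
  fixes e f :: "'a::euclidean_space" and d :: "nat \<Rightarrow> real"
  assumes e: "e \<in> Basis" and f: "f \<in> Basis" and ef: "e \<noteq> f"
    and d: "\<And>j. 0 < d j" "\<And>j. d j \<le> rad j"
begin

abbreviation "col \<equiv> column e f"
abbreviation "crn \<equiv> corner e f"

text \<open>The heights are chosen for two purposes. Tripling the hall gives heights from -2 to 1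
  and tripling a room gives 1 to 4, so these halos are disjoint. A corridor starts at the floor of
  the hall and ends at the ceiling of its room, so it lies in the hall below height 0 and in the
  room above height 2; only the piece between is thin.\<close>

definition hall :: "'a set" where "hall = col 0 2 (-1) 0"
definition room :: "nat \<Rightarrow> 'a set" where "room j = col (ctr j) (rad j) 2 3"
definition corridor :: "nat \<Rightarrow> 'a set" where "corridor j = col (ctr j) (d j) (-1) 3"
definition \<Omega> :: "'a set" where "\<Omega> = hall \<union> (\<Union>j. room j \<union> corridor j)"

lemmas crn_inner = corner_inner[OF e f ef]

lemma mem_col:
  "x \<in> col c r lo hi \<longleftrightarrow> lo < x \<bullet> e \<and> x \<bullet> e < hi \<and> \<bar>x \<bullet> f - c\<bar> < r \<and> (\<forall>k\<in>Basis - {e, f}. \<bar>x \<bullet> k\<bar> < r)"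
proof -
  have B: "Basis = insert e (insert f (Basis - {e, f}))" using e f by auto
  have "x \<in> col c r lo hi \<longleftrightarrow> (\<forall>k\<in>insert e (insert f (Basis - {e, f})). crn c (- r) lo \<bullet> k < x \<bullet> k \<and> x \<bullet> k < crn c r hi \<bullet> k)"
    unfolding column_def mem_box B[symmetric] ..
  also have "\<dots> \<longleftrightarrow> lo < x \<bullet> e \<and> x \<bullet> e < hi \<and> \<bar>x \<bullet> f - c\<bar> < r \<and> (\<forall>k\<in>Basis - {e, f}. \<bar>x \<bullet> k\<bar> < r)"
  proof -
    have 1: "\<bar>x \<bullet> f - c\<bar> < r \<longleftrightarrow> c + - r < x \<bullet> f \<and> x \<bullet> f < c + r" by auto
    have 2: "\<bar>x \<bullet> k\<bar> < r \<longleftrightarrow> - r < x \<bullet> k \<and> x \<bullet> k < r" for k by auto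
    show ?thesis unfolding ball_simps(7) 1 2 using e f ef by (auto simp: crn_inner)
  qed
  finally show ?thesis .
qed

lemma col_subset:
  assumes "x \<in> col c r lo hi" "\<bar>c - c'\<bar> + r \<le> r'" "lo' < x \<bullet> e" "x \<bullet> e < hi'"
  shows "x \<in> col c' r' lo' hi'"
proof -
  have x: "\<bar>x \<bullet> f - c\<bar> < r" "\<forall>k\<in>Basis - {e, f}. \<bar>x \<bullet> k\<bar> < r"
    using assms(1) by (auto simp: mem_col)
  have "r \<le> r'" using assms(2) by linarith
  then have "\<forall>k\<in>Basis - {e, f}. \<bar>x \<bullet> k\<bar> < r'" using x(2) by (meson less_le_trans)
  moreover have "\<bar>x \<bullet> f - c'\<bar> < r'" using x(1) assms(2) by linarith
  ultimately show ?thesis using assms(3,4) by (simp add: mem_col)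
qed

text \<open>Halos of columns are again columns, so their disjointness reduces to
  \<open>ctr_separated\<close> and their volumes to \<open>emeasure_col\<close>.\<close>

lemma col_halo:
  "2 *\<^sub>R crn c (- r) lo - crn c r hi = crn c (- (3 * r)) (2 * lo - hi)"
  "2 *\<^sub>R crn c r hi - crn c (- r) lo = crn c (3 * r) (2 * hi - lo)"
  by (rule euclidean_eqI; simp add: inner_diff_left crn_inner)+

lemma emeasure_col:
  assumes "lo \<le> hi" "r \<ge> 0"
  shows "emeasure lebesgue (col c r lo hi) = ennreal ((hi - lo) * (2 * r) ^ (DIM('a) - 1))"
proof -
  have "emeasure lebesgue (col c r lo hi) = emeasure lborel (col c r lo hi)"
    by (simp add: column_def)
  also have "\<dots> = ennreal (\<Prod>k\<in>Basis. (crn c r hi - crn c (- r) lo) \<bullet> k)"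
    unfolding column_def using assms by (intro emeasure_lborel_box) (auto simp: crn_inner)
  also have "(\<Prod>k\<in>Basis. (crn c r hi - crn c (- r) lo) \<bullet> k) = (\<Prod>k\<in>(Basis::'a set). if k = e then hi - lo else 2 * r)"
    by (intro prod.cong) (auto simp: crn_inner inner_diff_left)
  also have "\<dots> = (hi - lo) * (\<Prod>k\<in>Basis - {e}. if k = e then hi - lo else 2 * r)"
    using e by (subst prod.remove[of _ e]) auto
  also have "(\<Prod>k\<in>Basis - {e}. if k = e then hi - lo else 2 * r) = (2 * r) ^ (DIM('a) - 1)"
    using e by (simp add: card_Diff_singleton)
  finally show ?thesis .
qed

lemma open_col: "open (col c r lo hi)" and convex_col: "convex (col c r lo hi)"
  by (simp_all add: column_def open_box convex_box)

lemma open_\<Omega>: "open \<Omega>"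
  unfolding \<Omega>_def hall_def room_def corridor_def by (auto intro!: open_Un open_UN open_col)

lemma bounded_\<Omega>: "bounded \<Omega>"
proof (rule bounded_subset)
  show "bounded (col 0 2 (-1) 3)" by (simp add: column_def bounded_box)
  show "\<Omega> \<subseteq> col 0 2 (-1) 3"
  proof
    fix x assume "x \<in> \<Omega>"
    then consider "x \<in> hall" | j where "x \<in> room j" | j where "x \<in> corridor j" by (auto simp: \<Omega>_def)
    then show "x \<in> col 0 2 (-1) 3"
    proof cases
      case 1
      then show ?thesis using col_subset[of x 0 2 "-1" 0 0 2 "-1" 3] by (auto simp: hall_def mem_col)
    next
      case (2 j)
      then have "x \<in> col (ctr j) (rad j) 2 3" by (simp add: room_def)
      then show ?thesis
        using ctr_rad_bounds[of j] by (rule_tac col_subset) (auto simp: mem_col)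
    next
      case (3 j)
      then have "x \<in> col (ctr j) (d j) (-1) 3" by (simp add: corridor_def)
      then show ?thesis
        using ctr_rad_bounds[of j] d[of j] by (rule_tac col_subset) (auto simp: mem_col)
    qed
  qed
qed

lemma is_domain_\<Omega>: "is_domain \<Omega>"
proof -
  have h: "crn c 0 (-1/2) \<in> hall" if "\<bar>c\<bar> \<le> 1" for c
    using that e f ef by (auto simp: hall_def mem_col crn_inner)
  have c: "crn (ctr j) 0 (-1/2) \<in> corridor j" "crn (ctr j) 0 (5/2) \<in> corridor j" "crn (ctr j) 0 (5/2) \<in> room j" for j
    using e f ef d(1)[of j] ctr_rad_bounds[of j] by (auto simp: corridor_def room_def mem_col crn_inner)
  have conn: "connected (hall \<union> corridor j \<union> room j)" for j
  proof (rule connected_Un)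
    show "connected (hall \<union> corridor j)"
      using h[of "ctr j"] c(1)[of j] ctr_rad_bounds[of j]
      by (intro connected_Un convex_connected) (auto simp: hall_def corridor_def convex_col)
    show "connected (room j)" by (simp add: room_def convex_connected convex_col)
    show "(hall \<union> corridor j) \<inter> room j \<noteq> {}" using c[of j] by blast
  qed
  have "\<Omega> = (\<Union>j. hall \<union> corridor j \<union> room j)" by (auto simp: \<Omega>_def)
  moreover have "connected (\<Union>j. hall \<union> corridor j \<union> room j)"
    using conn h[of 0] by (intro connected_Union) auto
  ultimately show ?thesis using open_\<Omega> h[of 0] by (auto simp: is_domain_def \<Omega>_def)
qed

lemma corridor_low: assumes "x \<in> corridor j" "x \<bullet> e < 0" shows "x \<in> hall"
  unfolding hall_def
  by (rule col_subset[OF assms(1)[unfolded corridor_def]])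
    (use assms ctr_rad_bounds[of j] d[of j] in \<open>auto simp: corridor_def mem_col\<close>)

lemma corridor_high: assumes "x \<in> corridor j" "2 < x \<bullet> e" shows "x \<in> room j"
  unfolding room_def
  by (rule col_subset[OF assms(1)[unfolded corridor_def]])
    (use assms d(2)[of j] in \<open>auto simp: corridor_def mem_col\<close>)

lemma room_subset: "hall \<subseteq> \<Omega>" "room j \<subseteq> \<Omega>" "corridor j \<subseteq> \<Omega>"
  by (auto simp: \<Omega>_def)

lemma col_disjoint:
  assumes "i \<noteq> j" "r \<le> 3 * rad i" "r' \<le> 3 * rad j"
  shows "col (ctr i) r lo hi \<inter> col (ctr j) r' lo' hi' = {}"
  using ctr_separated[OF assms(1)] assms(2,3) by (fastforce simp: mem_col)

end

lemma energy_le_add: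
  assumes m: "u \<in> borel_measurable lebesgue" "g \<in> borel_measurable lebesgue"
    "v \<in> borel_measurable lebesgue" "h \<in> borel_measurable lebesgue"
    and le: "\<And>x. (w x = u x \<and> k x = g x) \<or> (w x = v x \<and> k x = h x)"
  shows "energy p s w k \<le> energy p s u g + energy p s v h"
proof -
  let ?d = "\<lambda>u g x. ennreal (\<bar>u x\<bar> powr p / s powr p + norm (g x) powr p)"
  have "energy p s w k \<le> (\<integral>\<^sup>+x. ?d u g x + ?d v h x \<partial>lebesgue)"
    unfolding energy_def
  proof (rule nn_integral_mono)
    fix x show "?d w k x \<le> ?d u g x + ?d v h x"
      using le[of x] by (elim disjE conjE) (simp_all only: add_increasing add_increasing2 order_refl zero_le)
  qed
  also have "\<dots> = energy p s u g + energy p s v h"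
    unfolding energy_def
    by (intro nn_integral_add measurable_compose[OF measurable_energy_density measurable_ennreal] m)
  finally show ?thesis .
qed

lemma powr_power_swap: "x > 0 \<Longrightarrow> (x ^ j) powr a = (x powr a) ^ j" for x a :: real
  by (simp add: powr_powr powr_realpow[symmetric] mult.commute powr_gt_zero)

section \<open>Bounded extension for the inhomogeneous spaces\<close>

context rooms
begin

text \<open>Up to constants, a room pays rad^(-q) for its width and gains rad^(\<gamma>+q) from the
  volume of its halo, in total the summable rad^\<gamma>. A corridor pays d^(-q) rad^(-q), the
  second factor being inherited from the first extension, and gains d^(\<gamma>+q). The hypothesis
  \<open>small\<close> makes the resulting d^\<gamma> rad^(-q) summable.\<close>

lemma W_ext_domain_\<Omega>:
  fixes p q \<gamma> :: real
  defines "\<gamma> \<equiv> (real DIM('a) - 1) * (1 - q / p) - q"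
  assumes q: "1 \<le> q" and pq: "q < p" and \<gamma>: "\<gamma> > 0"
    and small: "\<And>j. d j powr \<gamma> * rad j powr (- q) \<le> (1/2) ^ j"
  shows "W_ext_domain \<Omega> p q"
proof (rule W11_box_family_extend[OF q less_imp_le[OF pq]])
  fix K :: real
  assume K: "K \<ge> 0" and ext: "\<And>(a::nat \<Rightarrow> 'a::euclidean_space) b s u g A V. (\<And>j. 0 < s j \<and> s j \<le> 1) \<Longrightarrow>
      (\<And>j k. k \<in> Basis \<Longrightarrow> s j \<le> b j \<bullet> k - a j \<bullet> k) \<Longrightarrow>
      disjoint_family (\<lambda>j. box (2 *\<^sub>R a j - b j) (2 *\<^sub>R b j - a j)) \<Longrightarrow>
      (\<And>j. emeasure lebesgue (box (2 *\<^sub>R a j - b j) (2 *\<^sub>R b j - a j)) = ennreal (V j) \<and> V j > 0) \<Longrightarrow>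
      summable V \<Longrightarrow> summable (\<lambda>j. A j powr (q / p) * V j powr (1 - q / p)) \<Longrightarrow>
      (\<And>j. W11 (box (a j) (b j)) (u j) (g j) \<and> energy p (s j) (u j) (g j) \<le> ennreal (A j) \<and> A j \<ge> 0) \<Longrightarrow>
      \<exists>U H. family_extension p q K a b u A V U H"
  define n where "n = DIM('a) - 1"
  have DIM2: "DIM('a) \<ge> 2"
  proof -
    have "card {e, f} \<le> DIM('a)" using e f by (intro card_mono) auto
    then show ?thesis using ef by simp
  qed
  then have n: "n \<ge> 1" "real n = real DIM('a) - 1" by (simp_all add: n_def of_nat_diff)
  have p: "p \<ge> 1" "p > 0" "p \<ge> 0" using q pq by auto
  define \<kappa> where "\<kappa> = q / p"
  have \<kappa>: "0 < \<kappa>" "\<kappa> < 1" using q pq by (auto simp: \<kappa>_def)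
  have p\<kappa>: "p * \<kappa> = q" using p by (simp add: \<kappa>_def)
  have \<gamma>': "\<gamma> = real n * (1 - \<kappa>) - q" by (simp add: \<gamma>_def n \<kappa>_def)
  have rad1: "rad j \<le> 1" for j using ctr_rad_bounds(4)[of j] by linarith
  have sum_rad: "summable (\<lambda>j. rad j powr a)" if "a > 0" for a
  proof -
    have "(1/2::real) powr a < (1/2) powr 0" using that by (intro powr_less_mono') auto
    then have "summable (\<lambda>j. ((1/2::real) powr a) ^ j)" by (intro summable_geometric) simp
    then have "summable (\<lambda>j. ((1/2::real) powr a) ^ j * (1/16) powr a)" by (rule summable_mult2)
    moreover have "rad j powr a = ((1/2::real) powr a) ^ j * (1/16) powr a" for j
    proof -
      have "rad j powr a = ((1/2) ^ j * (1/16)) powr a" by (simp add: rad_def)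
      also have "\<dots> = ((1/2) ^ j) powr a * (1/16) powr a" by (rule powr_mult)
      finally show ?thesis by (simp add: powr_power_swap)
    qed
    ultimately show ?thesis by simp
  qed
  \<comment> \<open>Here \<open>t\<close> is half the side of a column, so its halo has side
    \<open>6 * t\<close>, and \<open>h\<close> is the height of the halo. The exponent
    \<open>1 - \<kappa>\<close> is the one that Hoelder puts on volumes.\<close>
  have volume_weight: "(h * (6 * t) ^ n) powr (1 - \<kappa>) = (h * 6 ^ n) powr (1 - \<kappa>) * t powr (\<gamma> + q)"
    if "t > 0" "h > 0" for t h :: real
  proof -
    have "(h * (6 * t) ^ n) powr (1 - \<kappa>) = ((h * 6 ^ n) * t ^ n) powr (1 - \<kappa>)"
      by (simp add: power_mult_distrib mult.assoc)
    also have "\<dots> = (h * 6 ^ n) powr (1 - \<kappa>) * (t ^ n) powr (1 - \<kappa>)" by (rule powr_mult)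
    also have "(t ^ n) powr (1 - \<kappa>) = t powr (real n * (1 - \<kappa>))"
      using that by (simp add: powr_realpow[symmetric] powr_powr)
    also have "real n * (1 - \<kappa>) = \<gamma> + q" by (simp add: \<gamma>')
    finally show ?thesis .
  qed
  \<comment> \<open>Index 0 stands for the hall and \<open>Suc j\<close> for room \<open>j\<close>.
    The hall has half side 2, hence a halo of side 12 and height 3, and it is treated at scale
    1.\<close>
  define c1 where "c1 = case_nat 0 ctr"
  define r1 where "r1 = case_nat 2 rad"
  define l1 :: "nat \<Rightarrow> real" where "l1 = case_nat (-1) (\<lambda>_. 2)"
  define s1 where "s1 = case_nat 1 rad"
  define V1 where "V1 = case_nat (3 * 12 ^ n) (\<lambda>j. 3 * (6 * rad j) ^ n)"
  define a1 where "a1 j = crn (c1 j) (- r1 j) (l1 j)" for j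
  define b1 where "b1 j = crn (c1 j) (r1 j) (l1 j + 1)" for j
  define B1 where "B1 j = box (a1 j) (b1 j)" for j
  have B1: "B1 0 = hall" "B1 (Suc j) = room j" for j
    by (simp_all add: B1_def a1_def b1_def hall_def room_def column_def c1_def r1_def l1_def)
  define Q1 where "Q1 j = box (2 *\<^sub>R a1 j - b1 j) (2 *\<^sub>R b1 j - a1 j)" for j
  have Q1': "Q1 j = col (c1 j) (3 * r1 j) (l1 j - 1) (l1 j + 2)" for j
    unfolding Q1_def a1_def b1_def col_halo column_def by (simp add: algebra_simps)
  have Q1: "Q1 0 = col 0 6 (-2) 1" "Q1 (Suc j) = col (ctr j) (3 * rad j) 1 4" for j
    by (simp_all add: Q1' c1_def r1_def l1_def)
  have s1: "0 < s1 j \<and> s1 j \<le> 1" for j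
    by (cases j) (use ctr_rad_bounds rad1 in \<open>auto simp: s1_def\<close>)
  have side1: "s1 j \<le> b1 j \<bullet> k - a1 j \<bullet> k" if "k \<in> Basis" for j k
    using rad1 ctr_rad_bounds(3) that less_imp_le
    by (cases j) (auto simp: s1_def a1_def b1_def crn_inner r1_def)
  have disj1: "disjoint_family Q1"
    unfolding disjoint_family_on_def
  proof (intro ballI impI)
    fix i j :: nat assume ij: "i \<noteq> j"
    have 0: "Q1 0 \<inter> Q1 (Suc k) = {}" for k by (auto simp: Q1 mem_col)
    show "Q1 i \<inter> Q1 j = {}"
    proof (cases i; cases j)
      fix i' j' assume "i = Suc i'" "j = Suc j'"
      then show ?thesis using ij col_disjoint[of i' j'] by (simp add: Q1)
    qed (use ij 0 in auto)
  qed
  have vol: "emeasure lebesgue (col c r lo hi) = ennreal ((hi - lo) * (2 * r) ^ n)" if "lo \<le> hi" "r \<ge> 0" for c r lo hi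
    unfolding n_def by (rule emeasure_col[OF that])
  have vol1: "emeasure lebesgue (Q1 j) = ennreal (V1 j) \<and> V1 j > 0" for j
  proof (cases j)
    case 0
    then show ?thesis using vol[of "-2" 1 6 0] by (simp add: Q1 V1_def)
  next
    case (Suc k)
    then show ?thesis using vol[of 1 4 "3 * rad k" "ctr k"] ctr_rad_bounds(3)[of k] by (simp add: Q1 V1_def)
  qed
  have sumV: "summable (\<lambda>j. h * (6 * t j) ^ n)" if t: "\<And>j. 0 < t j" "\<And>j. t j \<le> rad j" for t :: "nat \<Rightarrow> real" and h
  proof (rule summable_comparison_test'[of "\<lambda>j. \<bar>h\<bar> * 6 ^ n * rad j powr 1" 0])
    show "summable (\<lambda>j. \<bar>h\<bar> * 6 ^ n * rad j powr 1)" by (intro summable_mult sum_rad) simp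
    fix j :: nat
    have "t j ^ n \<le> t j ^ 1" using n t[of j] rad1[of j] by (intro power_decreasing) auto
    then have "t j ^ n \<le> rad j powr 1" using t[of j] ctr_rad_bounds(3)[of j] by simp
    then have "\<bar>h\<bar> * 6 ^ n * t j ^ n \<le> \<bar>h\<bar> * 6 ^ n * rad j powr 1" by (intro mult_left_mono) auto
    then show "norm (h * (6 * t j) ^ n) \<le> \<bar>h\<bar> * 6 ^ n * rad j powr 1"
      using t(1)[of j] by (simp add: abs_mult power_mult_distrib mult.assoc)
  qed
  have "summable (\<lambda>j. V1 (Suc j))"
    using sumV[of rad 3] ctr_rad_bounds(3) by (simp add: V1_def)
  then have sumV1: "summable V1" by (simp add: summable_Suc_iff)
  define \<omega>1 where "\<omega>1 j = (s1 j powr (- p)) powr \<kappa> * V1 j powr (1 - \<kappa>)" for j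
  have "\<omega>1 (Suc j) = (3 * 6 ^ n) powr (1 - \<kappa>) * rad j powr \<gamma>" for j
  proof -
    have "\<omega>1 (Suc j) = rad j powr (- q) * ((3 * 6 ^ n) powr (1 - \<kappa>) * rad j powr (\<gamma> + q))"
      using volume_weight[of "rad j" 3] ctr_rad_bounds(3)[of j]
      by (simp add: \<omega>1_def s1_def V1_def powr_powr p\<kappa>)
    moreover have "rad j powr (- q) * rad j powr (\<gamma> + q) = rad j powr \<gamma>" by (simp add: powr_add[symmetric])
    ultimately show ?thesis by (simp add: mult_ac)
  qed
  then have "summable (\<lambda>j. \<omega>1 (Suc j))"
    using sum_rad[OF \<gamma>] by (simp add: summable_mult)
  then have sum\<omega>1: "summable \<omega>1" by (simp add: summable_Suc_iff)
  have \<omega>1: "\<omega>1 j \<ge> 0" for j by (simp add: \<omega>1_def)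
  \<comment> \<open>Origin of the constant: the remainder is a difference of two terms, whence
    \<open>2 powr p\<close>. The given function contributes 1, and \<open>U\<close> contributes
    \<open>K\<close> from the halo of the hall and \<open>K\<close> from that of the room.\<close>
  define L2 where "L2 = 2 powr p * (1 + 2 * K)"
  have L2: "L2 \<ge> 0" using K by (simp add: L2_def)
  define a2 where "a2 j = crn (ctr j) (- d j) (-1)" for j
  define b2 where "b2 j = crn (ctr j) (d j) 3" for j
  have B2: "box (a2 j) (b2 j) = corridor j" for j
    by (simp add: a2_def b2_def corridor_def column_def)
  define Q2 where "Q2 j = box (2 *\<^sub>R a2 j - b2 j) (2 *\<^sub>R b2 j - a2 j)" for j
  have Q2: "Q2 j = col (ctr j) (3 * d j) (-5) 7" for j
    unfolding Q2_def a2_def b2_def col_halo column_def by simp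
  define V2 where "V2 j = 12 * (6 * d j) ^ n" for j
  have d1: "d j \<le> 1" for j using d(2)[of j] rad1[of j] by linarith
  have side2: "d j \<le> b2 j \<bullet> k - a2 j \<bullet> k" if "k \<in> Basis" for j k
    using that d(1)[of j] d1[of j] by (auto simp: a2_def b2_def crn_inner)
  have disj2: "disjoint_family Q2"
    unfolding disjoint_family_on_def
  proof (intro ballI impI)
    fix i j :: nat assume "i \<noteq> j"
    then show "Q2 i \<inter> Q2 j = {}"
      unfolding Q2 using d(2)[of i] d(2)[of j] by (intro col_disjoint) auto
  qed
  have vol2: "emeasure lebesgue (Q2 j) = ennreal (V2 j) \<and> V2 j > 0" for j
    using vol[of "-5" 7 "3 * d j" "ctr j"] d(1)[of j] by (simp add: Q2 V2_def)
  have sumV2: "summable V2" unfolding V2_def[abs_def] by (rule sumV) (use d in auto)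
  define \<beta> where "\<beta> j = d j powr (- p) * (L2 * rad j powr (- p))" for j
  have \<beta>: "\<beta> j \<ge> 0" for j using L2 by (simp add: \<beta>_def)
  define \<omega>2 where "\<omega>2 j = \<beta> j powr \<kappa> * V2 j powr (1 - \<kappa>)" for j
  have \<omega>2: "\<omega>2 j \<ge> 0" for j by (simp add: \<omega>2_def)
  have "\<omega>2 j = L2 powr \<kappa> * (12 * 6 ^ n) powr (1 - \<kappa>) * (d j powr \<gamma> * rad j powr (- q))" for j
  proof -
    have "\<beta> j powr \<kappa> = (d j powr (- p)) powr \<kappa> * (L2 powr \<kappa> * (rad j powr (- p)) powr \<kappa>)"
      unfolding \<beta>_def by (simp only: powr_mult)
    also have "\<dots> = d j powr (- q) * (L2 powr \<kappa> * rad j powr (- q))"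
      by (simp add: powr_powr p\<kappa>)
    finally have "\<omega>2 j = d j powr (- q) * (L2 powr \<kappa> * rad j powr (- q)) * ((12 * 6 ^ n) powr (1 - \<kappa>) * d j powr (\<gamma> + q))"
      unfolding \<omega>2_def V2_def using volume_weight[of "d j" 12] d(1)[of j] by simp
    moreover have "d j powr (- q) * d j powr (\<gamma> + q) = d j powr \<gamma>" by (simp add: powr_add[symmetric])
    ultimately show ?thesis by (simp add: mult_ac)
  qed
  then have \<omega>2_le: "\<omega>2 j \<le> L2 powr \<kappa> * (12 * 6 ^ n) powr (1 - \<kappa>) * (1/2) ^ j" for j
    using small[of j] by (simp add: mult_left_mono)
  have sum\<omega>2: "summable \<omega>2"
    by (rule summable_comparison_test'[of "\<lambda>j. L2 powr \<kappa> * (12 * 6 ^ n) powr (1 - \<kappa>) * (1/2) ^ j" 0])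
      (use \<omega>2 \<omega>2_le in \<open>auto intro!: summable_mult summable_geometric\<close>)
  define Z where "Z = 2 powr q * (K * (\<Sum>j. \<omega>1 j) + K * (\<Sum>j. \<omega>2 j))"
  have Z: "Z \<ge> 0" unfolding Z_def
    using K suminf_nonneg[OF sum\<omega>1 \<omega>1] suminf_nonneg[OF sum\<omega>2 \<omega>2] by simp
  \<comment> \<open>\<open>Z\<close> does not depend on \<open>u\<close>, which makes the bound
    uniform. The summand 1 only ensures that the constant is positive.\<close>
  have main: "\<exists>v. W1p UNIV q v \<and> (AE x in lebesgue. x \<in> \<Omega> \<longrightarrow> v x = u x) \<and>
      W1p_norm UNIV q v \<le> (Z powr (1 / q) + 1) * W1p_norm \<Omega> p u" if u: "W1p \<Omega> p u" for u
  proof -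
    define u0 where "u0 x = indicator \<Omega> x * u x" for x
    define g0 where "g0 x = indicator \<Omega> x *\<^sub>R wgrad \<Omega> u x" for x
    define N where "N = Lp_pow \<Omega> p u + Lp_pow \<Omega> p (\<lambda>x. norm (wgrad \<Omega> u x))"
    have N: "N \<ge> 0" by (simp add: N_def Lp_pow_def)
    have W0: "W11 \<Omega> u0 g0" and E0: "energy p 1 u0 g0 = ennreal N"
      using W1p_imp_W11[OF open_\<Omega> bounded_\<Omega> u p(1)] unfolding u0_def[abs_def] g0_def[abs_def] N_def by auto
    note m0 = W11_measurable[OF W0]
    have B1\<Omega>: "B1 j \<subseteq> \<Omega>" for j by (cases j) (use B1 room_subset in auto)
    have meas: "box a b \<in> sets lebesgue" for a b :: 'a by simp
    define u1 where "u1 j x = indicator (B1 j) x * u0 x" for j x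
    define g1 where "g1 j x = indicator (B1 j) x *\<^sub>R g0 x" for j x
    \<comment> \<open>Every piece is charged with the full norm \<open>N\<close> instead of its
      share. The sum still converges because the weights \<open>\<omega>1\<close> are summable by
      themselves.\<close>
    have WE1: "W11 (box (a1 j) (b1 j)) (u1 j) (g1 j) \<and> energy p (s1 j) (u1 j) (g1 j) \<le> ennreal (s1 j powr (- p) * N)
        \<and> s1 j powr (- p) * N \<ge> 0" for j
    proof (intro conjI)
      show W: "W11 (box (a1 j) (b1 j)) (u1 j) (g1 j)"
        unfolding u1_def[abs_def] g1_def[abs_def] B1_def
        by (rule W11_restrict[OF W0 _ meas]) (use B1\<Omega>[of j] in \<open>simp add: B1_def\<close>)
      have "energy p (s1 j) (u1 j) (g1 j) \<le> ennreal (s1 j powr (- p)) * energy p 1 (u1 j) (g1 j)"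
        using s1[of j] p by (intro energy_scale W11_measurable[OF W]) auto
      also have "\<dots> \<le> ennreal (s1 j powr (- p)) * energy p 1 u0 g0"
        unfolding u1_def[abs_def] g1_def[abs_def] by (intro mult_left_mono energy_indicator p) auto
      finally show "energy p (s1 j) (u1 j) (g1 j) \<le> ennreal (s1 j powr (- p) * N)"
        using N by (simp add: E0 ennreal_mult)
    qed (use N in simp)
    have w1: "(s1 j powr (- p) * N) powr (q / p) * V1 j powr (1 - q / p) = N powr \<kappa> * \<omega>1 j" for j
      by (simp add: \<kappa>_def[symmetric] \<omega>1_def powr_mult)
    have "\<exists>U H. family_extension p q K a1 b1 u1 (\<lambda>j. s1 j powr (- p) * N) V1 U H"
      by (rule ext[where s = s1 and g = g1])
        (use s1 side1 disj1[unfolded Q1_def[abs_def]] vol1[unfolded Q1_def] sumV1 sum\<omega>1 WE1 in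
          \<open>auto simp: w1 summable_mult\<close>)
    then obtain U H where UH: "family_extension p q K a1 b1 u1 (\<lambda>j. s1 j powr (- p) * N) V1 U H" by blast
    have WU: "W11 UNIV U H" using UH by (simp add: family_extension_def)
    have U_eq: "U x = u0 x" if "x \<in> B1 j" for j x
      using UH that by (simp add: family_extension_def B1_def u1_def)
    have UH_out: "\<exists>j. x \<in> Q1 j" if "U x \<noteq> 0 \<or> H x \<noteq> 0" for x
      using UH that unfolding family_extension_def Q1_def by blast
    have EU: "energy p 1 (\<lambda>x. indicator (Q1 j) x * U x) (\<lambda>x. indicator (Q1 j) x *\<^sub>R H x) \<le> ennreal (K * (s1 j powr (- p) * N))" for j
      using UH unfolding family_extension_def Q1_def by blast
    have EqU: "energy q 1 U H \<le> ennreal (K * (\<Sum>j. \<omega>1 j) * N powr \<kappa>)"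
    proof -
      have "energy q 1 U H \<le> ennreal (K * (\<Sum>j. N powr \<kappa> * \<omega>1 j))"
        using UH unfolding family_extension_def w1 by blast
      then show ?thesis unfolding suminf_mult[OF sum\<omega>1] by (simp add: mult_ac)
    qed
    \<comment> \<open>The remainder after the first stage. It is kept on the corridors only, and it
      vanishes where a corridor runs inside the hall or its room.\<close>
    define D where "D x = u0 x + (-1) * U x" for x
    define DH where "DH x = g0 x + (-1) *\<^sub>R H x" for x
    have W0U: "W11 (corridor j) (\<lambda>x. indicator (corridor j) x * u0 x) (\<lambda>x. indicator (corridor j) x *\<^sub>R g0 x)"
      "W11 (corridor j) (\<lambda>x. indicator (corridor j) x * U x) (\<lambda>x. indicator (corridor j) x *\<^sub>R H x)" for j
      using W11_restrict[OF W0 room_subset(3)[of j]] W11_restrict[OF WU, of "corridor j"] meas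
      by (auto simp: corridor_def column_def)
    define u2 where "u2 j x = indicator (corridor j) x * D x" for j x
    define g2 where "g2 j x = indicator (corridor j) x *\<^sub>R DH x" for j x
    have u2': "u2 j = (\<lambda>x. indicator (corridor j) x * u0 x + (-1) * (indicator (corridor j) x * U x))"
      and g2': "g2 j = (\<lambda>x. indicator (corridor j) x *\<^sub>R g0 x + (-1) *\<^sub>R (indicator (corridor j) x *\<^sub>R H x))" for j
      by (auto simp: u2_def g2_def D_def DH_def algebra_simps)
    have W2: "W11 (corridor j) (u2 j) (g2 j)" for j
      unfolding u2' g2' by (intro W11_add W11_cmult W0U)
    have E2: "energy p (d j) (u2 j) (g2 j) \<le> ennreal (\<beta> j * N)" for j
    proof -
      let ?C = "corridor j"
      have mQ: "(\<lambda>x. indicator (Q1 i) x * U x) \<in> borel_measurable lebesgue"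
        "(\<lambda>x. indicator (Q1 i) x *\<^sub>R H x) \<in> borel_measurable lebesgue" for i
        using W11_measurable[OF W11_restrict[OF WU, of "Q1 i"]] meas by (auto simp: Q1_def)
      \<comment> \<open>A corridor meets no halos but those of the hall and of its own room, so on
        it \<open>U\<close> is bounded by two of the local \<open>p\<close>-energies.\<close>
      have sel: "(indicator ?C x * U x = indicator ?C x * (indicator (Q1 0) x * U x) \<and>
          indicator ?C x *\<^sub>R H x = indicator ?C x *\<^sub>R (indicator (Q1 0) x *\<^sub>R H x)) \<or>
         (indicator ?C x * U x = indicator ?C x * (indicator (Q1 (Suc j)) x * U x) \<and>
          indicator ?C x *\<^sub>R H x = indicator ?C x *\<^sub>R (indicator (Q1 (Suc j)) x *\<^sub>R H x))" for x
      proof (cases "x \<in> ?C \<and> (U x \<noteq> 0 \<or> H x \<noteq> 0)")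
        case True
        then obtain i where i: "x \<in> Q1 i" using UH_out by blast
        have "i = 0 \<or> i = Suc j"
        proof (cases i)
          case (Suc k)
          have "x \<in> col (ctr j) (d j) (-1) 3" using True by (simp add: corridor_def)
          moreover have "x \<in> col (ctr k) (3 * rad k) 1 4" using i Suc by (simp add: Q1)
          moreover have "d j \<le> 3 * rad j" using d(2)[of j] ctr_rad_bounds(3)[of j] by linarith
          ultimately have "k = j" using col_disjoint[of j k "d j" "3 * rad k"] by blast
          then show ?thesis using Suc by simp
        qed simp
        then show ?thesis using i by auto
      next
        case False
        then show ?thesis by (auto simp: indicator_def)
      qed
      have mC: "(\<lambda>x. indicator ?C x * (indicator (Q1 i) x * U x)) \<in> borel_measurable lebesgue"
        "(\<lambda>x. indicator ?C x *\<^sub>R (indicator (Q1 i) x *\<^sub>R H x)) \<in> borel_measurable lebesgue" for i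
        using meas[of "a2 j" "b2 j"] unfolding B2
        by (intro borel_measurable_times borel_measurable_scaleR borel_measurable_indicator mQ; assumption)+
      have EC: "energy p 1 (\<lambda>x. indicator ?C x * (indicator (Q1 i) x * U x)) (\<lambda>x. indicator ?C x *\<^sub>R (indicator (Q1 i) x *\<^sub>R H x))
         \<le> ennreal (K * (s1 i powr (- p) * N))" for i
        using order_trans[OF energy_indicator[OF p(2)] EU[of i]] .
      have rp: "1 \<le> rad j powr (- p)"
        using powr_mono2'[of "-p" "rad j" 1] ctr_rad_bounds(3)[of j] rad1[of j] p by simp
      have "energy p 1 (\<lambda>x. indicator ?C x * U x) (\<lambda>x. indicator ?C x *\<^sub>R H x)
          \<le> ennreal (K * (s1 0 powr (- p) * N)) + ennreal (K * (s1 (Suc j) powr (- p) * N))"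
        by (rule order_trans[OF energy_le_add[OF mC[of 0] mC[of "Suc j"] sel] add_mono[OF EC EC]])
      also have "\<dots> = ennreal (K * N + K * (rad j powr (- p) * N))"
        using K N by (simp add: s1_def ennreal_plus)
      also have "\<dots> \<le> ennreal (2 * K * rad j powr (- p) * N)"
      proof (rule ennreal_leI)
        have "K * N * 1 \<le> K * N * rad j powr (- p)" using rp K N by (intro mult_left_mono) auto
        then show "K * N + K * (rad j powr (- p) * N) \<le> 2 * K * rad j powr (- p) * N" by (simp add: algebra_simps)
      qed
      finally have 1: "energy p 1 (\<lambda>x. indicator ?C x * U x) (\<lambda>x. indicator ?C x *\<^sub>R H x) \<le> ennreal (2 * K * rad j powr (- p) * N)" .
      have 2: "energy p 1 (\<lambda>x. indicator ?C x * u0 x) (\<lambda>x. indicator ?C x *\<^sub>R g0 x) \<le> ennreal (rad j powr (- p) * N)"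
      proof -
        have "energy p 1 (\<lambda>x. indicator ?C x * u0 x) (\<lambda>x. indicator ?C x *\<^sub>R g0 x) \<le> ennreal N"
          using energy_indicator[OF p(2), of 1 ?C u0 g0] E0 by simp
        also have "\<dots> \<le> ennreal (rad j powr (- p) * N)"
          using mult_right_mono[OF rp N] by (intro ennreal_leI) simp
        finally show ?thesis .
      qed
      have "energy p 1 (u2 j) (g2 j) \<le> ennreal (2 powr p) * (energy p 1 (\<lambda>x. indicator ?C x * u0 x) (\<lambda>x. indicator ?C x *\<^sub>R g0 x)
          + energy p 1 (\<lambda>x. (-1) * (indicator ?C x * U x)) (\<lambda>x. (-1) *\<^sub>R (indicator ?C x *\<^sub>R H x)))"
        unfolding u2' g2'
        by (rule energy_add[OF p(3) W11_measurable[OF W0U(1)] W11_measurable[OF W11_cmult[OF W0U(2)]]])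
      also have "\<dots> \<le> ennreal (2 powr p) * (ennreal (rad j powr (- p) * N) + ennreal (2 * K * rad j powr (- p) * N))"
        unfolding energy_cmult_minus by (intro mult_left_mono add_mono 1 2) auto
      also have "\<dots> = ennreal (L2 * rad j powr (- p) * N)"
        unfolding L2_def using K N
        by (simp add: ennreal_plus[symmetric] ennreal_mult[symmetric] algebra_simps del: ennreal_plus)
      finally have 3: "energy p 1 (u2 j) (g2 j) \<le> ennreal (L2 * rad j powr (- p) * N)" .
      have "energy p (d j) (u2 j) (g2 j) \<le> ennreal (d j powr (- p)) * energy p 1 (u2 j) (g2 j)"
        using d(1)[of j] d1[of j] p by (intro energy_scale W11_measurable[OF W2]) auto
      also have "\<dots> \<le> ennreal (d j powr (- p)) * ennreal (L2 * rad j powr (- p) * N)"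
        by (intro mult_left_mono 3) auto
      also have "\<dots> = ennreal (\<beta> j * N)"
        unfolding \<beta>_def using L2 N by (simp add: ennreal_mult[symmetric] mult.assoc)
      finally show ?thesis .
    qed
    have WE2: "W11 (box (a2 j) (b2 j)) (u2 j) (g2 j) \<and> energy p (d j) (u2 j) (g2 j) \<le> ennreal (\<beta> j * N) \<and> \<beta> j * N \<ge> 0" for j
      using W2 E2 \<beta> N by (simp add: B2)
    have w2: "(\<beta> j * N) powr (q / p) * V2 j powr (1 - q / p) = N powr \<kappa> * \<omega>2 j" for j
      by (simp add: \<kappa>_def[symmetric] \<omega>2_def powr_mult)
    have "\<exists>X Y. family_extension p q K a2 b2 u2 (\<lambda>j. \<beta> j * N) V2 X Y"
      by (rule ext[where s = d and g = g2])
        (use d(1) d1 side2 disj2[unfolded Q2_def[abs_def]] vol2[unfolded Q2_def] sumV2 sum\<omega>2 WE2 in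
          \<open>auto simp: w2 summable_mult\<close>)
    then obtain X Y where XY: "family_extension p q K a2 b2 u2 (\<lambda>j. \<beta> j * N) V2 X Y" by blast
    have WX: "W11 UNIV X Y" using XY by (simp add: family_extension_def)
    have X_eq: "X x = u2 j x" if "x \<in> corridor j" for j x
      using XY that by (simp add: family_extension_def B2)
    have EqX: "energy q 1 X Y \<le> ennreal (K * (\<Sum>j. \<omega>2 j) * N powr \<kappa>)"
    proof -
      have "energy q 1 X Y \<le> ennreal (K * (\<Sum>j. N powr \<kappa> * \<omega>2 j))"
        using XY unfolding family_extension_def w2 by blast
      then show ?thesis unfolding suminf_mult[OF sum\<omega>2] by (simp add: mult_ac)
    qed
    have u2_0: "u2 j x = 0" if "x \<bullet> e < 0 \<or> 2 < x \<bullet> e" for j x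
    proof (cases "x \<in> corridor j")
      case True
      then have "x \<in> B1 0 \<or> x \<in> B1 (Suc j)" using that corridor_low corridor_high by (auto simp: B1)
      then have "U x = u0 x" using U_eq by blast
      then show ?thesis by (simp add: u2_def D_def)
    qed (simp add: u2_def)
    \<comment> \<open>At these heights the coordinate along \<open>e\<close> lies within the range
      of every corridor, so the point \<open>y\<close> at which the remainder is nonzero has the
      same height as \<open>x\<close>. There the remainder is zero by \<open>u2_0\<close>. Thus
      \<open>X\<close> vanishes on the hall and on all rooms, although its halos enter them.\<close>
    have X_0: "X x = 0" if x: "-1 < x \<bullet> e" "x \<bullet> e < 3" "x \<bullet> e < 0 \<or> 2 < x \<bullet> e" for x
    proof (rule ccontr)
      assume "X x \<noteq> 0"
      then obtain j y where y: "u2 j y \<noteq> 0" "\<forall>k\<in>Basis. a2 j \<bullet> k < x \<bullet> k \<and> x \<bullet> k < b2 j \<bullet> k \<longrightarrow> y \<bullet> k = x \<bullet> k"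
        using XY unfolding family_extension_def by blast
      have "a2 j \<bullet> e < x \<bullet> e \<and> x \<bullet> e < b2 j \<bullet> e" using x e by (simp add: a2_def b2_def crn_inner)
      then have "y \<bullet> e = x \<bullet> e" using y(2) e by blast
      then show False using u2_0[of y j] y(1) x(3) by simp
    qed
    define v where "v x = U x + X x" for x
    have v_eq: "v x = u x" if x: "x \<in> \<Omega>" for x
    proof -
      have u0: "u0 x = u x" using x by (simp add: u0_def)
      consider "x \<in> hall" | j where "x \<in> room j" | j where "x \<in> corridor j" using x by (auto simp: \<Omega>_def)
      then show ?thesis
      proof cases
        case 1
        then have "U x = u0 x" using U_eq[of x 0] by (simp add: B1)
        moreover have "X x = 0" using 1 by (intro X_0) (auto simp: hall_def mem_col)
        ultimately show ?thesis by (simp add: v_def u0)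
      next
        case (2 j)
        then have "U x = u0 x" using U_eq[of x "Suc j"] by (simp add: B1)
        moreover have "X x = 0" using 2 by (intro X_0) (auto simp: room_def mem_col)
        ultimately show ?thesis by (simp add: v_def u0)
      next
        case (3 j)
        then show ?thesis using X_eq[OF 3] by (simp add: v_def u2_def D_def u0)
      qed
    qed
    have Wv: "W11 UNIV v (\<lambda>x. H x + Y x)" unfolding v_def[abs_def] by (rule W11_add[OF WU WX])
    have "energy q 1 v (\<lambda>x. H x + Y x) \<le> ennreal (2 powr q) * (energy q 1 U H + energy q 1 X Y)"
      unfolding v_def[abs_def] using q by (intro energy_add W11_measurable[OF WU] W11_measurable[OF WX]) auto
    also have "\<dots> \<le> ennreal (2 powr q) * (ennreal (K * (\<Sum>j. \<omega>1 j) * N powr \<kappa>) + ennreal (K * (\<Sum>j. \<omega>2 j) * N powr \<kappa>))"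
      by (intro mult_left_mono add_mono EqU EqX) auto
    also have "\<dots> = ennreal (Z * N powr \<kappa>)"
      unfolding Z_def using K suminf_nonneg[OF sum\<omega>1 \<omega>1] suminf_nonneg[OF sum\<omega>2 \<omega>2]
      by (simp add: ennreal_plus[symmetric] ennreal_mult[symmetric] algebra_simps del: ennreal_plus)
    finally have Ev: "energy q 1 v (\<lambda>x. H x + Y x) \<le> ennreal (Z * N powr \<kappa>)" .
    have Z0: "Z * N powr \<kappa> \<ge> 0" using Z by simp
    \<comment> \<open>The \<open>q\<close>-energy is of order N^(q/p), so its q-th root has the same
      homogeneity in \<open>u\<close> as the \<open>W^{1,p}\<close> norm N^(1/p).\<close>
    have "W1p_norm UNIV q v \<le> (Z * N powr \<kappa>) powr (1 / q)" by (rule W11_imp_W1p(2)[OF Wv Ev Z0 q])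
    also have "\<dots> = Z powr (1 / q) * N powr (\<kappa> * (1 / q))" by (simp add: powr_mult powr_powr)
    also have "\<kappa> * (1 / q) = 1 / p" using q by (simp add: \<kappa>_def)
    also have "Z powr (1 / q) * N powr (1 / p) \<le> (Z powr (1 / q) + 1) * N powr (1 / p)"
      by (intro mult_right_mono) auto
    also have "N powr (1 / p) = W1p_norm \<Omega> p u" by (simp add: W1p_norm_def N_def)
    finally show ?thesis
      using W11_imp_W1p(1)[OF Wv Ev Z0 q] v_eq by (intro exI[of _ v]) auto
  qed
  then have "\<forall>u. \<exists>v. W1p \<Omega> p u \<longrightarrow> W1p UNIV q v \<and> (AE x in lebesgue. x \<in> \<Omega> \<longrightarrow> v x = u x) \<and>
      W1p_norm UNIV q v \<le> (Z powr (1 / q) + 1) * W1p_norm \<Omega> p u" by blast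
  then obtain E where E: "\<forall>u. W1p \<Omega> p u \<longrightarrow> W1p UNIV q (E u) \<and> (AE x in lebesgue. x \<in> \<Omega> \<longrightarrow> E u x = u x) \<and>
      W1p_norm UNIV q (E u) \<le> (Z powr (1 / q) + 1) * W1p_norm \<Omega> p u"
    by (rule choice[THEN exE])
  have "Z powr (1 / q) + 1 > 0" by (simp add: add_nonneg_pos)
  with E show "W_ext_domain \<Omega> p q" unfolding W_ext_domain_def by blast
qed

end

section \<open>Failure of the homogeneous extension\<close>

definition grad :: "('a::euclidean_space \<Rightarrow> real) \<Rightarrow> 'a \<Rightarrow> 'a" where
  "grad u x = (\<Sum>i\<in>Basis. pderiv_i u i x *\<^sub>R i)"

lemma grad_inner: "i \<in> Basis \<Longrightarrow> grad u x \<bullet> i = pderiv_i u i x"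
  by (simp add: grad_def)

lemma continuous_imp_L1loc:
  fixes f :: "'a::euclidean_space \<Rightarrow> 'b::{banach, second_countable_topology}"
  assumes "continuous_on UNIV f"
  shows "L1loc \<Omega> f"
  unfolding L1loc_def set_integrable_def
proof (intro allI impI)
  fix K :: "'a set" assume "compact K \<and> K \<subseteq> \<Omega>"
  then have "integrable lborel (\<lambda>x. indicator K x *\<^sub>R f x)"
    by (intro borel_integrable_compact continuous_on_subset[OF assms]) auto
  then show "integrable lebesgue (\<lambda>x. indicator K x *\<^sub>R f x)"
    using integrable_completion[of "\<lambda>x. indicator K x *\<^sub>R f x" lborel] by auto
qed

lemma weak_grad_smooth:
  assumes u: "smooth_fun u"
  shows "weak_grad \<Omega> u (grad u)"
proof -
  have "continuous_on UNIV (grad u)"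
    unfolding grad_def[abs_def]
    by (intro continuous_intros smooth_fun_continuous_on smooth_fun_pderiv u)
  moreover have "(LINT x:\<Omega>|lebesgue. u x * pderiv_i \<phi> i x) = - (LINT x:\<Omega>|lebesgue. (grad u x \<bullet> i) * \<phi> x)"
    if \<phi>: "test_fun \<Omega> \<phi>" and i: "i \<in> Basis" for \<phi> i
  proof -
    have 0: "\<phi> x = 0" "pderiv_i \<phi> i x = 0" if "x \<notin> \<Omega>" for x
      using that \<phi> test_fun_pderiv[OF \<phi> i] by (auto simp: test_fun_def)
    have "(LINT x:\<Omega>|lebesgue. u x * pderiv_i \<phi> i x) = (LINT x|lebesgue. u x * pderiv_i \<phi> i x)"
      "(LINT x:\<Omega>|lebesgue. (grad u x \<bullet> i) * \<phi> x) = (LINT x|lebesgue. (grad u x \<bullet> i) * \<phi> x)"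
      unfolding set_lebesgue_integral_def using 0
      by (auto intro!: Bochner_Integration.integral_cong simp: indicator_def)
    then show ?thesis using integral_by_parts_test[OF u \<phi> i] i by (simp add: grad_inner)
  qed
  ultimately show ?thesis
    unfolding weak_grad_def
    by (intro conjI allI impI ballI continuous_imp_L1loc smooth_fun_continuous_on u)
qed

lemma grad_cong_open:
  assumes "open S" "x \<in> S" "\<And>y. y \<in> S \<Longrightarrow> u y = v y" "smooth_fun v"
  shows "grad u x = grad v x"
proof -
  have "(u has_derivative (\<lambda>h. pderiv_i v h x)) (at x)"
    by (rule has_derivative_transform_within_open[OF smooth_fun_has_derivative[OF assms(4)] assms(1,2)])
      (use assms(3) in simp)
  from pderiv_i_eq[OF this] show ?thesis by (simp add: grad_def)
qed

lemma grad_const: "grad (\<lambda>x. c) x = 0"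
  using pderiv_i_eq[OF has_derivative_const[of c "at x"]] by (simp add: grad_def)

lemma grad_coord:
  assumes "smooth_fun h" "e \<in> Basis"
  shows "grad (\<lambda>x::'a::euclidean_space. h (x \<bullet> e)) x = pderiv_i h 1 (x \<bullet> e) *\<^sub>R e"
proof (rule euclidean_eqI)
  fix i :: 'a assume "i \<in> Basis"
  then show "grad (\<lambda>x. h (x \<bullet> e)) x \<bullet> i = (pderiv_i h 1 (x \<bullet> e) *\<^sub>R e) \<bullet> i"
    using pderiv_i_coord[OF assms(1), of 0 1 e i x] by (simp add: grad_inner) (simp add: inner_commute)
qed

section \<open>The competitor, the probe and its pairing\<close>

definition plateau :: "real \<Rightarrow> real \<Rightarrow> real \<Rightarrow> real" where
  "plateau c r t = step ((2 - c / r) + (1 / r) * t) * step ((2 + c / r) + (- (1 / r)) * t)"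

lemma smooth_fun_plateau: "smooth_fun (plateau c r)"
  unfolding plateau_def[abs_def]
  by (intro smooth_fun_mult smooth_fun_real_affine smooth_fun_step)

lemma plateau_eq: "plateau c r t = step (2 + (t - c) / r) * step (2 - (t - c) / r)"
proof -
  have "(2 - c / r) + (1 / r) * t = 2 + (t - c) / r" "(2 + c / r) + (- (1 / r)) * t = 2 - (t - c) / r"
    by (simp_all add: diff_divide_distrib)
  then show ?thesis by (simp only: plateau_def)
qed

lemma plateau_eq_1: assumes "r > 0" "\<bar>t - c\<bar> < r" shows "plateau c r t = 1"
proof -
  define \<tau> where "\<tau> = (t - c) / r"
  have "\<bar>\<tau>\<bar> < 1" using assms by (simp add: \<tau>_def abs_divide)
  then show ?thesis unfolding plateau_eq \<tau>_def[symmetric] by (simp add: step_eq_1)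
qed

lemma plateau_eq_0: assumes "r > 0" "\<bar>t - c\<bar> \<ge> 2 * r" shows "plateau c r t = 0"
proof -
  define \<tau> where "\<tau> = (t - c) / r"
  have "2 \<le> \<bar>\<tau>\<bar>" using assms by (simp add: \<tau>_def abs_divide field_simps)
  then show ?thesis unfolding plateau_eq \<tau>_def[symmetric] by (cases "\<tau> \<ge> 0") (simp_all add: step_eq_0)
qed

text \<open>The weak formulation tested with \<open>probe\<close> only sees a function where \<open>x \<bullet> e\<close> lies in
  \<open>(-1,0)\<close> or in \<open>(2,3)\<close>, that is, in the hall and in a room, and does not depend on the corridor.\<close>

definition probe :: "'a::euclidean_space \<Rightarrow> 'a \<Rightarrow> nat \<Rightarrow> 'a \<Rightarrow> real" where
  "probe e f j x = (step (1 + 1 * (x \<bullet> e)) * step (3 + (-1) * (x \<bullet> e))) *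
     (\<Prod>k\<in>Basis - {e}. bump ((rad j - (if k = f then ctr j else 0)) + 1 * (x \<bullet> k)) *
        bump ((rad j + (if k = f then ctr j else 0)) + (-1) * (x \<bullet> k)))"

text \<open>The pairing of the \<open>e\<close>-derivative of a unit rise with the probe. It depends
  on the room but not on \<open>d\<close>, and so may be used in the choice of
  \<open>d\<close>.\<close>

definition jump :: "'a::euclidean_space \<Rightarrow> 'a \<Rightarrow> nat \<Rightarrow> real" where
  "jump e f j = (LINT x|lebesgue. step' (x \<bullet> e) * probe e f j x)"

lemma probe_bounds: "0 \<le> probe e f j x" "probe e f j x \<le> 1"
  unfolding probe_def
  by (auto intro!: mult_nonneg_nonneg prod_nonneg mult_le_one prod_le_1
      simp: step_nonneg step_le_1 bump_nonneg bump_le_1)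

lemma smooth_fun_probe: "smooth_fun (probe e f j)"
  unfolding probe_def[abs_def]
  by (intro smooth_fun_mult smooth_fun_prod smooth_fun_coord smooth_fun_step smooth_fun_bump)

context
  fixes e f :: "'a::euclidean_space"
  assumes e: "e \<in> Basis" and f: "f \<in> Basis" and ef: "e \<noteq> f"
begin

lemma probe_support:
  assumes "probe e f j x \<noteq> 0"
  shows "-1 < x \<bullet> e" "x \<bullet> e < 3" "\<bar>x \<bullet> f - ctr j\<bar> < rad j" "\<And>k. k \<in> Basis - {e, f} \<Longrightarrow> \<bar>x \<bullet> k\<bar> < rad j"
proof -
  have "step (1 + x \<bullet> e) \<noteq> 0" "step (3 - x \<bullet> e) \<noteq> 0" using assms by (auto simp: probe_def)
  then show "-1 < x \<bullet> e" "x \<bullet> e < 3"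
    using step_eq_0[of "1 + x \<bullet> e"] step_eq_0[of "3 - x \<bullet> e"] by force+
  have "\<forall>k\<in>Basis - {e}. bump ((rad j - (if k = f then ctr j else 0)) + 1 * (x \<bullet> k)) *
        bump ((rad j + (if k = f then ctr j else 0)) + (-1) * (x \<bullet> k)) \<noteq> 0"
    using assms by (auto simp: probe_def)
  then have *: "0 < rad j - (if k = f then ctr j else 0) + x \<bullet> k" "0 < rad j + (if k = f then ctr j else 0) - x \<bullet> k"
    if "k \<in> Basis - {e}" for k
    using that bump_eq_0[of "rad j - (if k = f then ctr j else 0) + x \<bullet> k"]
      bump_eq_0[of "rad j + (if k = f then ctr j else 0) - x \<bullet> k"] by (force simp: not_le[symmetric])+
  show "\<bar>x \<bullet> f - ctr j\<bar> < rad j" using *[of f] f ef by auto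
  show "\<bar>x \<bullet> k\<bar> < rad j" if "k \<in> Basis - {e, f}" for k using *[of k] that by auto
qed

lemma test_fun_probe: "test_fun UNIV (probe e f j)"
proof -
  let ?B = "cbox (corner e f (ctr j) (- rad j) (-1)) (corner e f (ctr j) (rad j) 3)"
  have "x \<in> ?B" if "probe e f j x \<noteq> 0" for x
    unfolding mem_box
  proof
    fix k :: 'a assume k: "k \<in> Basis"
    consider "k = e" | "k = f" | "k \<in> Basis - {e, f}" using k by blast
    then show "corner e f (ctr j) (- rad j) (-1) \<bullet> k \<le> x \<bullet> k \<and> x \<bullet> k \<le> corner e f (ctr j) (rad j) 3 \<bullet> k"
      using probe_support(1-3)[OF that] probe_support(4)[OF that, of k] ef k
      by cases (auto simp: corner_inner[OF e f ef] abs_less_iff less_imp_le)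
  qed
  then show ?thesis
    unfolding test_fun_def using smooth_fun_probe by (intro conjI exI[of _ ?B]) (auto simp: compact_cbox)
qed

lemma pderiv_probe:
  assumes "pderiv_i (probe e f j) e x \<noteq> 0"
  shows "\<bar>x \<bullet> f - ctr j\<bar> < rad j" "\<And>k. k \<in> Basis - {e, f} \<Longrightarrow> \<bar>x \<bullet> k\<bar> < rad j"
    and "(-1 < x \<bullet> e \<and> x \<bullet> e < 0) \<or> (2 < x \<bullet> e \<and> x \<bullet> e < 3)"
proof -
  define \<psi> where "\<psi> t = step (1 + 1 * t) * step (3 + (-1) * t)" for t
  define P where "P x = (\<Prod>k\<in>Basis - {e}. bump ((rad j - (if k = f then ctr j else 0)) + 1 * (x \<bullet> k)) *
        bump ((rad j + (if k = f then ctr j else 0)) + (-1) * (x \<bullet> k)))" for x :: 'a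
  have sm\<psi>: "smooth_fun \<psi>"
    unfolding \<psi>_def[abs_def] by (intro smooth_fun_mult smooth_fun_real_affine smooth_fun_step)
  have sm\<psi>': "smooth_fun (\<lambda>x::'a. \<psi> (x \<bullet> e))" using smooth_fun_coord[OF sm\<psi>, of 0 1 e] by simp
  have smP: "smooth_fun P"
    unfolding P_def[abs_def] by (intro smooth_fun_mult smooth_fun_prod smooth_fun_coord smooth_fun_bump)
  have "P (x + t *\<^sub>R e) = P x" for t
    unfolding P_def using e by (intro prod.cong) (auto simp: inner_add_left inner_Basis)
  then have "((\<lambda>t. P x) has_real_derivative pderiv_i P e x) (at 0)"
    using smooth_fun_line_derivative[OF smP, of x e 0] by simp
  then have P0: "pderiv_i P e x = 0" using DERIV_unique[OF _ DERIV_const] by blast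
  have "probe e f j = (\<lambda>x. \<psi> (x \<bullet> e) * P x)" by (simp add: probe_def[abs_def] \<psi>_def P_def)
  then have *: "pderiv_i (probe e f j) e x = pderiv_i \<psi> 1 (x \<bullet> e) * P x"
    using pderiv_i_mult[OF sm\<psi>' smP, of e x] pderiv_i_coord[OF sm\<psi>, of 0 1 e e x] P0 e by simp
  have "pderiv_i \<psi> 1 (x \<bullet> e) = step (1 + x \<bullet> e) * (- step' (3 - x \<bullet> e)) + step' (1 + x \<bullet> e) * step (3 - x \<bullet> e)"
    unfolding \<psi>_def[abs_def]
    using pderiv_i_mult[OF smooth_fun_real_affine smooth_fun_real_affine, OF smooth_fun_step smooth_fun_step, of 1 1 3 "-1" 1 "x \<bullet> e"]
      pderiv_i_real_affine[OF smooth_fun_step, of 1 1 "x \<bullet> e"] pderiv_i_real_affine[OF smooth_fun_step, of 3 "-1" "x \<bullet> e"]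
    by simp
  then have "\<not> (3 - x \<bullet> e \<le> 0 \<or> 1 \<le> 3 - x \<bullet> e) \<or> \<not> (1 + x \<bullet> e \<le> 0 \<or> 1 \<le> 1 + x \<bullet> e)"
    using assms * step'_eq_0[of "3 - x \<bullet> e"] step'_eq_0[of "1 + x \<bullet> e"] by fastforce
  then show te: "(-1 < x \<bullet> e \<and> x \<bullet> e < 0) \<or> (2 < x \<bullet> e \<and> x \<bullet> e < 3)" by auto
  \<comment> \<open>Sliding along \<open>e\<close> to height 1 does not change the transversal
    factor \<open>P\<close>, while the longitudinal factor is 1 there. So the probe is nonzero at
    \<open>y\<close>, and \<open>probe_support\<close> bounds the transversal coordinates, which are
    those of \<open>x\<close>.\<close>
  define y where "y = x + (1 - x \<bullet> e) *\<^sub>R e"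
  have y: "y \<bullet> e = 1" "\<And>k. k \<in> Basis \<Longrightarrow> k \<noteq> e \<Longrightarrow> y \<bullet> k = x \<bullet> k"
    using e by (auto simp: y_def inner_add_left inner_Basis)
  have "P y = P x" using \<open>\<And>t. P (x + t *\<^sub>R e) = P x\<close> by (simp add: y_def)
  moreover have "\<psi> (y \<bullet> e) = 1" by (simp add: y \<psi>_def step_eq_1)
  ultimately have "probe e f j y \<noteq> 0"
    using assms * \<open>probe e f j = (\<lambda>x. \<psi> (x \<bullet> e) * P x)\<close> by auto
  from probe_support[OF this] y f ef
  show "\<bar>x \<bullet> f - ctr j\<bar> < rad j" "\<And>k. k \<in> Basis - {e, f} \<Longrightarrow> \<bar>x \<bullet> k\<bar> < rad j" by auto
qed

text \<open>The integrand is continuous and nonnegative, so one point where it is positive suffices: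
  the set where it is nonzero is then open and nonempty, hence not negligible. The mean value
  theorem yields a height \<open>z\<close> with slope exactly 1.\<close>

lemma jump_pos: "jump e f j > 0"
proof -
  let ?F = "\<lambda>x. step' (x \<bullet> e) * probe e f j x"
  have sm: "smooth_fun (\<lambda>x::'a. step' (x \<bullet> e))"
    using smooth_fun_coord[OF smooth_fun_pderiv[OF smooth_fun_step, of 1], of 0 1 e] by simp
  have F0: "?F x \<ge> 0" for x by (simp add: step'_nonneg probe_bounds)
  have I: "integrable lebesgue ?F"
    by (rule integrable_test_fun[OF test_fun_mult_smooth[OF test_fun_probe sm]])
  have "jump e f j \<noteq> 0"
  proof
    assume "jump e f j = 0"
    then have "AE x in lebesgue. ?F x = 0"
      unfolding jump_def using integral_nonneg_eq_0_iff_AE[OF I] F0 by simp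
    then have "negligible {x. ?F x \<noteq> 0}"
      unfolding eventually_ae_filter_negligible using negligible_subset by blast
    moreover have "open {x. ?F x \<noteq> 0}"
      using smooth_fun_continuous_on[OF smooth_fun_mult[OF sm smooth_fun_probe], of UNIV]
      by (intro open_Collect_neq continuous_on_const) auto
    moreover obtain z where z: "0 < z" "z < 1" "step' z = 1"
      using MVT2[of 0 1 step step'] step_deriv by (auto simp: step_eq_0 step_eq_1)
    have "corner e f (ctr j) 0 z \<in> {x. ?F x \<noteq> 0}"
    proof -
      let ?w = "corner e f (ctr j) 0 z"
      have w: "?w \<bullet> e = z" "\<And>k. k \<in> Basis \<Longrightarrow> k \<noteq> e \<Longrightarrow> ?w \<bullet> k = (if k = f then ctr j else 0)"
        using e by (simp_all add: corner_inner[OF e f ef])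
      have "bump (rad j) > 0" using bump_pos_iff ctr_rad_bounds(3) by blast
      then have "probe e f j ?w \<noteq> 0"
        unfolding probe_def using z by (auto simp: w step_eq_1)
      then show ?thesis using z by (simp add: w)
    qed
    ultimately show False using open_not_negligible by blast
  qed
  moreover have "jump e f j \<ge> 0" unfolding jump_def by (intro integral_nonneg_AE AE_I2 F0)
  ultimately show ?thesis by simp
qed

end

context rooms
begin

text \<open>Given a constant \<open>C\<close>, the room with \<open>j \<ge> C\<close> refutes it;
  this is why the factor \<open>real j + 1\<close> stands in \<open>small\<close>. The term
  \<open>8 * d j\<close> bounds the volume of a corridor, which is
  \<open>4 * (2 * d j) ^ (DIM('a) - 1)\<close>.\<close>

lemma not_L_ext_domain_\<Omega>:
  fixes p q D :: real
  assumes q: "1 \<le> q" and p: "1 \<le> p" and D: "\<And>t. \<bar>step' t\<bar> \<le> D"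
    and small: "\<And>j. (D powr p * (8 * d j)) powr (1 / p) * (real j + 1) < jump e f j / 2"
  shows "\<not> L_ext_domain \<Omega> p q"
proof
  assume "L_ext_domain \<Omega> p q"
  then obtain E C where C: "C > 0" and E: "\<And>u. L1p \<Omega> p u \<Longrightarrow> L1p UNIV q (E u) \<and>
      (AE x in lebesgue. x \<in> \<Omega> \<longrightarrow> E u x = u x) \<and> L1p_seminorm UNIV q (E u) \<le> C * L1p_seminorm \<Omega> p u"
    unfolding L_ext_domain_def by auto
  obtain j where j: "C \<le> real j" using real_arch_simple by blast
  have D0: "D \<ge> 0" using D[of 0] by linarith
  have dim: "DIM('a) - 1 \<ge> 1"
  proof -
    have "card {e, f} \<le> DIM('a)" using e f by (intro card_mono) auto
    then show ?thesis using ef by simp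
  qed
  have small_power: "(2 * t) ^ (DIM('a) - 1) \<le> 2 * t" if "0 \<le> t" "t \<le> 1/16" for t :: real
    using power_decreasing[OF dim, of "2 * t"] that by simp
  \<comment> \<open>A function smooth on the whole space, so its weak gradient is the classical one.
    The plateau falls off between radius \<open>rad j\<close> and \<open>2 * rad j\<close>, where
    there are no other rooms or corridors, and in the hall the step is 0. Within \<Omega> the
    gradient therefore lives in corridor \<open>j\<close> alone.\<close>
  define u where "u x = step (0 + 1 * (x \<bullet> e)) * plateau (ctr j) (rad j) (0 + 1 * (x \<bullet> f))" for x
  have u: "u x = step (x \<bullet> e) * plateau (ctr j) (rad j) (x \<bullet> f)" for x by (simp add: u_def)
  have smu: "smooth_fun u"
    unfolding u_def[abs_def] by (intro smooth_fun_mult smooth_fun_coord smooth_fun_step smooth_fun_plateau)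
  note wgu = weak_grad_smooth[OF smu, of \<Omega>]
  have pl1: "plateau (ctr j) (rad j) (x \<bullet> f) = 1" if "\<bar>x \<bullet> f - ctr j\<bar> < rad j" for x
    using plateau_eq_1 ctr_rad_bounds(3) that by blast
  have pl0: "plateau (ctr j) (rad j) (x \<bullet> f) = 0" if "\<bar>x \<bullet> f - ctr k\<bar> < rad k" "k \<noteq> j" for x k
    using ctr_separated[OF that(2)] that(1) ctr_rad_bounds(3)[of j] ctr_rad_bounds(3)[of k]
    by (intro plateau_eq_0) auto
  have grad_corridor: "grad u x = step' (x \<bullet> e) *\<^sub>R e" if x: "x \<in> corridor j" for x
  proof -
    have sm: "smooth_fun (\<lambda>y::'a. step (y \<bullet> e))" using smooth_fun_coord[OF smooth_fun_step, of 0 1 e] by simp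
    have "grad u x = grad (\<lambda>y. step (y \<bullet> e)) x"
    proof (rule grad_cong_open[OF _ x _ sm])
      show "open (corridor j)" by (simp add: corridor_def open_col)
      fix y assume "y \<in> corridor j"
      then have "\<bar>y \<bullet> f - ctr j\<bar> < rad j" using d(2)[of j] by (auto simp: corridor_def mem_col)
      then show "u y = step (y \<bullet> e)" by (simp add: u pl1)
    qed
    then show ?thesis by (simp add: grad_coord[OF smooth_fun_step e])
  qed
  have grad_zero: "grad u x = 0" if x: "x \<in> \<Omega>" "x \<notin> corridor j" for x
  proof -
    have *: "grad u x = 0" if "open S" "x \<in> S" "\<And>y. y \<in> S \<Longrightarrow> u y = c" for S c
      using grad_cong_open[OF that(1,2), of u "\<lambda>_. c"] that(3) by (simp add: smooth_fun_const grad_const)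
    consider "x \<in> hall" | k where "x \<in> room k" | k where "x \<in> corridor k" "k \<noteq> j"
      using x by (auto simp: \<Omega>_def)
    then show ?thesis
    proof cases
      case 1
      show ?thesis
        by (rule *[of hall 0]) (use 1 in \<open>auto simp: hall_def open_col mem_col u step_eq_0\<close>)
    next
      case (2 k)
      show ?thesis
      proof (rule *[of "room k" "if k = j then 1 else 0"])
        show "u y = (if k = j then 1 else 0)" if "y \<in> room k" for y
          using that pl1[of y] pl0[of y k] by (auto simp: room_def mem_col u step_eq_1)
      qed (use 2 in \<open>auto simp: room_def open_col\<close>)
    next
      case (3 k)
      show ?thesis
      proof (rule *[of "corridor k" 0])
        show "u y = 0" if "y \<in> corridor k" for y
        proof -
          have "\<bar>y \<bullet> f - ctr k\<bar> < rad k" using that d(2)[of k] by (auto simp: corridor_def mem_col)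
          then show ?thesis using pl0 3 by (simp add: u)
        qed
      qed (use 3 in \<open>auto simp: corridor_def open_col\<close>)
    qed
  qed
  have int_u: "(\<integral>\<^sup>+x\<in>\<Omega>. ennreal (\<bar>norm (wgrad \<Omega> u x)\<bar> powr p) \<partial>lebesgue) \<le> ennreal (D powr p * (8 * d j))"
  proof -
    have "(\<integral>\<^sup>+x\<in>\<Omega>. ennreal (\<bar>norm (wgrad \<Omega> u x)\<bar> powr p) \<partial>lebesgue)
        = (\<integral>\<^sup>+x\<in>\<Omega>. ennreal (norm (grad u x) powr p) \<partial>lebesgue)"
      by (rule Lp_pow_wgrad_eq[OF open_\<Omega> wgu])
    also have "\<dots> \<le> (\<integral>\<^sup>+x. ennreal (D powr p) * indicator (corridor j) x \<partial>lebesgue)"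
    proof (rule nn_integral_mono)
      fix x :: 'a
      have "norm (grad u x) powr p \<le> D powr p" if "x \<in> corridor j"
        using grad_corridor[OF that] D[of "x \<bullet> e"] e p by (intro powr_mono2) auto
      then show "ennreal (norm (grad u x) powr p) * indicator \<Omega> x \<le> ennreal (D powr p) * indicator (corridor j) x"
        using grad_zero[of x] p by (cases "x \<in> corridor j"; cases "x \<in> \<Omega>") (auto simp: ennreal_leI)
    qed
    also have "\<dots> = ennreal (D powr p) * emeasure lebesgue (corridor j)"
      by (rule nn_integral_cmult_indicator) (simp add: corridor_def column_def)
    also have "\<dots> = ennreal (D powr p * (4 * (2 * d j) ^ (DIM('a) - 1)))"
      using d(1)[of j] by (simp add: corridor_def emeasure_col ennreal_mult)
    also have "\<dots> \<le> ennreal (D powr p * (8 * d j))"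
    proof (intro ennreal_leI mult_left_mono)
      have "(2 * d j) ^ (DIM('a) - 1) \<le> 2 * d j"
        using d[of j] ctr_rad_bounds(4)[of j] by (intro small_power) linarith+
      then show "4 * (2 * d j) ^ (DIM('a) - 1) \<le> 8 * d j" by linarith
    qed simp
    finally show ?thesis .
  qed
  have wdu: "weakly_diff \<Omega> u" using wgu by (auto simp: weakly_diff_def)
  have L1u: "L1p \<Omega> p u"
    unfolding L1p_def Lp_on_def
    using wgu wdu wgrad_measurable[OF open_\<Omega> wdu] int_u by (auto simp: weak_grad_def le_less_trans)
  have semi_u: "L1p_seminorm \<Omega> p u \<le> (D powr p * (8 * d j)) powr (1 / p)"
  proof -
    have "Lp_pow \<Omega> p (\<lambda>x. norm (wgrad \<Omega> u x)) \<le> enn2real (ennreal (D powr p * (8 * d j)))"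
      unfolding Lp_pow_def by (intro enn2real_mono int_u) simp
    also have "\<dots> = D powr p * (8 * d j)" using d(1)[of j] by (intro enn2real_ennreal) simp
    finally show ?thesis unfolding L1p_seminorm_def using p by (intro powr_mono2) (auto simp: Lp_pow_def)
  qed
  define v where "v = E u"
  define G where "G = wgrad UNIV v"
  have L1v: "L1p UNIV q v" and v_eq: "AE x in lebesgue. x \<in> \<Omega> \<longrightarrow> v x = u x"
    and semi_v: "L1p_seminorm UNIV q v \<le> C * L1p_seminorm \<Omega> p u"
    using E[OF L1u] by (auto simp: v_def)
  have wgv: "weak_grad UNIV v G"
    unfolding G_def using L1v by (intro wgrad_weak_grad) (simp add: L1p_def)
  have mv: "v \<in> borel_measurable lebesgue" and mG: "G \<in> borel_measurable lebesgue"
    using L1loc_measurable[OF open_UNIV, of v] L1loc_measurable[OF open_UNIV, of G] wgv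
    by (auto simp: weak_grad_def)
  define I where "I = Lp_pow UNIV q (\<lambda>x. norm (G x))"
  have intG: "(\<integral>\<^sup>+x. ennreal (norm (G x) powr q) \<partial>lebesgue) = ennreal I"
    using L1v by (simp add: L1p_def Lp_on_def I_def Lp_pow_def G_def)
  have I0: "I \<ge> 0" by (simp add: I_def Lp_pow_def)
  have Iint: "integrable lebesgue (\<lambda>x. norm (G x) powr q)" "(LINT x|lebesgue. norm (G x) powr q) = I"
  proof -
    have m: "(\<lambda>x. norm (G x) powr q) \<in> borel_measurable lebesgue" using mG by measurable
    show "integrable lebesgue (\<lambda>x. norm (G x) powr q)"
      by (rule integrableI_bounded[OF m]) (simp add: intG)
    show "(LINT x|lebesgue. norm (G x) powr q) = I"
      using I0 by (subst integral_eq_nn_integral[OF m]) (simp_all add: intG)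
  qed
  let ?\<Phi> = "probe e f j"
  note t\<Phi> = test_fun_probe[OF e f ef, of j]
  define L where "L = jump e f j / 2"
  have L: "L > 0" using jump_pos[OF e f ef] by (simp add: L_def)
  have smS: "smooth_fun (\<lambda>x::'a. step (x \<bullet> e))" using smooth_fun_coord[OF smooth_fun_step, of 0 1 e] by simp
  have "jump e f j = (LINT x|lebesgue. pderiv_i (\<lambda>x. step (x \<bullet> e)) e x * ?\<Phi> x)"
    unfolding jump_def using pderiv_i_coord[OF smooth_fun_step, of 0 1 e e] e by simp
  also have "\<dots> = - (LINT x|lebesgue. step (x \<bullet> e) * pderiv_i ?\<Phi> e x)"
    using integral_by_parts_test[OF smS t\<Phi> e] by simp
  \<comment> \<open>Where the \<open>e\<close>-derivative of the probe is nonzero, the point lies in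
    the hall or in room \<open>j\<close>, and there \<open>v = u = step\<close> almost everywhere.
    So any extension may replace the step function, whatever it does elsewhere.\<close>
  also have "(LINT x|lebesgue. step (x \<bullet> e) * pderiv_i ?\<Phi> e x) = (LINT x|lebesgue. v x * pderiv_i ?\<Phi> e x)"
  proof (rule integral_cong_AE)
    note md = test_fun_measurable[OF test_fun_pderiv[OF t\<Phi> e]]
    show "(\<lambda>x. step (x \<bullet> e) * pderiv_i ?\<Phi> e x) \<in> borel_measurable lebesgue"
      by (intro borel_measurable_times md continuous_imp_measurable_lebesgue smooth_fun_continuous_on smS)
    show "(\<lambda>x. v x * pderiv_i ?\<Phi> e x) \<in> borel_measurable lebesgue"
      by (intro borel_measurable_times md mv)
    show "AE x in lebesgue. step (x \<bullet> e) * pderiv_i ?\<Phi> e x = v x * pderiv_i ?\<Phi> e x"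
      using v_eq
    proof eventually_elim
      case (elim x)
      show ?case
      proof (cases "pderiv_i ?\<Phi> e x = 0")
        case False
        note x = pderiv_probe[OF e f ef False]
        have "x \<in> \<Omega> \<and> u x = step (x \<bullet> e)"
          using x(3)
        proof
          assume t: "-1 < x \<bullet> e \<and> x \<bullet> e < 0"
          have "x \<in> col (ctr j) (rad j) (-1) 3" using x t by (auto simp: mem_col)
          then have "x \<in> hall"
            unfolding hall_def by (rule col_subset) (use t ctr_rad_bounds[of j] in auto)
          then show ?thesis using room_subset(1) t by (auto simp: u step_eq_0)
        next
          assume t: "2 < x \<bullet> e \<and> x \<bullet> e < 3"
          then have "x \<in> room j" using x by (auto simp: room_def mem_col)
          then show ?thesis using room_subset(2) pl1[OF x(1)] by (auto simp: u)
        qed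
        then show ?thesis using elim by simp
      qed simp
    qed
  qed
  also have "(LINT x|lebesgue. v x * pderiv_i ?\<Phi> e x) = - (LINT x|lebesgue. (G x \<bullet> e) * ?\<Phi> x)"
    using wgv t\<Phi> e by (simp add: weak_grad_def set_lebesgue_integral_def)
  finally have jump_eq: "2 * L = (LINT x|lebesgue. (G x \<bullet> e) * ?\<Phi> x)" by (simp add: L_def)
  \<comment> \<open>The Bochner integral of a non-integrable function is 0 by convention, which a
    positive value excludes.\<close>
  have int1: "integrable lebesgue (\<lambda>x. (G x \<bullet> e) * ?\<Phi> x)"
  proof (rule ccontr)
    assume "\<not> integrable lebesgue (\<lambda>x. (G x \<bullet> e) * ?\<Phi> x)"
    then show False using not_integrable_integral_eq jump_eq L by force
  qed
  let ?B = "col (ctr j) (rad j) (-1) 3"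
  have vB: "emeasure lebesgue ?B = ennreal (4 * (2 * rad j) ^ (DIM('a) - 1))"
    using emeasure_col[of "-1" 3 "rad j" "ctr j"] ctr_rad_bounds(3)[of j] by simp
  have mB: "?B \<in> lmeasurable" by (simp add: column_def)
  have B: "measure lebesgue ?B \<le> 1"
  proof -
    have "measure lebesgue ?B = 4 * (2 * rad j) ^ (DIM('a) - 1)"
      unfolding measure_def vB using ctr_rad_bounds(3)[of j] by (intro enn2real_ennreal) simp
    also have "\<dots> \<le> 4 * (2 * rad j)" using small_power[OF less_imp_le ctr_rad_bounds(4), OF ctr_rad_bounds(3), of j]
      by (intro mult_left_mono) auto
    finally show ?thesis using ctr_rad_bounds(4)[of j] by linarith
  qed
  \<comment> \<open>Interpolation with threshold \<open>L\<close>, half the jump. The volume term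
    costs at most \<open>L\<close>, since \<open>?B\<close> has measure at most 1, so half of the
    jump survives as a lower bound for the gradient term.\<close>
  have "2 * L \<le> (LINT x|lebesgue. L * indicator ?B x + L powr (1 - q) * norm (G x) powr q)"
    unfolding jump_eq
  proof (rule integral_mono[OF int1])
    show "integrable lebesgue (\<lambda>x. L * indicat_real ?B x + L powr (1 - q) * norm (G x) powr q)"
      using mB Iint(1) by (intro Bochner_Integration.integrable_add integrable_mult_right)
        (simp_all add: lmeasurable_iff_integrable)
    fix x :: 'a
    show "(G x \<bullet> e) * ?\<Phi> x \<le> L * indicator ?B x + L powr (1 - q) * norm (G x) powr q"
    proof (cases "?\<Phi> x = 0")
      case True
      then show ?thesis using L by (simp add: indicator_def)
    next
      case False
      then have xB: "x \<in> ?B" using probe_support[OF e f ef False] by (auto simp: mem_col)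
      have "(G x \<bullet> e) * ?\<Phi> x \<le> norm (G x) * 1"
        using probe_bounds[of e f j x] Basis_le_norm[OF e, of "G x"] by (intro mult_mono) auto
      also have "norm (G x) * 1 \<le> L + L powr (1 - q) * norm (G x) powr q"
        using powr_le_interpolate[OF _ L _ q, of "norm (G x)"] L by simp
      finally show ?thesis using xB by simp
    qed
  qed
  also have "\<dots> = L * measure lebesgue ?B + L powr (1 - q) * I"
    using mB Iint by (subst Bochner_Integration.integral_add) (simp_all add: lmeasurable_iff_integrable)
  also have "\<dots> \<le> L * 1 + L powr (1 - q) * I" using B L by (intro add_right_mono mult_left_mono) auto
  finally have "L \<le> L powr (1 - q) * I" by simp
  then have "L powr (q - 1) * L \<le> L powr (q - 1) * (L powr (1 - q) * I)" by (intro mult_left_mono) auto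
  moreover have "L powr (q - 1) * L = L powr q" using L powr_mult_base[of L "q - 1"] by (simp add: mult.commute)
  moreover have "L powr (q - 1) * (L powr (1 - q) * I) = I"
    using L by (simp add: mult.assoc[symmetric] powr_add[symmetric])
  ultimately have "L powr q \<le> I" by simp
  then have "(L powr q) powr (1 / q) \<le> I powr (1 / q)" using q by (intro powr_mono2) auto
  then have "L \<le> L1p_seminorm UNIV q v"
    using L q by (simp add: powr_powr L1p_seminorm_def I_def G_def)
  also have "\<dots> \<le> (real j + 1) * (D powr p * (8 * d j)) powr (1 / p)"
    using semi_v mult_mono[OF _ semi_u, of C "real j + 1"] j C by (force simp: L1p_seminorm_def)
  also have "\<dots> < L" using small[of j] by (simp add: L_def mult.commute)
  finally show False by simp
qed

end

theorem theorem1p4: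
  fixes p q :: real
  assumes "DIM('a::euclidean_space) \<ge> 3"
    and "1 \<le> q" and "q < real DIM('a) - 1"
    and "(real DIM('a) - 1) * q / (real DIM('a) - 1 - q) < p"
  shows "\<exists>\<Omega> :: 'a set. is_domain \<Omega> \<and> bounded \<Omega> \<and> W_ext_domain \<Omega> p q \<and> \<not> L_ext_domain \<Omega> p q"
proof -
  define m where "m = real DIM('a) - 1"
  define \<gamma> where "\<gamma> = m * (1 - q / p) - q"
  have mq: "m - q > 0" using assms(3) by (simp add: m_def)
  have "m * q / (m - q) < p" using assms(4) by (simp add: m_def)
  then have mp: "m * q < p * (m - q)" using mq by (simp add: field_simps)
  have p0: "p > 0"
  proof (rule ccontr)
    assume "\<not> p > 0"
    then have "p * (m - q) \<le> 0" using mq by (simp add: mult_nonpos_nonneg)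
    moreover have "m * q > 0" using mq assms(2) by simp
    ultimately show False using mp by linarith
  qed
  \<comment> \<open>Multiplied by \<open>p\<close>, positivity of \<open>\<gamma>\<close> reads
    \<open>m * q < p * (m - q)\<close>, which is the assumed lower bound on
    \<open>p\<close>.\<close>
  have \<gamma>: "\<gamma> > 0" using mp p0 by (simp add: \<gamma>_def field_simps)
  have pq: "q < p"
  proof (rule ccontr)
    assume "\<not> q < p"
    then have "p * (m - q) \<le> q * (m - q)" using mq by (intro mult_right_mono) auto
    then have "m * q < q * (m - q)" using mp by linarith
    then have "q * q < 0" by (simp add: algebra_simps)
    then show False using not_square_less_zero[of q] by blast
  qed
  obtain e f :: 'a where ef: "e \<in> Basis" "f \<in> Basis" "e \<noteq> f"
  proof -
    have "\<not> card (Basis :: 'a set) \<le> Suc 0" using assms(1) by simp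
    then show thesis using that card_le_Suc0_iff_eq[OF finite_Basis] by blast
  qed
  obtain D where D: "D \<ge> 1" "\<And>t. \<bar>step' t\<bar> \<le> D" using step'_bounded by blast
  \<comment> \<open>The three entries keep corridors inside their rooms, make the corridor costs at
    most (1/2)^j, and make the seminorm of the competitor small against the jump. Dividing the jump
    by 4 where 2 is needed yields the strict inequality.\<close>
  define d where "d j = min (rad j) (min (((1/2) ^ j * rad j powr q) powr (1 / \<gamma>))
      ((jump e f j / (4 * (real j + 1))) powr p / (8 * D powr p)))" for j
  have jp: "jump e f j > 0" for j by (rule jump_pos[OF ef])
  have d0: "0 < d j" "d j \<le> rad j" for j
    using ctr_rad_bounds(3)[of j] D(1) jp[of j] by (auto simp: d_def)
  interpret rooms e f d by unfold_locales (use ef d0 in auto)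
  have small1: "d j powr \<gamma> * rad j powr (- q) \<le> (1/2) ^ j" for j
  proof -
    have "d j powr \<gamma> \<le> (((1/2) ^ j * rad j powr q) powr (1 / \<gamma>)) powr \<gamma>"
      using d0[of j] \<gamma> by (intro powr_mono2) (auto simp: d_def)
    also have "\<dots> = (1/2) ^ j * rad j powr q" using \<gamma> ctr_rad_bounds(3)[of j] by (simp add: powr_powr)
    finally have "d j powr \<gamma> * rad j powr (- q) \<le> (1/2) ^ j * rad j powr q * rad j powr (- q)"
      by (rule mult_right_mono) simp
    also have "\<dots> = (1/2) ^ j" using ctr_rad_bounds(3)[of j] by (simp add: powr_minus)
    finally show ?thesis .
  qed
  have small2: "(D powr p * (8 * d j)) powr (1 / p) * (real j + 1) < jump e f j / 2" for j
  proof -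
    have "d j \<le> (jump e f j / (4 * (real j + 1))) powr p / (8 * D powr p)" by (simp add: d_def)
    then have "D powr p * (8 * d j) \<le> (jump e f j / (4 * (real j + 1))) powr p"
      using D(1) by (simp add: field_simps)
    then have "(D powr p * (8 * d j)) powr (1 / p) \<le> ((jump e f j / (4 * (real j + 1))) powr p) powr (1 / p)"
      using d0[of j] p0 by (intro powr_mono2) auto
    also have "\<dots> = jump e f j / (4 * (real j + 1))" using p0 jp[of j] by (simp add: powr_powr)
    finally have "(D powr p * (8 * d j)) powr (1 / p) * (real j + 1) \<le> jump e f j / (4 * (real j + 1)) * (real j + 1)"
      by (rule mult_right_mono) simp
    also have "\<dots> = jump e f j / 4" by (simp add: field_simps)
    also have "\<dots> < jump e f j / 2" using jp[of j] by simp
    finally show ?thesis .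
  qed
  have "W_ext_domain \<Omega> p q"
    using \<gamma> small1 by (intro W_ext_domain_\<Omega>[OF assms(2) pq]) (simp_all add: \<gamma>_def m_def)
  moreover have "\<not> L_ext_domain \<Omega> p q"
    using pq assms(2) by (intro not_L_ext_domain_\<Omega>[OF assms(2) _ D(2) small2]) auto
  ultimately show ?thesis using is_domain_\<Omega> bounded_\<Omega> by blast
qed

end
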